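(* Under the standing setting and assumptions (A.1)–(A.6) described in the context, there exist constants $c_0,\ldots,c_7>0$ such that for any $\delta\in(e^{-c_0\sqrt n},\,1-c_1e^{-c_2 n})$, if $p\ge c_3(n+k)$, $n\ge c_4\max\{k,s_k\}$ and $\|\theta^\star\|\le c_5$, $\|w\|\le c_5$, then with probability at least $1-c_6\delta$, $$\mathsf{Risk}(\hat\theta)\le \mathsf{Bias}+\mathsf{Variance}+\Xi,$$ where $$\mathsf{Bias}\le c_7\Big(\sum_{i\le k}\frac{(\theta^\star-\psi)_i^2}{\lambda_i}\Big(\frac{s_k}{n}\Big)^2+\sum_{i>k}\lambda_i(\theta^\star-\psi)_i^2\Big)\le \frac{2c_7\|\theta^\star-\psi\|^2 s_k}{n},$$ $$\mathsf{Variance}\le c_7\log(1/\delta)\Big(\frac{k}{n}+\frac{n}{R_k}\Big),$$ $$\Xi\le c_7\lambda_1\|\psi\|^2\Big[\frac{n}{R_k}+\frac{n^2}{r_k^2}+\frac{s_k}{n}+\frac{\log(1/\delta)}{n}+\frac{k^2}{n^2}\Big]\max\Big\{\sqrt{\tfrac{r_0}{n}},\tfrac{r_0}{n},\sqrt{\tfrac{\log(1/\delta)}{n}}\Big\}.$$ In particular $\mathsf{Risk}(\hat\theta)$ is at most the sum of the three displayed upper bounds.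
   Context: Setting: $p>n$. Data $(x_1,y_1),\dots,(x_n,y_n)$ and a test pair $(x,y)$ in $\mathbb R^p\times\mathbb R$. $X\in\mathbb R^{n\times p}$ has rows $x_i^\top$, $\mathbf y=(y_1,\dots,y_n)^\top$. $\theta^\star\in\arg\min_\theta\mathbb E[(y-x^\top\theta)^2]$, $\boldsymbol\epsilon=\mathbf y-X\theta^\star$. $\Sigma=\mathbb E[xx^\top]$, assumed (w.l.o.g.) diagonal with diagonal entries $\lambda_1\ge\dots\ge\lambda_p>0$. Assumptions: (A.1) the samples and $(x,y)$ are i.i.d.; (A.2) $x,y$ are mean zero; (A.3) $x=\Sigma^{1/2}u$ where $u$ has independent components, each $\sigma_x^2$-sub-Gaussian ($\mathbb E[e^{\phi^\top u}]\le e^{\sigma_x^2\|\phi\|^2/2}$ for all $\phi$); (A.4) there is an absolute constant $c$ such that for every unit $\phi\in\mathbb S^{n-1}$, all $a\le b$ and all $i\in[p]$, $\Pr[(\Sigma^{-1/2}X^\top\phi)_i\in[a,b]]\le c|b-a|$; (A.5) conditionally on $x$, $y-x^\top\theta^\star$ is $\sigma_y^2$-sub-Gaussian; (A.6) $\mathbb E[(y-x^\top\theta^\star)^2\mid x]=\sigma^2$. Here $\sigma_x,\sigma_y,\sigma$ are positive absolute constants and all constants may depend on them. Excess risk: $\mathsf{Risk}(\theta)=\mathbb E_{x,y}[(y-x^\top\theta)^2-(y-x^\top\theta^\star)^2]$ with $(x,y)$ an independent test pair. Estimator: given an initialization $\theta(0)\ne0$ of a balanced two-layer linear network, $w=\theta(0)/\sqrt{\|\theta(0)\|}$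 and $\hat\theta\in\arg\min_{\theta}\{\|\theta\|^{3/2}-w^\top\theta : \mathbf y=X\theta\}$. Effective ranks: for $S\subseteq[p]$, $s(S)=\sum_{i\in S}\lambda_i$, $r(S)=s(S)/\max_{i\in S}\lambda_i$, $R(S)=s(S)^2/\sum_{i\in S}\lambda_i^2$; for $j\ge0$, $s_j=\sum_{i>j}\lambda_i$, $r_j=s_j/\lambda_{j+1}$, $R_j=s_j^2/\sum_{i>j}\lambda_i^2$. For a fixed sufficiently large constant $b$ (chosen large relative to all other constants), $k=\min\{j\ge0: r_j\ge bn\}$. $\psi=\frac{2\sqrt\sigma\, n^{1/4}}{3 s_k^{1/4}}\,w$.
   Formalization: The middle inequality between the two Bias bounds can fail for large b (k=1, λ_1 near s_1/(bn), θ*−ψ along e_1), so it is not asserted; instead the risk is bounded by Variance and Ξ bounds plus each of the two Bias bounds separately. Existence of k is assumed; constants may depend on b. *)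

theory Defs
  imports "HOL-Probability.Probability" "HOL-Probability.Conditional_Expectation"
begin

text \<open>Coordinates are 0-indexed: the paper's lambda_i, x_i, theta_i (i = 1..p)
  are lam (i-1), x (i-1), theta (i-1).  Vectors in R^p are functions nat => real,
  only the coordinates below p matter.\<close>

type_synonym pt = "(nat \<Rightarrow> real) \<times> real"

definition ip :: "nat \<Rightarrow> (nat \<Rightarrow> real) \<Rightarrow> (nat \<Rightarrow> real) \<Rightarrow> real" where
  "ip p u v = (\<Sum>i<p. u i * v i)"

definition nrm :: "nat \<Rightarrow> (nat \<Rightarrow> real) \<Rightarrow> real" where
  "nrm p u = sqrt (ip p u u)"

definition pt_space :: "nat \<Rightarrow> pt measure" where
  "pt_space p = pair_measure (PiM {..<p} (\<lambda>_. (borel :: real measure))) (borel :: real measure)"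

definition sample :: "nat \<Rightarrow> pt measure \<Rightarrow> (nat \<Rightarrow> pt) measure" where
  "sample n D = PiM {..<n} (\<lambda>_. D)"

definition xalg :: "nat \<Rightarrow> pt measure \<Rightarrow> pt measure" where
  "xalg p D = vimage_algebra (space D) fst (PiM {..<p} (\<lambda>_. (borel :: real measure)))"

definition noise :: "nat \<Rightarrow> (nat \<Rightarrow> real) \<Rightarrow> pt \<Rightarrow> real" where
  "noise p th z = snd z - ip p (fst z) th"

definition setting ::
  "real \<Rightarrow> real \<Rightarrow> real \<Rightarrow> real \<Rightarrow> nat \<Rightarrow> nat \<Rightarrow> pt measure \<Rightarrow> (nat \<Rightarrow> real) \<Rightarrow> (nat \<Rightarrow> real) \<Rightarrow> bool"
  where
  "setting sx sy sig c n p D lam th \<longleftrightarrow>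
     n < p \<and> prob_space D \<and> sets D = sets (pt_space p) \<and>
     (\<forall>i j. i \<le> j \<longrightarrow> j < p \<longrightarrow> lam j \<le> lam i) \<and> (\<forall>i<p. 0 < lam i) \<and>
     \<comment> \<open>(A.2) mean zero\<close>
     (\<forall>i<p. integrable D (\<lambda>z. fst z i) \<and> integral\<^sup>L D (\<lambda>z. fst z i) = 0) \<and>
     integrable D snd \<and> integral\<^sup>L D snd = 0 \<and>
     \<comment> \<open>Sigma = E[x x^T] = diag(lam)\<close>
     (\<forall>i<p. \<forall>j<p. integrable D (\<lambda>z. fst z i * fst z j) \<and>
         integral\<^sup>L D (\<lambda>z. fst z i * fst z j) = (if i = j then lam i else 0)) \<and>
     \<comment> \<open>(A.3) u = Sigma^(-1/2) x has independent components, sx^2-sub-Gaussian\<close>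
     prob_space.indep_vars D (\<lambda>_. borel) (\<lambda>i z. fst z i / sqrt (lam i)) {..<p} \<and>
     (\<forall>\<phi>. integrable D (\<lambda>z. exp (\<Sum>i<p. \<phi> i * (fst z i / sqrt (lam i)))) \<and>
         integral\<^sup>L D (\<lambda>z. exp (\<Sum>i<p. \<phi> i * (fst z i / sqrt (lam i))))
           \<le> exp (sx\<^sup>2 * ip p \<phi> \<phi> / 2)) \<and>
     \<comment> \<open>(A.4) small-ball condition on Sigma^(-1/2) X^T phi\<close>
     (\<forall>\<phi>. (\<Sum>j<n. (\<phi> j)\<^sup>2) = 1 \<longrightarrow> (\<forall>a b. a \<le> b \<longrightarrow> (\<forall>i<p.
         measure (sample n D) {\<omega> \<in> space (sample n D).
            (\<Sum>j<n. \<phi> j * fst (\<omega> j) i) / sqrt (lam i) \<in> {a..b}} \<le> c * \<bar>b - a\<bar>))) \<and>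
     \<comment> \<open>theta* minimizes the population square loss\<close>
     integrable D (\<lambda>z. (snd z)\<^sup>2) \<and>
     (\<forall>\<theta>. integral\<^sup>L D (\<lambda>z. (snd z - ip p (fst z) th)\<^sup>2)
            \<le> integral\<^sup>L D (\<lambda>z. (snd z - ip p (fst z) \<theta>)\<^sup>2)) \<and>
     \<comment> \<open>(A.5) conditionally on x, the noise is sy^2-sub-Gaussian\<close>
     (\<forall>t. integrable D (\<lambda>z. exp (t * noise p th z)) \<and>
        (AE z in D. real_cond_exp D (xalg p D) (\<lambda>z. exp (t * noise p th z)) z \<le> exp (sy\<^sup>2 * t\<^sup>2 / 2))) \<and>
     \<comment> \<open>(A.6) conditional noise variance sig^2\<close>
     integrable D (\<lambda>z. (noise p th z)\<^sup>2) \<and>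
     (AE z in D. real_cond_exp D (xalg p D) (\<lambda>z. (noise p th z)\<^sup>2) z = sig\<^sup>2)"

text \<open>Effective ranks (paper: s_j = sum_{i>j} lambda_i, r_j = s_j/lambda_{j+1}, R_j).\<close>
definition s_tail :: "nat \<Rightarrow> (nat \<Rightarrow> real) \<Rightarrow> nat \<Rightarrow> real" where
  "s_tail p lam j = (\<Sum>i\<in>{j..<p}. lam i)"

definition r_tail :: "nat \<Rightarrow> (nat \<Rightarrow> real) \<Rightarrow> nat \<Rightarrow> real" where
  "r_tail p lam j = s_tail p lam j / lam j"

definition R_tail :: "nat \<Rightarrow> (nat \<Rightarrow> real) \<Rightarrow> nat \<Rightarrow> real" where
  "R_tail p lam j = (s_tail p lam j)\<^sup>2 / (\<Sum>i\<in>{j..<p}. (lam i)\<^sup>2)"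

definition kidx :: "real \<Rightarrow> nat \<Rightarrow> nat \<Rightarrow> (nat \<Rightarrow> real) \<Rightarrow> nat" where
  "kidx b n p lam = (LEAST j. b * real n \<le> r_tail p lam j)"

definition risk :: "nat \<Rightarrow> pt measure \<Rightarrow> (nat \<Rightarrow> real) \<Rightarrow> (nat \<Rightarrow> real) \<Rightarrow> real" where
  "risk p D th \<theta> = integral\<^sup>L D (\<lambda>z. (snd z - ip p (fst z) \<theta>)\<^sup>2 - (snd z - ip p (fst z) th)\<^sup>2)"

definition initw :: "nat \<Rightarrow> (nat \<Rightarrow> real) \<Rightarrow> (nat \<Rightarrow> real)" where
  "initw p \<theta>0 = (\<lambda>i. \<theta>0 i / sqrt (nrm p \<theta>0))"

definition is_est :: "nat \<Rightarrow> nat \<Rightarrow> (nat \<Rightarrow> pt) \<Rightarrow> (nat \<Rightarrow> real) \<Rightarrow> (nat \<Rightarrow> real) \<Rightarrow> bool" where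
  "is_est n p \<omega> w \<theta> \<longleftrightarrow>
     (\<forall>i\<ge>p. \<theta> i = 0) \<and> (\<forall>j<n. snd (\<omega> j) = ip p (fst (\<omega> j)) \<theta>) \<and>
     (\<forall>\<theta>'. (\<forall>i\<ge>p. \<theta>' i = 0) \<longrightarrow> (\<forall>j<n. snd (\<omega> j) = ip p (fst (\<omega> j)) \<theta>') \<longrightarrow>
        nrm p \<theta> powr (3/2) - ip p w \<theta> \<le> nrm p \<theta>' powr (3/2) - ip p w \<theta>')"

definition psi :: "real \<Rightarrow> real \<Rightarrow> nat \<Rightarrow> nat \<Rightarrow> (nat \<Rightarrow> real) \<Rightarrow> (nat \<Rightarrow> real) \<Rightarrow> (nat \<Rightarrow> real)" where
  "psi sig b n p lam w =
     (\<lambda>i. 2 * sqrt sig * real n powr (1/4) / (3 * s_tail p lam (kidx b n p lam) powr (1/4)) * w i)"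

definition bias_bd1 :: "real \<Rightarrow> nat \<Rightarrow> nat \<Rightarrow> (nat \<Rightarrow> real) \<Rightarrow> nat \<Rightarrow> (nat \<Rightarrow> real) \<Rightarrow> (nat \<Rightarrow> real) \<Rightarrow> real" where
  "bias_bd1 c7 n p lam k th ps =
     c7 * ((\<Sum>i<k. (th i - ps i)\<^sup>2 / lam i * (s_tail p lam k / real n)\<^sup>2)
           + (\<Sum>i\<in>{k..<p}. lam i * (th i - ps i)\<^sup>2))"

definition bias_bd2 :: "real \<Rightarrow> nat \<Rightarrow> nat \<Rightarrow> (nat \<Rightarrow> real) \<Rightarrow> nat \<Rightarrow> (nat \<Rightarrow> real) \<Rightarrow> (nat \<Rightarrow> real) \<Rightarrow> real" where
  "bias_bd2 c7 n p lam k th ps =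
     2 * c7 * (nrm p (\<lambda>i. th i - ps i))\<^sup>2 * s_tail p lam k / real n"

definition var_bd :: "real \<Rightarrow> real \<Rightarrow> nat \<Rightarrow> nat \<Rightarrow> (nat \<Rightarrow> real) \<Rightarrow> nat \<Rightarrow> real" where
  "var_bd c7 \<delta> n p lam k =
     c7 * ln (1 / \<delta>) * (real k / real n + real n / R_tail p lam k)"

definition xi_bd :: "real \<Rightarrow> real \<Rightarrow> nat \<Rightarrow> nat \<Rightarrow> (nat \<Rightarrow> real) \<Rightarrow> nat \<Rightarrow> (nat \<Rightarrow> real) \<Rightarrow> real" where
  "xi_bd c7 \<delta> n p lam k ps =
     c7 * lam 0 * (nrm p ps)\<^sup>2 *
       (real n / R_tail p lam k + (real n)\<^sup>2 / (r_tail p lam k)\<^sup>2 + s_tail p lam k / real n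
        + ln (1 / \<delta>) / real n + (real k)\<^sup>2 / (real n)\<^sup>2) *
       max (sqrt (r_tail p lam 0 / real n))
         (max (r_tail p lam 0 / real n) (sqrt (ln (1 / \<delta>) / real n)))"

end

theory Submission
  imports Defs "Jordan_Normal_Form.Determinant"
begin

text \<open>
  Stationarity says that \<open>\<theta> - \<tau> w\<close> is orthogonal to the kernel of the design \<open>X\<close>, where
  \<open>\<tau> = 2/3 * sqrt (nrm p \<theta>)\<close>. Hence \<open>\<theta> - \<theta>\<^sup>*\<close> is the projection of \<open>\<tau> w - \<theta>\<^sup>*\<close> onto that kernel plus
  the minimum-norm interpolator of the noise. The vector \<open>\<tau> w\<close> is replaced by \<open>\<psi>\<close> at the cost of a relative
  error, because the norm of \<open>\<theta>\<close> concentrates around \<open>sig * sqrt (n / s)\<close>, with \<open>s\<close> the tail sum of the eigenvalues.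

  Everything about \<open>X\<close> is deduced from two facts: the tail part of the Gram matrix is close to \<open>s\<close> times the
  identity in operator norm, and the head part is well conditioned after whitening. Both come from Bernstein's inequality
  over a net. The projection error of a fixed vector and the trace of the variance form are then energy estimates
  for the normal equations. The quadratic form in the noise is bounded conditionally on \<open>X\<close>.

  In the third error term the spectral factor enters only through \<open>s / n \<le> lam 0 * r_tail p lam 0 / n\<close>: the vector \<open>\<psi>\<close> is
  fixed, so its projection obeys the same bias bound, and no concentration of the full sample covariance is involved.
\<close>

section \<open>Vectors, bilinear forms and nets\<close>

text \<open>The working unknown is the multiplier \<open>\<mu>\<close> in
  \<open>v + xT n x \<mu>\<close>. Splitting the coordinates at \<open>k\<close> turns
  \<open>X (v + X^T \<mu>) = 0\<close> into an equation between a nearly scalar operator on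
  \<open>\<mu>\<close> and the head part of the error; testing it with \<open>\<mu>\<close> avoids
  any block inversion formula. The noise is sub-Gaussian only given the covariates, on all of which
  the variance form depends. Its exponential moment is therefore integrated row by row, and trading
  operator norm for trace costs the factor \<open>ln (1 / \<delta>)\<close> seen in the variance
  bound. The squared relative error of the factor of \<open>w\<close> itself contains a variance
  term. That part is charged to the variance bound, using that the bias of \<open>\<psi>\<close> is
  bounded by a constant; the rest goes to the third error term. The constant \<open>b\<close> must
  be large because a union bound over exponentially many net points leaves a tail deviation of
  relative size \<open>C1 * (sqrt (n / R_k) + n / r_k)\<close>, at most
  \<open>2 * C1 / sqrt b\<close>. Conversely \<open>c7\<close> grows with \<open>b\<close>, since
  head eigenvalues are bounded below only by \<open>s / (b n)\<close>.\<close>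

lemma ip_commute: "ip d u v = ip d v u"
  by (simp add: ip_def mult.commute)

lemma ip_add_left: "ip d (\<lambda>i. u i + v i) w = ip d u w + ip d v w"
  by (simp add: ip_def sum.distrib distrib_right)

lemma ip_diff_left: "ip d (\<lambda>i. u i - v i) w = ip d u w - ip d v w"
  by (simp add: ip_def sum_subtractf left_diff_distrib)

lemma ip_scale_left: "ip d (\<lambda>i. a * u i) w = a * ip d u w"
  by (simp add: ip_def sum_distrib_left mult.assoc)

lemma ip_add_right: "ip d w (\<lambda>i. u i + v i) = ip d w u + ip d w v"
  by (simp add: ip_def sum.distrib distrib_left)

lemma ip_diff_right: "ip d w (\<lambda>i. u i - v i) = ip d w u - ip d w v"
  by (simp add: ip_def sum_subtractf right_diff_distrib)

lemma ip_scale_right: "ip d w (\<lambda>i. a * u i) = a * ip d w u"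
  by (simp add: ip_def sum_distrib_left mult.left_commute)

lemmas ip_linear = ip_add_left ip_diff_left ip_scale_left ip_add_right ip_diff_right ip_scale_right

lemma ip_self: "ip d u u = (\<Sum>i<d. (u i)\<^sup>2)"
  by (simp add: ip_def power2_eq_square)

lemma ip_self_nonneg [simp]: "0 \<le> ip d u u"
  by (simp add: ip_self sum_nonneg)

lemma nrm_eq_L2_set: "nrm d u = L2_set u {..<d}"
  by (simp add: nrm_def ip_self L2_set_def)

lemma nrm_nonneg [simp]: "0 \<le> nrm d u"
  by (simp add: nrm_def)

lemma nrm_power2: "(nrm d u)\<^sup>2 = ip d u u"
  by (simp add: nrm_def)

lemma ip_self_eq_0_iff: "ip d u u = 0 \<longleftrightarrow> (\<forall>i<d. u i = 0)"
  by (auto simp: ip_self sum_nonneg_eq_0_iff)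

lemma nrm_eq_0_iff: "nrm d u = 0 \<longleftrightarrow> (\<forall>i<d. u i = 0)"
  by (simp add: nrm_def ip_self_eq_0_iff)

lemma abs_ip_le: "\<bar>ip d u v\<bar> \<le> nrm d u * nrm d v"
proof -
  have "\<bar>ip d u v\<bar> \<le> (\<Sum>i<d. \<bar>u i\<bar> * \<bar>v i\<bar>)"
    unfolding ip_def by (rule order_trans[OF sum_abs]) (simp add: abs_mult)
  also have "\<dots> \<le> L2_set u {..<d} * L2_set v {..<d}"
    by (rule L2_set_mult_ineq)
  finally show ?thesis by (simp add: nrm_eq_L2_set)
qed

lemma nrm_triangle: "nrm d (\<lambda>i. u i + v i) \<le> nrm d u + nrm d v"
  by (simp add: nrm_eq_L2_set L2_set_triangle_ineq)

lemma nrm_scale: "nrm d (\<lambda>i. a * u i) = \<bar>a\<bar> * nrm d u"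
  by (simp add: nrm_def ip_linear real_sqrt_mult mult.assoc[symmetric])

lemma nrm_minus: "nrm d (\<lambda>i. - u i) = nrm d u"
  using nrm_scale[of d "-1" u] by simp

lemma nrm_triangle_diff: "nrm d (\<lambda>i. u i - v i) \<le> nrm d u + nrm d v"
  using nrm_triangle[of d u "\<lambda>i. - v i"] by (simp add: nrm_minus)

section \<open>Bilinear forms of square matrices and their operator norms\<close>

definition bform :: "nat \<Rightarrow> (nat \<Rightarrow> nat \<Rightarrow> real) \<Rightarrow> (nat \<Rightarrow> real) \<Rightarrow> (nat \<Rightarrow> real) \<Rightarrow> real" where
  "bform d E u v = ip d u (\<lambda>i. \<Sum>j<d. E i j * v j)"

lemma bform_add_right: "bform d E u (\<lambda>i. v i + w i) = bform d E u v + bform d E u w"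
  by (simp add: bform_def distrib_left sum.distrib ip_linear)

lemma bform_diff_right: "bform d E u (\<lambda>i. v i - w i) = bform d E u v - bform d E u w"
  by (simp add: bform_def right_diff_distrib sum_subtractf ip_linear)

lemma bform_scale_right: "bform d E u (\<lambda>i. a * v i) = a * bform d E u v"
proof -
  have "(\<lambda>i. \<Sum>j<d. E i j * (a * v j)) = (\<lambda>i. a * (\<Sum>j<d. E i j * v j))"
    by (auto simp: sum_distrib_left mult_ac)
  thus ?thesis by (simp add: bform_def ip_linear)
qed

lemma bform_add_left: "bform d E (\<lambda>i. v i + w i) u = bform d E v u + bform d E w u"
  by (simp add: bform_def ip_linear)

lemma bform_diff_left: "bform d E (\<lambda>i. v i - w i) u = bform d E v u - bform d E w u"
  by (simp add: bform_def ip_linear)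

lemma bform_scale_left: "bform d E (\<lambda>i. a * v i) u = a * bform d E v u"
  by (simp add: bform_def ip_linear)

lemmas bform_linear = bform_add_left bform_diff_left bform_scale_left
  bform_add_right bform_diff_right bform_scale_right

lemma bform_commute:
  assumes "\<And>i j. i < d \<Longrightarrow> j < d \<Longrightarrow> E i j = E j i"
  shows "bform d E u v = bform d E v u"
proof -
  have "bform d E u v = (\<Sum>i<d. \<Sum>j<d. u i * E i j * v j)"
    by (simp add: bform_def ip_def sum_distrib_left mult.assoc)
  also have "\<dots> = (\<Sum>j<d. \<Sum>i<d. u i * E i j * v j)"
    by (rule sum.swap)
  also have "\<dots> = (\<Sum>j<d. \<Sum>i<d. v j * E j i * u i)"
    by (intro sum.cong refl) (simp add: assms mult_ac)
  also have "\<dots> = bform d E v u"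
    by (simp add: bform_def ip_def sum_distrib_left mult.assoc)
  finally show ?thesis .
qed

text \<open>Polarisation. The vectors are first rescaled to \<open>V u\<close> and
  \<open>U v\<close>, which have equal norm, so that the parallelogram law returns the product of
  the norms instead of the sum of their squares.\<close>

lemma bform_bound_of_diagonal:
  assumes sym: "\<And>i j. i < d \<Longrightarrow> j < d \<Longrightarrow> E i j = E j i"
    and diag: "\<And>u. \<bar>bform d E u u\<bar> \<le> N * ip d u u"
  shows "\<bar>bform d E u v\<bar> \<le> N * nrm d u * nrm d v"
proof (cases "nrm d u = 0 \<or> nrm d v = 0")
  case True
  hence "bform d E u v = 0"
  proof
    assume "nrm d u = 0"
    thus ?thesis by (simp add: nrm_eq_0_iff bform_def ip_def)
  next
    assume "nrm d v = 0"
    thus ?thesis by (simp add: nrm_eq_0_iff bform_def ip_def)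
  qed
  thus ?thesis using True by auto
next
  case False
  define U where "U = nrm d u"
  define V where "V = nrm d v"
  have pos: "U > 0" "V > 0" using False nrm_nonneg[of d u] nrm_nonneg[of d v]
    by (auto simp: U_def V_def less_le)
  let ?a = "\<lambda>i. V * u i" and ?b = "\<lambda>i. U * v i"
  have "4 * (U * V * bform d E u v)
      = bform d E (\<lambda>i. ?a i + ?b i) (\<lambda>i. ?a i + ?b i) - bform d E (\<lambda>i. ?a i - ?b i) (\<lambda>i. ?a i - ?b i)"
    by (simp add: bform_linear bform_commute[OF sym, where u=v and v=u] algebra_simps)
  hence "4 * (U * V * \<bar>bform d E u v\<bar>) \<le>
      \<bar>bform d E (\<lambda>i. ?a i + ?b i) (\<lambda>i. ?a i + ?b i)\<bar> + \<bar>bform d E (\<lambda>i. ?a i - ?b i) (\<lambda>i. ?a i - ?b i)\<bar>"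
    using pos by (auto simp: abs_mult[symmetric] abs_if)
  also have "\<dots> \<le> N * ip d (\<lambda>i. ?a i + ?b i) (\<lambda>i. ?a i + ?b i) + N * ip d (\<lambda>i. ?a i - ?b i) (\<lambda>i. ?a i - ?b i)"
    by (intro add_mono diag)
  also have "\<dots> = 2 * N * (V\<^sup>2 * ip d u u + U\<^sup>2 * ip d v v)"
    by (simp add: ip_linear ip_commute[of d v u] algebra_simps power2_eq_square)
  also have "\<dots> = 4 * (U * V * (N * U * V))"
    by (simp add: U_def V_def nrm_power2[symmetric] power2_eq_square algebra_simps)
  finally have "U * V * \<bar>bform d E u v\<bar> \<le> U * V * (N * U * V)" by simp
  hence "\<bar>bform d E u v\<bar> \<le> N * U * V" using pos by (simp add: mult_le_cancel_left_pos)
  thus ?thesis by (simp add: U_def V_def)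
qed

lemma nrm_apply_le_of_diagonal:
  assumes sym: "\<And>i j. i < d \<Longrightarrow> j < d \<Longrightarrow> E i j = E j i" and "0 \<le> N"
    and diag: "\<And>u. \<bar>bform d E u u\<bar> \<le> N * ip d u u"
  shows "nrm d (\<lambda>i. \<Sum>j<d. E i j * u j) \<le> N * nrm d u"
proof -
  let ?w = "\<lambda>i. \<Sum>j<d. E i j * u j"
  have "nrm d ?w * nrm d ?w = bform d E ?w u"
    by (simp add: bform_def nrm_def)
  also have "\<dots> \<le> N * nrm d ?w * nrm d u"
    using bform_bound_of_diagonal[OF sym diag, of ?w u] by simp
  finally have "nrm d ?w * nrm d ?w \<le> nrm d ?w * (N * nrm d u)" by (simp add: mult_ac)
  thus ?thesis using assms(2) nrm_nonneg[of d ?w]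
    by (cases "nrm d ?w = 0") (auto simp: mult_le_cancel_left_pos less_le)
qed

section \<open>A finite net of the Euclidean unit ball\<close>

definition ball_net :: "nat \<Rightarrow> (nat \<Rightarrow> real) set" where
  "ball_net d = (\<lambda>z i. if i < d then real_of_int (z i) / (4 * sqrt (real d)) else 0) `
     {z \<in> {..<d} \<rightarrow>\<^sub>E {- 4 * int d..4 * int d}. (\<Sum>i<d. (z i)\<^sup>2) \<le> 16 * int d}"

lemma finite_ball_net: "finite (ball_net d)"
  unfolding ball_net_def
  by (intro finite_imageI finite_subset[OF _ finite_PiE[of "{..<d}" "\<lambda>_. {- 4 * int d..4 * int d}"]]) auto

lemma sum_two_sided_geometric_le:
  "(\<Sum>z\<in>{- int m..int m}. (1/2::real) ^ nat \<bar>z\<bar>) \<le> 3"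
proof -
  have "(\<Sum>z\<in>{- int m..int m}. (1/2::real) ^ nat \<bar>z\<bar>) = 3 - 2 * (1/2) ^ m"
  proof (induction m)
    case (Suc m)
    have "{- int (Suc m)..int (Suc m)} = insert (- int (Suc m)) (insert (int (Suc m)) {- int m..int m})"
      by auto
    thus ?case by (simp add: Suc nat_add_distrib)
  qed simp
  thus ?thesis by simp
qed

text \<open>Counting by an exponential weight, since counting the whole box would give a power of
  order \<open>d^d\<close>. Integrality gives \<open>|a| <= a^2\<close>, so \<open>2^(16 d)\<close>
  times \<open>prod (1/2)^|z i|\<close> is at least 1 at every admissible integer vector. Summed
  over the box, this weight factors into \<open>d\<close> two-sided geometric series, each at most
  3.\<close>

lemma card_ball_net: "real (card (ball_net d)) \<le> (3 * 2 ^ 16) ^ d"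
proof -
  define P where "P = ({..<d} \<rightarrow>\<^sub>E {- int (4 * d)..int (4 * d)})"
  define Q where "Q = {z \<in> P. (\<Sum>i<d. (z i)\<^sup>2) \<le> 16 * int d}"
  have finP: "finite P" unfolding P_def by (intro finite_PiE) auto
  have "real (card (ball_net d)) \<le> real (card Q)"
    unfolding ball_net_def Q_def P_def using finP[unfolded P_def]
    by (intro of_nat_mono order_trans[OF card_image_le]) (auto intro: card_mono)
  also have "\<dots> = (\<Sum>z\<in>Q. 1)" by simp
  also have "\<dots> \<le> (\<Sum>z\<in>Q. 2 ^ (16 * d) * (\<Prod>i<d. (1/2::real) ^ nat \<bar>z i\<bar>))"
  proof (rule sum_mono)
    fix z assume z: "z \<in> Q"
    have "int (\<Sum>i<d. nat \<bar>z i\<bar>) \<le> (\<Sum>i<d. (z i)\<^sup>2)"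
    proof -
      have "\<bar>a\<bar> \<le> a\<^sup>2" for a :: int
      proof (cases "a = 0")
        case False
        hence "\<bar>a\<bar> * 1 \<le> \<bar>a\<bar> * \<bar>a\<bar>" by (intro mult_left_mono) auto
        thus ?thesis by (simp add: power2_eq_square)
      qed simp
      thus ?thesis by (simp add: sum_mono)
    qed
    also have "\<dots> \<le> 16 * int d" using z by (simp add: Q_def)
    finally have le: "(\<Sum>i<d. nat \<bar>z i\<bar>) \<le> 16 * d" by linarith
    have "(1::real) = 2 ^ (16 * d) * (1/2) ^ (16 * d)" by (simp add: power_one_over)
    also have "\<dots> \<le> 2 ^ (16 * d) * (1/2) ^ (\<Sum>i<d. nat \<bar>z i\<bar>)"
      by (intro mult_left_mono power_decreasing le) auto
    finally show "1 \<le> 2 ^ (16 * d) * (\<Prod>i<d. (1/2::real) ^ nat \<bar>z i\<bar>)" by (simp add: power_sum)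
  qed
  also have "\<dots> \<le> (\<Sum>z\<in>P. 2 ^ (16 * d) * (\<Prod>i<d. (1/2::real) ^ nat \<bar>z i\<bar>))"
    using finP by (intro sum_mono2) (auto simp: Q_def intro!: mult_nonneg_nonneg prod_nonneg)
  also have "\<dots> = 2 ^ (16 * d) * (\<Prod>i<d. \<Sum>a\<in>{- int (4 * d)..int (4 * d)}. (1/2::real) ^ nat \<bar>a\<bar>)"
    unfolding P_def by (subst prod_sum_PiE) (auto simp: sum_distrib_left)
  also have "\<dots> \<le> 2 ^ (16 * d) * (\<Prod>i<d. 3)"
    using sum_two_sided_geometric_le[of "4 * d"]
    by (intro mult_left_mono prod_mono) (auto intro!: sum_nonneg)
  also have "\<dots> = (3 * 2 ^ 16) ^ d" by (simp add: power_mult power_mult_distrib[symmetric])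
  finally show ?thesis .
qed

lemma ball_net_norm_le:
  assumes "v \<in> ball_net d"
  shows "ip d v v \<le> 1"
proof -
  from assms obtain z where z: "(\<Sum>i<d. (z i)\<^sup>2) \<le> 16 * int d"
    and v: "v = (\<lambda>i. if i < d then real_of_int (z i) / (4 * sqrt (real d)) else 0)"
    by (auto simp: ball_net_def)
  have "ip d v v = (\<Sum>i<d. (real_of_int (z i))\<^sup>2 / (16 * real d))"
    unfolding ip_self v by (intro sum.cong) (auto simp: power_divide power_mult_distrib)
  also have "\<dots> = real_of_int (\<Sum>i<d. (z i)\<^sup>2) / (16 * real d)" by (simp add: sum_divide_distrib)
  also have "\<dots> \<le> 1" using z by (cases "d = 0") (auto simp: divide_simps simp flip: of_int_le_iff[where 'a=real])
  finally show ?thesis .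
qed

text \<open>Rounding every coordinate towards zero on the grid of mesh
  \<open>1 / (4 * sqrt d)\<close> cannot increase the norm, so the result stays in the net;
  \<open>d\<close> coordinate errors of at most one mesh width amount to Euclidean distance at most
  1/4.\<close>

lemma ball_net_dense:
  assumes u: "ip d u u \<le> 1"
  obtains v where "v \<in> ball_net d" "nrm d (\<lambda>i. u i - v i) \<le> 1/4"
proof (cases "d = 0")
  case True
  show ?thesis
    by (rule that[of "\<lambda>i. 0"]) (auto simp: True ball_net_def nrm_def ip_def)
next
  case False
  define h where "h = 1 / (4 * sqrt (real d))"
  have h: "h > 0" "h\<^sup>2 = 1 / (16 * real d)" using False
    by (auto simp: h_def power_divide power_mult_distrib)
  \<comment> \<open>Truncation towards zero for both signs; a plain floor would enlarge negative
    coordinates.\<close>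
  define r where "r a = (if 0 \<le> a then \<lfloor>a / h\<rfloor> else - \<lfloor>- a / h\<rfloor>)" for a :: real
  have r: "\<bar>real_of_int (r a) * h\<bar> \<le> \<bar>a\<bar> \<and> \<bar>a - real_of_int (r a) * h\<bar> \<le> h" for a
  proof -
    have *: "0 \<le> real_of_int \<lfloor>c / h\<rfloor> * h \<and> real_of_int \<lfloor>c / h\<rfloor> * h \<le> c \<and> c - real_of_int \<lfloor>c / h\<rfloor> * h \<le> h"
      if "0 \<le> c" for c
    proof -
      have "real_of_int \<lfloor>c / h\<rfloor> \<le> c / h" "c / h \<le> real_of_int \<lfloor>c / h\<rfloor> + 1" "0 \<le> \<lfloor>c/h\<rfloor>" using that h by auto
      moreover from this have "real_of_int \<lfloor>c / h\<rfloor> * h \<le> (c / h) * h" "(c / h) * h \<le> (real_of_int \<lfloor>c / h\<rfloor> + 1) * h"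
        using h by (intro mult_right_mono; simp)+
      ultimately show ?thesis using h by (auto simp: distrib_right)
    qed
    show ?thesis using *[of a] *[of "-a"] by (auto simp: r_def abs_if)
  qed
  define z where "z = (\<lambda>i\<in>{..<d}. r (u i))"
  define v where "v = (\<lambda>i. if i < d then real_of_int (z i) / (4 * sqrt (real d)) else 0)"
  have v_eq: "v i = real_of_int (r (u i)) * h" if "i < d" for i using that by (simp add: v_def z_def h_def)
  have "(\<Sum>i<d. (real_of_int (r (u i)) * h)\<^sup>2) \<le> (\<Sum>i<d. (u i)\<^sup>2)"
    using r by (intro sum_mono) (metis abs_le_square_iff)
  also have "\<dots> \<le> 1" using u by (simp add: ip_self)
  finally have "(\<Sum>i<d. (real_of_int (r (u i)))\<^sup>2) * h\<^sup>2 \<le> 1" by (simp add: power_mult_distrib sum_distrib_right)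
  hence "(\<Sum>i<d. (real_of_int (r (u i)))\<^sup>2) \<le> 16 * real d" using False by (simp add: h(2) field_simps)
  hence "real_of_int (\<Sum>i<d. (r (u i))\<^sup>2) \<le> real_of_int (16 * int d)" by simp
  hence zz: "(\<Sum>i<d. (z i)\<^sup>2) \<le> 16 * int d" by (simp only: of_int_le_iff) (simp add: z_def)
  have "z i \<in> {- 4 * int d..4 * int d}" if "i < d" for i
  proof -
    have "(z i)\<^sup>2 \<le> (\<Sum>i<d. (z i)\<^sup>2)" using that by (intro member_le_sum) auto
    also have "\<dots> \<le> 16 * int d * int d" using zz False by (intro order_trans[OF zz]) simp
    also have "\<dots> = (4 * int d)\<^sup>2" by (simp add: power2_eq_square)
    finally have "\<bar>z i\<bar> \<le> \<bar>4 * int d\<bar>" by (simp only: abs_le_square_iff)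
    thus ?thesis by auto
  qed
  hence "v \<in> ball_net d" unfolding ball_net_def v_def using zz
    by (intro image_eqI[OF refl]) (auto simp: z_def PiE_iff extensional_def)
  moreover have "nrm d (\<lambda>i. u i - v i) \<le> 1/4"
  proof -
    have "ip d (\<lambda>i. u i - v i) (\<lambda>i. u i - v i) \<le> (\<Sum>i<d. h\<^sup>2)"
      unfolding ip_self
    proof (rule sum_mono)
      fix i assume "i \<in> {..<d}"
      thus "(u i - v i)\<^sup>2 \<le> h\<^sup>2" using r[of "u i"] h(1) v_eq[of i]
        by (intro abs_le_square_iff[THEN iffD1]) auto
    qed
    also have "\<dots> = (1/4)\<^sup>2" using False unfolding h(2) by (simp add: power2_eq_square)
    finally show ?thesis unfolding nrm_def by (intro real_le_lsqrt) auto
  qed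
  ultimately show ?thesis by (rule that)
qed

text \<open>The supremum \<open>N\<close> over the ball bounds itself: for a net point
  \<open>v\<close> near \<open>u\<close>, symmetry turns the difference of the two diagonal values
  into the form at \<open>u - v\<close> and \<open>u + v\<close>, which is at most
  \<open>N * (1/4) * 2\<close>. Hence \<open>N <= t + N / 2\<close>, and passing from the net to the
  ball costs a factor 2.\<close>

lemma bform_bound_of_net:
  assumes sym: "\<And>i j. i < d \<Longrightarrow> j < d \<Longrightarrow> E i j = E j i"
    and net: "\<And>v. v \<in> ball_net d \<Longrightarrow> \<bar>bform d E v v\<bar> \<le> t"
  shows "\<bar>bform d E u u\<bar> \<le> 2 * t * ip d u u"
proof -
  define S where "S = (\<lambda>u. \<bar>bform d E u u\<bar>) ` {u. ip d u u \<le> 1}"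
  \<comment> \<open>Finiteness of the supremum is what later allows \<open>N / 2\<close> to be
    subtracted from both sides.\<close>
  have bdd: "bdd_above S"
  proof -
    have "\<bar>bform d E u u\<bar> \<le> (\<Sum>i<d. \<Sum>j<d. \<bar>E i j\<bar>)" if "ip d u u \<le> 1" for u
    proof -
      have le1: "\<bar>u i\<bar> \<le> 1" if "i < d" for i
      proof -
        have "(u i)\<^sup>2 \<le> ip d u u" unfolding ip_self using that by (intro member_le_sum) auto
        hence "(u i)\<^sup>2 \<le> 1" using \<open>ip d u u \<le> 1\<close> by simp
        thus ?thesis by (simp add: abs_square_le_1)
      qed
      have "\<bar>bform d E u u\<bar> \<le> (\<Sum>i<d. \<Sum>j<d. \<bar>u i * E i j * u j\<bar>)"
        unfolding bform_def ip_def sum_distrib_left mult.assoc[symmetric]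
        by (rule order_trans[OF sum_abs sum_mono[OF sum_abs]])
      also have "\<dots> \<le> (\<Sum>i<d. \<Sum>j<d. \<bar>E i j\<bar>)"
      proof (intro sum_mono)
        fix i j assume "i \<in> {..<d}" "j \<in> {..<d}"
        hence "\<bar>u i\<bar> * \<bar>u j\<bar> \<le> 1" using le1 by (intro mult_le_one) auto
        hence "\<bar>E i j\<bar> * (\<bar>u i\<bar> * \<bar>u j\<bar>) \<le> \<bar>E i j\<bar>" by (intro mult_left_le) auto
        thus "\<bar>u i * E i j * u j\<bar> \<le> \<bar>E i j\<bar>" by (simp add: abs_mult mult_ac)
      qed
      finally show ?thesis .
    qed
    thus ?thesis by (auto simp: S_def intro!: bdd_aboveI)
  qed
  define N where "N = Sup S"
  have le_N: "\<bar>bform d E u u\<bar> \<le> N" if "ip d u u \<le> 1" for u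
    unfolding N_def using that by (intro cSup_upper bdd) (auto simp: S_def)
  have le_N': "\<bar>bform d E u u\<bar> \<le> N * ip d u u" for u
  proof (cases "ip d u u = 0")
    case True
    hence "\<forall>i<d. u i = 0" by (simp only: ip_self_eq_0_iff)
    thus ?thesis by (simp add: bform_def ip_def)
  next
    case False
    let ?r = "nrm d u"
    have r: "?r > 0" using False by (simp add: nrm_def less_le)
    have "\<bar>bform d E (\<lambda>i. (1/?r) * u i) (\<lambda>i. (1/?r) * u i)\<bar> \<le> N"
      using r by (intro le_N) (simp only: ip_linear nrm_power2[symmetric], simp add: power2_eq_square)
    thus ?thesis using r by (simp only: bform_linear nrm_power2[symmetric])
        (simp add: abs_mult field_simps power2_eq_square)
  qed
  have "N \<le> t + N / 2" unfolding N_def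
  proof (rule cSup_least)
    show "S \<noteq> {}" by (auto simp: S_def ip_def intro: exI[of _ "\<lambda>_. 0"])
    fix a assume "a \<in> S"
    then obtain u where u: "ip d u u \<le> 1" and a: "a = \<bar>bform d E u u\<bar>" by (auto simp: S_def)
    obtain v where v: "v \<in> ball_net d" "nrm d (\<lambda>i. u i - v i) \<le> 1/4" by (rule ball_net_dense[OF u])
    have N0: "0 \<le> N" using le_N[of "\<lambda>_. 0"] by (simp add: ip_def bform_def)
    have "nrm d u \<le> 1" "nrm d v \<le> 1" using u ball_net_norm_le[OF v(1)] by (auto simp: nrm_def)
    hence uv: "nrm d (\<lambda>i. u i + v i) \<le> 2" using nrm_triangle[of d u v] by linarith
    have "bform d E u u = bform d E v v + bform d E (\<lambda>i. u i - v i) (\<lambda>i. u i + v i)"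
      by (simp add: bform_linear bform_commute[OF sym, where u=v and v=u])
    hence "\<bar>bform d E u u\<bar> \<le> t + N * nrm d (\<lambda>i. u i - v i) * nrm d (\<lambda>i. u i + v i)"
      using net[OF v(1)] bform_bound_of_diagonal[OF sym le_N', of "\<lambda>i. u i - v i" "\<lambda>i. u i + v i"] by linarith
    also have "\<dots> \<le> t + N * (1/4) * 2" using v(2) uv N0 by (intro add_left_mono mult_mono) auto
    finally show "a \<le> t + Sup S / 2" by (simp add: a N_def)
  qed
  hence "N \<le> 2 * t" by simp
  thus ?thesis using le_N'[of u] mult_right_mono[of N "2 * t" "ip d u u"] ip_self_nonneg[of d u] by linarith
qed

section \<open>Matrix inversion by cofactors\<close>

definition inv_entry :: "nat \<Rightarrow> (nat \<Rightarrow> nat \<Rightarrow> real) \<Rightarrow> nat \<Rightarrow> nat \<Rightarrow> real" where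
  "inv_entry d E i j = adj_mat (mat d d (\<lambda>(i, j). E i j)) $$ (i, j) / Determinant.det (mat d d (\<lambda>(i, j). E i j))"

lemma inv_entry_right_inverse:
  assumes inj: "\<And>u. (\<And>i. i < d \<Longrightarrow> (\<Sum>j<d. E i j * u j) = 0) \<Longrightarrow> (\<And>i. i < d \<Longrightarrow> u i = 0)"
    and i: "i < d"
  shows "(\<Sum>j<d. E i j * (\<Sum>l<d. inv_entry d E j l * r l)) = r i"
proof -
  define M where "M = mat d d (\<lambda>(i, j). E i j)"
  have M: "M \<in> carrier_mat d d" by (simp add: M_def)
  have det: "Determinant.det M \<noteq> 0"
  proof
    assume "Determinant.det M = 0"
    then obtain v where v: "v \<in> carrier_vec d" "v \<noteq> 0\<^sub>v d" "M *\<^sub>v v = 0\<^sub>v d"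
      by (auto simp: det_0_iff_vec_prod_zero[OF M])
    have "(\<Sum>j<d. E i j * vec_index v j) = 0" if "i < d" for i
    proof -
      have "vec_index (M *\<^sub>v v) i = 0" using that by (simp add: v(3))
      thus ?thesis using that v(1) by (simp add: M_def scalar_prod_def atLeast0LessThan)
    qed
    hence "\<And>i. i < d \<Longrightarrow> vec_index v i = 0" by (rule inj)
    hence "v = 0\<^sub>v d" using v(1) by (intro eq_vecI) auto
    thus False using v(2) by simp
  qed
  have prod: "(\<Sum>j<d. E i j * adj_mat M $$ (j, l)) = Determinant.det M * (if i = l then 1 else 0)" if "l < d" for l
  proof -
    have "(M * adj_mat M) $$ (i, l) = (Determinant.det M \<cdot>\<^sub>m 1\<^sub>m d) $$ (i, l)" by (simp add: adj_mat(2)[OF M])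
    thus ?thesis using that i adj_mat(1)[OF M] by (simp add: M_def scalar_prod_def atLeast0LessThan)
  qed
  have "(\<Sum>j<d. E i j * (\<Sum>l<d. inv_entry d E j l * r l)) = (\<Sum>j<d. \<Sum>l<d. E i j * inv_entry d E j l * r l)"
    by (simp add: sum_distrib_left mult.assoc)
  also have "\<dots> = (\<Sum>l<d. \<Sum>j<d. E i j * inv_entry d E j l * r l)" by (rule sum.swap)
  also have "\<dots> = (\<Sum>l<d. (\<Sum>j<d. E i j * adj_mat M $$ (j, l)) / Determinant.det M * r l)"
    by (simp add: inv_entry_def M_def sum_distrib_right sum_divide_distrib)
  also have "\<dots> = (\<Sum>l<d. (if i = l then 1 else 0) * r l)" using det by (intro sum.cong refl) (simp add: prod)
  also have "\<dots> = r i" using i by (simp add: if_distrib[where f="\<lambda>x. x * _"] cong: if_cong)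
  finally show ?thesis .
qed

lemma borel_measurable_det:
  assumes "\<And>i j. i < d \<Longrightarrow> j < d \<Longrightarrow> (\<lambda>x. E x i j) \<in> borel_measurable M"
  shows "(\<lambda>x. Determinant.det (mat d d (\<lambda>(i, j). E x i j)) :: real) \<in> borel_measurable M"
proof -
  have "(\<lambda>x. Determinant.det (mat d d (\<lambda>(i, j). E x i j))) =
    (\<lambda>x. \<Sum>q\<in>{q. q permutes {0..<d}}. signof q * (\<Prod>i = 0..<d. E x i (q i)))"
    by (auto simp: Determinant.det_def intro!: ext sum.cong prod.cong dest: permutes_in_image)
  moreover have "(\<lambda>x. \<Sum>q\<in>{q. q permutes {0..<d}}. signof q * (\<Prod>i = 0..<d. E x i (q i))) \<in> borel_measurable M"
    by (intro borel_measurable_sum borel_measurable_times borel_measurable_const borel_measurable_prod assms)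
      (auto dest: permutes_in_image)
  ultimately show ?thesis by simp
qed

text \<open>The reason for encoding the inverse by the adjugate: each entry is a quotient of
  determinants of measurable entries. \<open>?h\<close> skips the deleted row or column, and where
  the determinant vanishes division by zero yields 0, so no case distinction arises.\<close>

lemma borel_measurable_inv_entry:
  assumes E: "\<And>i j. i < d \<Longrightarrow> j < d \<Longrightarrow> (\<lambda>x. E x i j) \<in> borel_measurable M"
    and ij: "i < d" "j < d"
  shows "(\<lambda>x. inv_entry d (E x) i j) \<in> borel_measurable M"
proof -
  let ?h = "\<lambda>a b. if a < b then a else Suc a"
  have "(\<lambda>x. adj_mat (mat d d (\<lambda>(i, j). E x i j)) $$ (i, j)) =
     (\<lambda>x. (-1) ^ (j + i) * Determinant.det (mat (d - 1) (d - 1) (\<lambda>(a, b). E x (?h a j) (?h b i))))"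
    using ij by (auto simp: adj_mat_def cofactor_def mat_delete_def intro!: ext arg_cong[where f=Determinant.det] eq_matI)
  moreover have "\<dots> \<in> borel_measurable M"
    by (intro borel_measurable_times borel_measurable_const borel_measurable_det E) (use ij in auto)
  ultimately have "(\<lambda>x. adj_mat (mat d d (\<lambda>(i, j). E x i j)) $$ (i, j)) \<in> borel_measurable M" by simp
  thus ?thesis unfolding inv_entry_def
    by (intro borel_measurable_divide borel_measurable_det E)
qed

section \<open>The design matrix: bias and variance\<close>

definition xT :: "nat \<Rightarrow> (nat \<Rightarrow> nat \<Rightarrow> real) \<Rightarrow> (nat \<Rightarrow> real) \<Rightarrow> nat \<Rightarrow> real" where
  "xT n x m i = (\<Sum>j<n. m j * x j i)"

text \<open>The vector \<open>(X X^T)^(-1) r\<close> for the matrix \<open>X\<close> with rows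
  \<open>x j\<close>, whenever that Gram matrix is invertible; \<open>xT\<close> of it is then the
  minimum-norm solution of \<open>X u = r\<close>.\<close>

definition gram_solve :: "nat \<Rightarrow> nat \<Rightarrow> (nat \<Rightarrow> nat \<Rightarrow> real) \<Rightarrow> (nat \<Rightarrow> real) \<Rightarrow> nat \<Rightarrow> real" where
  "gram_solve n p x r j = (\<Sum>l<n. inv_entry n (\<lambda>j j'. ip p (x j) (x j')) j l * r l)"

lemma sum_xT: "(\<Sum>j<n. m j * (\<Sum>i\<in>S. x j i * u i)) = (\<Sum>i\<in>S. xT n x m i * u i)"
proof -
  have "(\<Sum>j<n. m j * (\<Sum>i\<in>S. x j i * u i)) = (\<Sum>j<n. \<Sum>i\<in>S. m j * x j i * u i)"
    by (simp add: sum_distrib_left mult.assoc)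
  also have "\<dots> = (\<Sum>i\<in>S. \<Sum>j<n. m j * x j i * u i)" by (rule sum.swap)
  finally show ?thesis by (simp add: xT_def sum_distrib_right)
qed

lemma ip_xT: "ip n m (\<lambda>j. ip d (x j) u) = ip d (xT n x m) u"
  unfolding ip_def by (rule sum_xT)

lemma xT_diff: "xT n x (\<lambda>j. a j - b j) i = xT n x a i - xT n x b i"
  by (simp add: xT_def left_diff_distrib sum_subtractf)

lemma sum_lessThan_split:
  fixes f :: "nat \<Rightarrow> real"
  assumes "k \<le> p"
  shows "(\<Sum>i<p. f i) = (\<Sum>i<k. f i) + (\<Sum>i\<in>{k..<p}. f i)"
  using sum.atLeastLessThan_concat[of 0 k p f] assms by (simp add: atLeast0LessThan)

lemma quadratic_bound:
  fixes M q :: real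
  assumes "M\<^sup>2 \<le> q\<^sup>2 + 3 * q * M" "0 \<le> q" "0 \<le> M"
  shows "M \<le> 4 * q"
proof (rule ccontr)
  assume "\<not> M \<le> 4 * q"
  hence M: "M > 4 * q" by simp
  hence "q * M \<ge> q * (4 * q)" using assms by (intro mult_left_mono) auto
  moreover have "M * M \<ge> (4 * q) * M" using M assms by (intro mult_right_mono) auto
  moreover have "q * q \<ge> 0" by simp
  ultimately have "q * q \<le> 0" using assms(1) by (simp add: power2_eq_square algebra_simps)
  hence "q = 0" using mult_eq_0_iff[of q q] zero_le_square[of q] by linarith
  thus False using assms(1) M by simp
qed

lemma square_sum2_le: "(a + b)\<^sup>2 \<le> 2 * (a\<^sup>2 + b\<^sup>2)" for a b :: real
  using zero_le_power2[of "a - b"] by (simp add: power2_eq_square algebra_simps)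

lemma square_sum3_le: "(a + b + c)\<^sup>2 \<le> 3 * (a\<^sup>2 + b\<^sup>2 + c\<^sup>2)" for a b c :: real
  using zero_le_power2[of "a - b"] zero_le_power2[of "a - c"] zero_le_power2[of "b - c"]
  by (simp add: power2_eq_square algebra_simps)

text \<open>Everything the regression algebra needs to know about a design, separated from
  probability. \<open>s\<close> stands for the tail eigenvalue sum, \<open>\<eta>\<close> for the
  relative operator-norm distance of the tail Gram matrix from \<open>s\<close> times the identity,
  and the head conditions place the spectrum of the whitened head sample covariance in
  \<open>[1/2, 2]\<close>.\<close>

locale good_design =
  fixes n k p :: nat and lam :: "nat \<Rightarrow> real" and x :: "nat \<Rightarrow> nat \<Rightarrow> real" and s \<eta> :: real
  assumes n_pos: "0 < n" and k_le: "k \<le> p" and lam_pos: "\<And>i. i < p \<Longrightarrow> 0 < lam i"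
    and s_pos: "0 < s" and eta_nonneg: "0 \<le> \<eta>" and eta_le: "\<eta> \<le> 1/2"
    and lam_tail_le: "\<And>i. k \<le> i \<Longrightarrow> i < p \<Longrightarrow> lam i \<le> s / real n"
    and tail_quad: "\<And>m. \<bar>(\<Sum>i\<in>{k..<p}. (xT n x m i)\<^sup>2) - s * ip n m m\<bar> \<le> \<eta> * s * ip n m m"
    and head_lower: "\<And>u. real n / 2 * (\<Sum>i<k. lam i * (u i)\<^sup>2) \<le> (\<Sum>j<n. (ip k (x j) u)\<^sup>2)"
    and head_upper: "\<And>u. (\<Sum>j<n. (ip k (x j) u)\<^sup>2) \<le> 2 * real n * (\<Sum>i<k. lam i * (u i)\<^sup>2)"
begin

text \<open>The Gram operator \<open>X_tail X_tail^T\<close> of the columns from \<open>k\<close>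
  on.\<close>

definition tail_op :: "(nat \<Rightarrow> real) \<Rightarrow> nat \<Rightarrow> real" where
  "tail_op m j = (\<Sum>i\<in>{k..<p}. x j i * xT n x m i)"

lemma ip_row_split: "ip p (x j) u = ip k (x j) u + (\<Sum>i\<in>{k..<p}. x j i * u i)"
  unfolding ip_def by (rule sum_lessThan_split[OF k_le])

lemma ip_tail_op: "ip n m (tail_op m) = (\<Sum>i\<in>{k..<p}. (xT n x m i)\<^sup>2)"
proof -
  have "ip n m (tail_op m) = (\<Sum>j<n. m j * (\<Sum>i\<in>{k..<p}. x j i * xT n x m i))"
    by (simp add: ip_def tail_op_def)
  also have "\<dots> = (\<Sum>i\<in>{k..<p}. xT n x m i * xT n x m i)" by (rule sum_xT)
  finally show ?thesis by (simp add: power2_eq_square)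
qed

lemma tail_quad_lower: "s / 2 * ip n m m \<le> (\<Sum>i\<in>{k..<p}. (xT n x m i)\<^sup>2)"
  and tail_quad_upper: "(\<Sum>i\<in>{k..<p}. (xT n x m i)\<^sup>2) \<le> 3 / 2 * s * ip n m m"
proof -
  have "\<eta> * s * ip n m m \<le> 1/2 * s * ip n m m"
    using s_pos eta_le by (intro mult_right_mono) auto
  with tail_quad[of m] show "s / 2 * ip n m m \<le> (\<Sum>i\<in>{k..<p}. (xT n x m i)\<^sup>2)"
    "(\<Sum>i\<in>{k..<p}. (xT n x m i)\<^sup>2) \<le> 3 / 2 * s * ip n m m"
    by (auto simp: abs_le_iff algebra_simps)
qed

text \<open>\<open>E\<close> is the tail Gram matrix minus \<open>s\<close> times the identity.
  Being symmetric, it has operator norm at most the bound on its quadratic form, which is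
  \<open>tail_quad\<close>.\<close>

lemma tail_op_near: "nrm n (\<lambda>j. tail_op m j - s * m j) \<le> \<eta> * s * nrm n m"
proof -
  define E where "E j j' = (\<Sum>i\<in>{k..<p}. x j i * x j' i) - (if j = j' then s else 0)" for j j'
  have app: "(\<Sum>j'<n. E j j' * m j') = tail_op m j - s * m j" if "j < n" for j m
  proof -
    have "(\<Sum>j'<n. E j j' * m j') = (\<Sum>j'<n. \<Sum>i\<in>{k..<p}. x j i * (m j' * x j' i)) - (\<Sum>j'<n. (if j = j' then s * m j' else 0))"
      unfolding sum_subtractf[symmetric] by (intro sum.cong refl) (auto simp: E_def left_diff_distrib right_diff_distrib sum_distrib_left sum_distrib_right mult_ac)
    also have "(\<Sum>j'<n. \<Sum>i\<in>{k..<p}. x j i * (m j' * x j' i)) = (\<Sum>i\<in>{k..<p}. \<Sum>j'<n. x j i * (m j' * x j' i))" by (rule sum.swap)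
    finally show ?thesis using that by (simp add: tail_op_def xT_def sum_distrib_left)
  qed
  have diag: "\<bar>bform n E m m\<bar> \<le> (\<eta> * s) * ip n m m" for m
  proof -
    have "bform n E m m = ip n m (\<lambda>j. tail_op m j - s * m j)"
      by (simp add: bform_def ip_def app)
    thus ?thesis using tail_quad[of m] by (simp add: ip_linear ip_tail_op)
  qed
  have "nrm n (\<lambda>j. \<Sum>j'<n. E j j' * m j') \<le> (\<eta> * s) * nrm n m"
  proof (rule nrm_apply_le_of_diagonal[OF _ _ diag])
    show "E i j = E j i" for i j by (auto simp: E_def mult.commute)
  qed (use eta_nonneg s_pos in simp)
  thus ?thesis by (simp add: nrm_def ip_def app)
qed

lemma nrm_tail_op_le: "nrm n (tail_op m) \<le> 3/2 * s * nrm n m"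
proof -
  have "nrm n (\<lambda>j. (tail_op m j - s * m j) + s * m j) \<le> \<eta> * s * nrm n m + s * nrm n m"
    by (rule order_trans[OF nrm_triangle]) (use tail_op_near[of m] s_pos in \<open>auto simp: nrm_scale\<close>)
  also have "\<dots> \<le> 1/2 * s * nrm n m + s * nrm n m" using s_pos eta_le by (intro add_mono mult_right_mono) auto
  finally show ?thesis by (simp add: algebra_simps)
qed

text \<open>The equation expresses the fitted head values \<open>X_head D\<close> as
  \<open>f - tail_op \<mu>\<close>, and the lower head condition converts their norm into the energy
  of \<open>D\<close>.\<close>

lemma head_energy_le:
  assumes eq: "\<And>j. j < n \<Longrightarrow> tail_op \<mu> j + ip k (x j) D = f j"
  shows "sqrt (\<Sum>i<k. lam i * (D i)\<^sup>2) \<le> sqrt (2 / real n) * (nrm n f + 3/2 * s * nrm n \<mu>)"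
proof -
  let ?E = "\<Sum>i<k. lam i * (D i)\<^sup>2"
  have "?E \<le> 2 / real n * (\<Sum>j<n. (ip k (x j) D)\<^sup>2)"
    using head_lower[of D] n_pos by (simp add: field_simps)
  hence "sqrt ?E \<le> sqrt (2 / real n * (\<Sum>j<n. (ip k (x j) D)\<^sup>2))" by (rule real_sqrt_le_mono)
  also have "\<dots> = sqrt (2 / real n) * nrm n (\<lambda>j. f j - tail_op \<mu> j)"
    unfolding real_sqrt_mult by (simp add: nrm_def ip_self eq[symmetric])
  also have "\<dots> \<le> sqrt (2 / real n) * (nrm n f + 3/2 * s * nrm n \<mu>)"
    by (intro mult_left_mono order_trans[OF nrm_triangle_diff] add_left_mono nrm_tail_op_le) auto
  finally show ?thesis .
qed

text \<open>Pairing the normal equations with \<^term>\<open>\<mu>\<close> turns them into an energy balance in which the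
  head contributes a nonnegative term; what remains is a quadratic inequality for \<^term>\<open>s * nrm n \<mu>\<close>.\<close>

lemma multiplier_le:
  assumes eq: "\<And>j. j < n \<Longrightarrow> tail_op \<mu> j + ip k (x j) D = f j"
    and D: "\<And>i. i < k \<Longrightarrow> D i = v i + xT n x \<mu> i"
  shows "s * nrm n \<mu> \<le> 4 * (s * sqrt (\<Sum>i<k. (v i)\<^sup>2 / lam i) * sqrt (2 / real n) + nrm n f)"
proof -
  define V where "V = sqrt (\<Sum>i<k. (v i)\<^sup>2 / lam i)"
  define F where "F = nrm n f"
  define m where "m = nrm n \<mu>"
  define DD where "DD = sqrt (\<Sum>i<k. lam i * (D i)\<^sup>2)"
  define c where "c = sqrt (2 / real n)"
  have nn: "0 \<le> V" "0 \<le> F" "0 \<le> m" "0 \<le> DD" "0 \<le> c"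
    using lam_pos k_le by (auto simp: V_def F_def m_def DD_def c_def less_imp_le intro!: sum_nonneg divide_nonneg_nonneg mult_nonneg_nonneg)
  have "ip n \<mu> (\<lambda>j. tail_op \<mu> j + ip k (x j) D) = ip n \<mu> f"
    unfolding ip_def[of n] by (intro sum.cong refl arg_cong2[where f="(*)"]) (use eq in auto)
  hence "ip n \<mu> (tail_op \<mu>) + ip k (xT n x \<mu>) D = ip n \<mu> f" by (simp add: ip_add_right ip_xT)
  moreover have "ip k (xT n x \<mu>) D = ip k D D - ip k v D"
    unfolding ip_diff_left[symmetric] unfolding ip_def by (intro sum.cong refl) (auto simp: D)
  moreover have "ip k v D \<le> V * DD"
  proof -
    have "ip k v D = (\<Sum>i<k. (v i / sqrt (lam i)) * (sqrt (lam i) * D i))"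
      unfolding ip_def using lam_pos k_le by (intro sum.cong) (auto simp: less_imp_neq[symmetric])
    also have "\<dots> = ip k (\<lambda>i. v i / sqrt (lam i)) (\<lambda>i. sqrt (lam i) * D i)" by (simp add: ip_def)
    also have "\<dots> \<le> nrm k (\<lambda>i. v i / sqrt (lam i)) * nrm k (\<lambda>i. sqrt (lam i) * D i)"
      using abs_ip_le[of k "\<lambda>i. v i / sqrt (lam i)" "\<lambda>i. sqrt (lam i) * D i"] by linarith
    also have "nrm k (\<lambda>i. v i / sqrt (lam i)) = V" using lam_pos k_le
      by (auto simp: nrm_def ip_self V_def power_divide less_imp_le intro!: sum.cong)
    also have "nrm k (\<lambda>i. sqrt (lam i) * D i) = DD" using lam_pos k_le
      by (auto simp: nrm_def ip_self DD_def power_mult_distrib less_imp_le intro!: sum.cong)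
    finally show ?thesis .
  qed
  moreover have "ip n \<mu> f \<le> m * F" using abs_ip_le[of n \<mu> f] by (simp add: m_def F_def)
  moreover have "s / 2 * m\<^sup>2 \<le> ip n \<mu> (tail_op \<mu>)"
    using tail_quad_lower[of \<mu>] by (simp add: ip_tail_op m_def nrm_power2)
  moreover have "0 \<le> ip k D D" by simp
  ultimately have "s / 2 * m\<^sup>2 \<le> V * DD + m * F" by linarith
  also have "V * DD \<le> V * (c * (F + 3/2 * s * m))"
    using nn unfolding DD_def c_def F_def m_def
    by (intro mult_left_mono head_energy_le[OF eq]) auto
  finally have "s / 2 * m\<^sup>2 \<le> V * (c * (F + 3/2 * s * m)) + m * F" by simp
  \<comment> \<open>With \<open>Y = s * V * c\<close> the aim is a quadratic inequality for
    \<open>s * m\<close> in the single quantity \<open>Y + F\<close>: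
    \<open>2 Y F <= (Y + F)^2\<close> and \<open>3 Y + 2 F <= 3 (Y + F)\<close>.\<close>
  from mult_left_mono[OF this, of "2 * s"] s_pos
  have "(s * m)\<^sup>2 \<le> 2 * (s * V * c) * F + 3 * (s * V * c) * (s * m) + 2 * F * (s * m)"
    by (simp add: power2_eq_square algebra_simps)
  also have "\<dots> \<le> (s * V * c + F)\<^sup>2 + 3 * (s * V * c + F) * (s * m)"
    using nn s_pos by (simp add: power2_eq_square algebra_simps)
  finally have "s * m \<le> 4 * (s * V * c + F)"
    using nn s_pos by (intro quadratic_bound) auto
  thus ?thesis by (simp add: V_def F_def m_def c_def)
qed

text \<open>By \<open>orth\<close>, \<open>v + xT n x \<mu>\<close> is the projection of
  \<open>v\<close> onto the kernel of the design. Moving the tail part of \<open>v\<close> to the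
  right-hand side \<open>f\<close> makes \<open>multiplier_le\<close> applicable. The head is then
  controlled by \<open>head_energy_le\<close>; in the tail, \<open>lam i <= s / n\<close> bounds the
  energy of \<open>X^T \<mu>\<close> by a multiple of \<open>(s * nrm n \<mu>)^2 / n\<close>. The
  constant 600 covers \<open>392 + 194\<close> for the tail of \<open>v\<close> and
  \<open>288 + 192\<close> for its head.\<close>

lemma bias_le:
  assumes orth: "\<And>j. j < n \<Longrightarrow> ip p (x j) (\<lambda>i. v i + xT n x \<mu> i) = 0"
    and tail_v: "(\<Sum>j<n. (\<Sum>i\<in>{k..<p}. x j i * v i)\<^sup>2) \<le> 2 * real n * (\<Sum>i\<in>{k..<p}. lam i * (v i)\<^sup>2)"
  shows "(\<Sum>i<p. lam i * (v i + xT n x \<mu> i)\<^sup>2) \<le>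
    600 * ((s / real n)\<^sup>2 * (\<Sum>i<k. (v i)\<^sup>2 / lam i) + (\<Sum>i\<in>{k..<p}. lam i * (v i)\<^sup>2))"
proof -
  define f where "f j = - (\<Sum>i\<in>{k..<p}. x j i * v i)" for j
  define D where "D i = v i + xT n x \<mu> i" for i
  define V2 where "V2 = (\<Sum>i<k. (v i)\<^sup>2 / lam i)"
  define W where "W = (\<Sum>i\<in>{k..<p}. lam i * (v i)\<^sup>2)"
  define M where "M = s * nrm n \<mu>"
  define F where "F = nrm n f"
  define Y where "Y = s * sqrt V2 * sqrt (2 / real n)"
  have V2: "0 \<le> V2" using lam_pos k_le by (auto simp: V2_def less_imp_le intro!: sum_nonneg divide_nonneg_nonneg)
  have eq: "tail_op \<mu> j + ip k (x j) D = f j" if "j < n" for j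
  proof -
    have "ip k (x j) D + (\<Sum>i\<in>{k..<p}. x j i * D i) = 0"
      using orth[OF that] by (simp add: ip_row_split D_def[abs_def])
    thus ?thesis by (simp add: tail_op_def f_def D_def distrib_left sum.distrib)
  qed
  have F2: "F\<^sup>2 \<le> 2 * real n * W" using tail_v by (simp add: F_def nrm_power2 ip_self f_def W_def)
  have Y2: "Y\<^sup>2 = 2 * s\<^sup>2 * V2 / real n" using V2 by (simp add: Y_def power_mult_distrib)
  have nn: "0 \<le> F" "0 \<le> Y" "0 \<le> M" using s_pos V2 by (auto simp: F_def Y_def M_def)
  have M: "M \<le> 4 * (Y + F)"
    unfolding M_def Y_def V2_def F_def by (rule multiplier_le[OF eq]) (simp_all add: D_def)
  have n1: "real n > 0" using n_pos by simp
  have sn: "s\<^sup>2 * V2 / (real n)\<^sup>2 = (s / real n)\<^sup>2 * V2" by (simp add: power_divide)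
  have head: "(\<Sum>i<k. lam i * (D i)\<^sup>2) \<le> 392 * W + 288 * ((s / real n)\<^sup>2 * V2)"
  proof -
    let ?E = "\<Sum>i<k. lam i * (D i)\<^sup>2"
    have E0: "0 \<le> ?E" using lam_pos k_le by (auto simp: less_imp_le intro!: sum_nonneg mult_nonneg_nonneg)
    have "sqrt ?E \<le> sqrt (2 / real n) * (F + 3/2 * s * nrm n \<mu>)"
      unfolding F_def by (rule head_energy_le[OF eq])
    also have "\<dots> \<le> sqrt (2 / real n) * (7 * F + 6 * Y)"
      using M by (intro mult_left_mono) (auto simp: M_def algebra_simps)
    finally have "(sqrt ?E)\<^sup>2 \<le> (sqrt (2 / real n) * (7 * F + 6 * Y))\<^sup>2" using E0 by (intro power_mono) auto
    hence "?E \<le> 2 / real n * (7 * F + 6 * Y)\<^sup>2" using E0 by (simp add: power_mult_distrib)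
    also have "\<dots> \<le> 2 / real n * (2 * ((7 * F)\<^sup>2 + (6 * Y)\<^sup>2))"
      by (intro mult_left_mono square_sum2_le) auto
    also have "\<dots> = 4 / real n * (49 * F\<^sup>2 + 36 * Y\<^sup>2)" by (simp add: power_mult_distrib algebra_simps)
    also have "\<dots> \<le> 4 / real n * (49 * (2 * real n * W) + 36 * Y\<^sup>2)" using F2 by (intro mult_left_mono add_mono) auto
    also have "\<dots> = 392 * W + 288 * (s\<^sup>2 * V2 / (real n)\<^sup>2)" unfolding Y2 using n1 by (simp add: field_simps power2_eq_square)
    finally show ?thesis unfolding sn .
  qed
  have tail: "(\<Sum>i\<in>{k..<p}. lam i * (D i)\<^sup>2) \<le> 194 * W + 192 * ((s / real n)\<^sup>2 * V2)"
  proof -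
    have "(\<Sum>i\<in>{k..<p}. lam i * (D i)\<^sup>2) \<le> (\<Sum>i\<in>{k..<p}. 2 * (lam i * (v i)\<^sup>2) + 2 * (s / real n * (xT n x \<mu> i)\<^sup>2))"
    proof (rule sum_mono)
      fix i assume i: "i \<in> {k..<p}"
      have "lam i * (D i)\<^sup>2 \<le> lam i * (2 * ((v i)\<^sup>2 + (xT n x \<mu> i)\<^sup>2))"
        unfolding D_def using i lam_pos by (intro mult_left_mono square_sum2_le) (auto simp: less_imp_le)
      also have "\<dots> = 2 * (lam i * (v i)\<^sup>2) + 2 * (lam i * (xT n x \<mu> i)\<^sup>2)" by (simp add: algebra_simps)
      also have "\<dots> \<le> 2 * (lam i * (v i)\<^sup>2) + 2 * (s / real n * (xT n x \<mu> i)\<^sup>2)"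
        using i by (intro add_mono mult_left_mono mult_right_mono lam_tail_le) auto
      finally show "lam i * (D i)\<^sup>2 \<le> 2 * (lam i * (v i)\<^sup>2) + 2 * (s / real n * (xT n x \<mu> i)\<^sup>2)" .
    qed
    also have "\<dots> = 2 * W + 2 * (s / real n) * (\<Sum>i\<in>{k..<p}. (xT n x \<mu> i)\<^sup>2)"
      by (simp add: sum.distrib sum_distrib_left W_def mult_ac)
    also have "\<dots> \<le> 2 * W + 2 * (s / real n) * (3 / 2 * s * ip n \<mu> \<mu>)"
      using s_pos by (intro add_left_mono mult_left_mono tail_quad_upper) auto
    also have "\<dots> = 2 * W + 3 / real n * M\<^sup>2"
      by (simp add: M_def power_mult_distrib nrm_power2 power2_eq_square[of s])
    also have "\<dots> \<le> 2 * W + 3 / real n * (4 * (Y + F))\<^sup>2"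
      using M nn by (intro add_left_mono mult_left_mono power_mono) auto
    also have "\<dots> \<le> 2 * W + 3 / real n * (32 * (Y\<^sup>2 + F\<^sup>2))"
      unfolding power_mult_distrib using square_sum2_le[of Y F] by (intro add_left_mono mult_left_mono) auto
    also have "\<dots> \<le> 2 * W + 3 / real n * (32 * (Y\<^sup>2 + 2 * real n * W))"
      using F2 by (intro add_left_mono mult_left_mono) auto
    also have "\<dots> = 194 * W + 192 * (s\<^sup>2 * V2 / (real n)\<^sup>2)" unfolding Y2 using n1 by (simp add: field_simps power2_eq_square)
    finally show ?thesis unfolding sn .
  qed
  have "0 \<le> W" using lam_pos by (auto simp: W_def less_imp_le intro!: sum_nonneg mult_nonneg_nonneg)
  moreover have "0 \<le> (s / real n)\<^sup>2 * V2" using V2 by simp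
  ultimately show ?thesis using head tail
    by (simp add: sum_lessThan_split[OF k_le] D_def[symmetric] V2_def[symmetric] W_def[symmetric])
qed

section \<open>The Gram solver and the trace of the variance form\<close>

lemma full_quad_lower: "s / 2 * ip n m m \<le> ip p (xT n x m) (xT n x m)"
  using tail_quad_lower[of m] sum_nonneg[of "{..<k}" "\<lambda>i. (xT n x m i)\<^sup>2"]
  by (simp add: ip_self sum_lessThan_split[OF k_le])

lemma gram_apply: "(\<Sum>l<n. ip p (x j) (x l) * m l) = ip p (x j) (xT n x m)"
proof -
  have "(\<Sum>l<n. ip p (x j) (x l) * m l) = ip n m (\<lambda>l. ip p (x l) (x j))"
    by (simp add: ip_def[of n] ip_commute mult.commute)
  also have "\<dots> = ip p (x j) (xT n x m)" by (simp add: ip_xT ip_commute)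
  finally show ?thesis .
qed

text \<open>Coercivity, from \<open>full_quad_lower\<close>, makes the Gram matrix injective, which
  is all that inversion by cofactors asks for.\<close>

lemma gram_solve: 
  assumes "j < n"
  shows "ip p (x j) (xT n x (gram_solve n p x r)) = r j"
proof -
  have "u i = 0" if z: "\<And>i. i < n \<Longrightarrow> (\<Sum>j<n. ip p (x i) (x j) * u j) = 0" and i: "i < n" for u i
  proof -
    have "ip p (xT n x u) (xT n x u) = ip n u (\<lambda>j. ip p (x j) (xT n x u))" by (simp add: ip_xT)
    also have "\<dots> = 0" using z by (simp add: ip_def[of n] gram_apply)
    finally have "s / 2 * ip n u u \<le> 0" using full_quad_lower[of u] by simp
    hence "ip n u u = 0" using s_pos ip_self_nonneg[of n u] by (auto simp: mult_le_0_iff)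
    thus ?thesis using i by (simp add: ip_self_eq_0_iff)
  qed
  hence "(\<Sum>l<n. ip p (x j) (x l) * (\<Sum>l'<n. inv_entry n (\<lambda>j j'. ip p (x j) (x j')) l l' * r l')) = r j"
    by (rule inv_entry_right_inverse) (use assms in auto)
  thus ?thesis unfolding gram_apply[symmetric] gram_solve_def .
qed

text \<open>Pairing the Gram equation with its own solution \<open>m\<close> and using coercivity
  gives \<open>s / 2 * ip n m m <= ip n m r\<close>.\<close>

lemma nrm_gram_solve_le: "s / 2 * nrm n (gram_solve n p x r) \<le> nrm n r"
proof -
  let ?m = "gram_solve n p x r"
  have "s / 2 * ip n ?m ?m \<le> ip p (xT n x ?m) (xT n x ?m)" by (rule full_quad_lower)
  also have "\<dots> = ip n ?m (\<lambda>j. ip p (x j) (xT n x ?m))" by (simp add: ip_xT)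
  also have "\<dots> = ip n ?m r" by (simp add: ip_def[of n] gram_solve)
  also have "\<dots> \<le> nrm n ?m * nrm n r" using abs_ip_le[of n ?m r] by linarith
  finally have "nrm n ?m * (s / 2 * nrm n ?m) \<le> nrm n ?m * nrm n r"
    by (simp add: nrm_power2[symmetric] power2_eq_square mult_ac)
  thus ?thesis using nrm_nonneg[of n ?m] by (cases "nrm n ?m = 0") (auto simp: less_le mult_le_cancel_left)
qed

text \<open>Symmetry of the inverse Gram matrix moves it from the noise to column \<open>i\<close>
  of the design. Each coordinate of the interpolator becomes a linear form in the noise with
  coefficients determined by the design, as the conditional tail bound requires.\<close>

lemma xT_gram_solve: "xT n x (gram_solve n p x e) i = ip n (gram_solve n p x (\<lambda>j. x j i)) e"
proof -
  let ?m = "gram_solve n p x e" and ?r = "gram_solve n p x (\<lambda>j. x j i)"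
  have "xT n x ?m i = ip n ?m (\<lambda>j. ip p (x j) (xT n x ?r))"
    by (simp add: ip_def[of n] xT_def[of n x ?m] gram_solve)
  also have "\<dots> = ip n ?r (\<lambda>j. ip p (x j) (xT n x ?m))" by (simp add: ip_xT ip_commute)
  also have "\<dots> = ip n ?r e" by (simp add: ip_def[of n] gram_solve)
  finally show ?thesis .
qed

text \<open>The two blocks are treated differently. A head column is \<open>X\<close> applied to a
  coordinate vector, so its Gram solution is the multiplier for \<open>v = - e_i\<close> with zero
  right-hand side, and \<open>multiplier_le\<close> yields \<open>32 / n\<close> after weighting by
  \<open>lam i\<close>. For tail columns the crude norm bound on the Gram solution suffices, summed
  by \<open>trace\<close>.\<close>

lemma variance_trace_le:
  assumes trace: "(\<Sum>i\<in>{k..<p}. lam i * (\<Sum>j<n. (x j i)\<^sup>2)) \<le> 2 * real n * (\<Sum>i\<in>{k..<p}. (lam i)\<^sup>2)"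
  shows "(\<Sum>i<p. lam i * ip n (gram_solve n p x (\<lambda>j. x j i)) (gram_solve n p x (\<lambda>j. x j i)))
     \<le> 32 * (real k / real n + real n * (\<Sum>i\<in>{k..<p}. (lam i)\<^sup>2) / s\<^sup>2)"
proof -
  let ?r = "\<lambda>i. gram_solve n p x (\<lambda>j. x j i)"
  have n1: "real n > 0" using n_pos by simp
  have "(\<Sum>i<k. lam i * ip n (?r i) (?r i)) \<le> (\<Sum>i<k. 32 / real n)"
  proof (rule sum_mono)
    fix i assume "i \<in> {..<k}"
    hence i: "i < k" "i < p" using k_le by auto
    hence l: "lam i > 0" using lam_pos by simp
    define v where "v l = (if l = i then - 1 else 0 :: real)" for l
    have ip_v: "ip k u v = - u i" for u using i by (simp add: ip_def v_def if_distrib cong: if_cong)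
    have "s * nrm n (?r i) \<le> 4 * (s * sqrt (\<Sum>l<k. (v l)\<^sup>2 / lam l) * sqrt (2 / real n) + nrm n (\<lambda>_. 0))"
    proof (rule multiplier_le)
      fix j assume j: "j < n"
      have "ip k (x j) (xT n x (?r i)) + tail_op (?r i) j = x j i"
        using gram_solve[OF j, of "\<lambda>j. x j i"] by (simp add: ip_row_split tail_op_def)
      thus "tail_op (?r i) j + ip k (x j) (\<lambda>l. v l + xT n x (?r i) l) = 0"
        by (simp add: ip_linear ip_v)
    qed simp
    also have "(\<Sum>l<k. (v l)\<^sup>2 / lam l) = (\<Sum>l<k. if l = i then 1 / lam l else 0)"
      by (intro sum.cong) (auto simp: v_def)
    also have "\<dots> = 1 / lam i" using i by simp
    also have "4 * (s * sqrt (1 / lam i) * sqrt (2 / real n) + nrm n (\<lambda>_. 0))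
        = s * (4 * (sqrt (1 / lam i) * sqrt (2 / real n)))"
      by (simp add: nrm_def ip_def)
    finally have "nrm n (?r i) \<le> 4 * (sqrt (1 / lam i) * sqrt (2 / real n))"
      using s_pos by (simp only: mult_le_cancel_left_pos)
    hence "(nrm n (?r i))\<^sup>2 \<le> (4 * (sqrt (1 / lam i) * sqrt (2 / real n)))\<^sup>2" by (intro power_mono) auto
    hence "ip n (?r i) (?r i) \<le> 32 / (lam i * real n)" using l by (simp add: nrm_power2 power_mult_distrib)
    thus "lam i * ip n (?r i) (?r i) \<le> 32 / real n" using l n1 by (simp add: field_simps)
  qed
  hence head: "(\<Sum>i<k. lam i * ip n (?r i) (?r i)) \<le> 32 * (real k / real n)" by (simp add: mult.commute)
  have "(\<Sum>i\<in>{k..<p}. lam i * ip n (?r i) (?r i)) \<le> (\<Sum>i\<in>{k..<p}. 4 / s\<^sup>2 * (lam i * (\<Sum>j<n. (x j i)\<^sup>2)))"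
  proof (rule sum_mono)
    fix i assume "i \<in> {k..<p}"
    hence l: "lam i > 0" using lam_pos by simp
    have "nrm n (?r i) \<le> 2 / s * nrm n (\<lambda>j. x j i)"
      using nrm_gram_solve_le[of "\<lambda>j. x j i"] s_pos by (simp add: field_simps)
    hence "(nrm n (?r i))\<^sup>2 \<le> (2 / s * nrm n (\<lambda>j. x j i))\<^sup>2" by (intro power_mono) auto
    hence "ip n (?r i) (?r i) \<le> 4 / s\<^sup>2 * (\<Sum>j<n. (x j i)\<^sup>2)"
      by (simp add: nrm_power2 power_mult_distrib power_divide ip_self)
    from mult_left_mono[OF this, of "lam i"] l
    show "lam i * ip n (?r i) (?r i) \<le> 4 / s\<^sup>2 * (lam i * (\<Sum>j<n. (x j i)\<^sup>2))" by (simp add: mult_ac)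
  qed
  also have "\<dots> = 4 / s\<^sup>2 * (\<Sum>i\<in>{k..<p}. lam i * (\<Sum>j<n. (x j i)\<^sup>2))" by (simp add: sum_distrib_left)
  also have "\<dots> \<le> 4 / s\<^sup>2 * (2 * real n * (\<Sum>i\<in>{k..<p}. (lam i)\<^sup>2))" by (intro mult_left_mono trace) auto
  also have "\<dots> = 8 * (real n * (\<Sum>i\<in>{k..<p}. (lam i)\<^sup>2) / s\<^sup>2)" by simp
  also have "\<dots> \<le> 32 * (real n * (\<Sum>i\<in>{k..<p}. (lam i)\<^sup>2) / s\<^sup>2)" by (auto intro!: divide_right_mono mult_nonneg_nonneg sum_nonneg)
  finally show ?thesis using head by (simp add: sum_lessThan_split[OF k_le])
qed

end

section \<open>The estimator\<close>

lemma ip_restrict: "ip p (\<lambda>i. if i < p then u i else 0) v = ip p u v"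
  "ip p v (\<lambda>i. if i < p then u i else 0) = ip p v u"
  by (auto simp: ip_def intro!: sum.cong)

lemma ip_restrict_line: "ip p a (\<lambda>i. b i + t * (if i < p then u i else 0)) = ip p a b + t * ip p a u"
  unfolding ip_add_right ip_scale_right ip_restrict ..

lemma nrm_powr_three_halves: "nrm p u powr (3/2) = ip p u u powr (3/4)"
  by (simp add: nrm_def powr_half_sqrt[symmetric] powr_powr)

text \<open>First-order condition along the feasible line through \<open>\<theta>\<close> in
  direction \<open>h\<close>, truncated beyond \<open>p\<close> to stay admissible. As a power of
  the squared norm, the penalty is differentiable away from the origin, with derivative
  \<open>3/2 * ip p \<theta> h / sqrt T\<close>. A vanishing norm is treated apart: both sides are
  then 0.\<close>

lemma is_est_stationary:
  assumes est: "is_est n p \<omega> w \<theta>"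
    and h: "\<And>j. j < n \<Longrightarrow> ip p (fst (\<omega> j)) h = 0"
  shows "ip p \<theta> h = 2/3 * sqrt (nrm p \<theta>) * ip p w h"
proof (cases "nrm p \<theta> = 0")
  case True
  thus ?thesis by (auto simp: ip_def nrm_eq_0_iff)
next
  case False
  define T where "T = nrm p \<theta>"
  have T: "T > 0" using False by (simp add: T_def less_le)
  have T2: "ip p \<theta> \<theta> = T\<^sup>2" by (simp add: T_def nrm_power2)
  define g where "g t = T\<^sup>2 + 2 * t * ip p \<theta> h + t\<^sup>2 * ip p h h" for t
  have gt: "ip p (\<lambda>i. \<theta> i + t * (if i < p then h i else 0)) (\<lambda>i. \<theta> i + t * (if i < p then h i else 0)) = g t" for t
    unfolding ip_linear ip_restrict unfolding g_def T2[symmetric]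
    by (simp add: ip_commute[of p h \<theta>] power2_eq_square algebra_simps)
  define F where "F t = g t powr (3/4) - (ip p w \<theta> + t * ip p w h)" for t
  have min: "F 0 \<le> F t" for t
  proof -
    let ?\<theta>' = "\<lambda>i. \<theta> i + t * (if i < p then h i else 0)"
    have "nrm p \<theta> powr (3/2) - ip p w \<theta> \<le> nrm p ?\<theta>' powr (3/2) - ip p w ?\<theta>'"
      using est h unfolding is_est_def by (elim conjE allE[of _ ?\<theta>']) (simp add: ip_restrict_line)
    hence "ip p \<theta> \<theta> powr (3/4) - ip p w \<theta> \<le> g t powr (3/4) - ip p w ?\<theta>'"
      by (simp only: nrm_powr_three_halves gt)
    thus ?thesis by (simp add: F_def g_def T2 ip_restrict_line)
  qed
  have "((\<lambda>t. g t) has_real_derivative 2 * ip p \<theta> h) (at 0)"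
    unfolding g_def by (auto intro!: derivative_eq_intros)
  hence "(F has_real_derivative (3/4) * T\<^sup>2 powr (3/4 - 1) * (2 * ip p \<theta> h) - ip p w h) (at 0)"
    unfolding F_def using T by (auto intro!: derivative_eq_intros simp: g_def)
  from DERIV_local_min[OF this, of 1] min
  have "(3/4) * T\<^sup>2 powr (3/4 - 1) * (2 * ip p \<theta> h) = ip p w h" by simp
  moreover have "T\<^sup>2 powr (3/4 - 1) = 1 / sqrt T"
  proof -
    have "T\<^sup>2 powr (3/4 - 1) = T powr (- (1/2))" using T
      by (simp add: powr_powr flip: powr_numeral)
    thus ?thesis using T by (simp add: powr_minus powr_half_sqrt inverse_eq_divide)
  qed
  ultimately have "3/2 * ip p \<theta> h / sqrt T = ip p w h" by simp
  thus ?thesis using T by (simp add: T_def[symmetric] field_simps)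
qed

text \<open>Coercivity and compactness: the power 3/2 beats the linear term outside a ball, so a
  minimiser over the feasible part of a box is a global one. The box lives in the full function
  space, with factor \<open>{0}\<close> at every index from \<open>p\<close> on, which makes it
  compact in the product topology.\<close>

lemma is_est_exists:
  assumes feas: "\<And>j. j < n \<Longrightarrow> snd (\<omega> j) = ip p (fst (\<omega> j)) \<theta>1"
  shows "\<exists>\<theta>. is_est n p \<omega> w \<theta>"
proof -
  define f where "f \<theta> = nrm p \<theta> powr (3/2) - ip p w \<theta>" for \<theta>
  define \<theta>2 where "\<theta>2 i = (if i < p then \<theta>1 i else 0)" for i
  have feas2: "snd (\<omega> j) = ip p (fst (\<omega> j)) \<theta>2" if "j < n" for j
    using feas[OF that] by (simp add: \<theta>2_def[abs_def] ip_restrict)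
  \<comment> \<open>For norm \<open>T\<close> the objective is at least
    \<open>T * (sqrt T - nrm p w)\<close>; once \<open>T > B >= 1\<close> this exceeds the value at
    the feasible point \<open>\<theta>2\<close>.\<close>
  define B where "B = (nrm p w + \<bar>f \<theta>2\<bar> + 1)\<^sup>2"
  have B1: "1 \<le> B"
    unfolding B_def using nrm_nonneg[of p w] abs_ge_zero[of "f \<theta>2"] by (intro one_le_power) linarith
  have large: "f \<theta>2 < f \<theta>" if "B < nrm p \<theta>" for \<theta>
  proof -
    let ?T = "nrm p \<theta>"
    have T: "?T > 1" using that B1 by linarith
    have "nrm p w + \<bar>f \<theta>2\<bar> + 1 = sqrt B" by (simp add: B_def)
    also have "\<dots> \<le> sqrt ?T" using that by simp
    finally have le: "\<bar>f \<theta>2\<bar> + 1 \<le> sqrt ?T - nrm p w" by simp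
    have "f \<theta>2 < \<bar>f \<theta>2\<bar> + 1" by linarith
    also have "\<dots> \<le> ?T * (\<bar>f \<theta>2\<bar> + 1)" using T mult_right_mono[of 1 ?T "\<bar>f \<theta>2\<bar> + 1"] by simp
    also have "\<dots> \<le> ?T * (sqrt ?T - nrm p w)" using le T by (intro mult_left_mono) auto
    also have "\<dots> = ?T powr (3/2) - nrm p w * ?T"
    proof -
      have "?T powr (3/2) = ?T powr (1 + 1/2)" by simp
      also have "\<dots> = ?T * sqrt ?T" using T by (simp only: powr_add) (simp add: powr_half_sqrt)
      finally show ?thesis by (simp add: algebra_simps)
    qed
    also have "\<dots> \<le> f \<theta>" using abs_ip_le[of p w \<theta>] by (auto simp: f_def)
    finally show ?thesis .
  qed
  define Box where "Box = PiE UNIV (\<lambda>i. if i < p then {-B..B} else {0::real})"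
  define C where "C = {\<theta>. \<forall>j<n. snd (\<omega> j) = ip p (fst (\<omega> j)) \<theta>}"
  have cont_ip: "continuous_on UNIV (\<lambda>\<theta>. ip p a \<theta>)" for a :: "nat \<Rightarrow> real"
    unfolding ip_def by (intro continuous_intros continuous_on_product_coordinates)
  have cont_f: "continuous_on UNIV f"
    unfolding f_def nrm_def ip_def
    by (intro continuous_intros continuous_on_product_coordinates continuous_on_powr') (auto intro!: sum_nonneg)
  have "compact Box"
    unfolding Box_def compactin_euclidean_iff[symmetric] euclidean_product_topology[symmetric]
    by (subst compactin_PiE) auto
  moreover have "closed C"
  proof -
    have "C = (\<Inter>j\<in>{..<n}. {\<theta>. ip p (fst (\<omega> j)) \<theta> = snd (\<omega> j)})" by (auto simp: C_def)
    also have "closed \<dots>" by (intro closed_INT ballI closed_Collect_eq cont_ip continuous_on_const)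
    finally show ?thesis .
  qed
  ultimately have comp: "compact (Box \<inter> C)" by (rule compact_Int_closed)
  have in_box: "\<theta> \<in> Box" if "f \<theta> \<le> f \<theta>2" "\<forall>i\<ge>p. \<theta> i = 0" for \<theta>
  proof -
    have "nrm p \<theta> \<le> B" using large[of \<theta>] that(1) by (meson not_less)
    moreover have "\<bar>\<theta> i\<bar> \<le> nrm p \<theta>" if "i < p" for i
      unfolding nrm_def ip_self using that by (intro real_le_rsqrt) (auto intro!: member_le_sum)
    ultimately have "\<bar>\<theta> i\<bar> \<le> B" if "i < p" for i using that by (meson order_trans)
    thus ?thesis using that by (force simp: Box_def abs_le_iff)
  qed
  have "\<theta>2 \<in> Box \<inter> C" using in_box[of \<theta>2] feas2 by (auto simp: C_def \<theta>2_def)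
  then obtain \<theta> where \<theta>: "\<theta> \<in> Box \<inter> C" and min: "\<And>\<theta>'. \<theta>' \<in> Box \<inter> C \<Longrightarrow> f \<theta> \<le> f \<theta>'"
    using continuous_attains_inf[OF comp _ continuous_on_subset[OF cont_f]] by blast
  have "is_est n p \<omega> w \<theta>"
    unfolding is_est_def f_def[symmetric]
  proof (intro conjI allI impI)
    show "\<theta> i = 0" if "p \<le> i" for i
    proof -
      have "\<theta> i \<in> (if i < p then {-B..B} else {0})" using \<theta> unfolding Box_def by (intro PiE_mem[of \<theta> UNIV]) auto
      thus ?thesis using that by simp
    qed
    show "snd (\<omega> j) = ip p (fst (\<omega> j)) \<theta>" if "j < n" for j using \<theta> that by (auto simp: C_def)
    fix \<theta>' assume supp: "\<forall>i\<ge>p. \<theta>' i = 0" and fe: "\<forall>j<n. snd (\<omega> j) = ip p (fst (\<omega> j)) \<theta>'"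
    show "f \<theta> \<le> f \<theta>'"
    proof (cases "f \<theta>' \<le> f \<theta>2")
      case True
      thus ?thesis using in_box[OF _ supp] fe by (intro min) (auto simp: C_def)
    next
      case False
      thus ?thesis using min[OF \<open>\<theta>2 \<in> Box \<inter> C\<close>] by simp
    qed
  qed
  thus ?thesis by blast
qed

text \<open>Transfers a relative error of the norm to the factor
  \<open>2/3 * sqrt (nrm p \<theta>)\<close> of the stationarity condition, by a difference of
  squares with one nonnegative summand dropped.\<close>

lemma sqrt_relative_error_le:
  assumes "0 < \<rho>" "0 \<le> T"
  shows "\<bar>(sqrt T - sqrt \<rho>) / sqrt \<rho>\<bar> \<le> \<bar>T - \<rho>\<bar> / \<rho>"
proof -
  have "T - \<rho> = (sqrt T - sqrt \<rho>) * (sqrt T + sqrt \<rho>)" using assms by (simp add: algebra_simps)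
  hence "\<bar>T - \<rho>\<bar> = \<bar>sqrt T - sqrt \<rho>\<bar> * (sqrt T + sqrt \<rho>)" using assms by (simp add: abs_mult)
  also have "\<dots> \<ge> \<bar>sqrt T - sqrt \<rho>\<bar> * sqrt \<rho>" using assms by (intro mult_left_mono) auto
  finally have "\<bar>sqrt T - sqrt \<rho>\<bar> * sqrt \<rho> / \<rho> \<le> \<bar>T - \<rho>\<bar> / \<rho>" using assms by (intro divide_right_mono) auto
  moreover have "\<bar>sqrt T - sqrt \<rho>\<bar> * sqrt \<rho> / \<rho> = \<bar>(sqrt T - sqrt \<rho>) / sqrt \<rho>\<bar>"
    using assms by (simp add: abs_divide field_simps)
  ultimately show ?thesis by simp
qed

lemma abs_diff_le_of_squares:
  fixes q \<rho> :: real
  assumes "0 < \<rho>" "0 \<le> q"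
  shows "\<bar>q - \<rho>\<bar> \<le> \<bar>q\<^sup>2 - \<rho>\<^sup>2\<bar> / \<rho>"
proof -
  have "\<bar>q\<^sup>2 - \<rho>\<^sup>2\<bar> = \<bar>q - \<rho>\<bar> * (q + \<rho>)" using assms
    by (simp add: power2_eq_square square_diff_square_factored abs_mult)
  also have "\<dots> \<ge> \<bar>q - \<rho>\<bar> * \<rho>" using assms by (intro mult_left_mono) auto
  finally show ?thesis using assms by (simp add: field_simps)
qed

lemma square_sum4_le: "(a + b + c + d)\<^sup>2 \<le> 4 * (a\<^sup>2 + b\<^sup>2 + c\<^sup>2 + d\<^sup>2)" for a b c d :: real
  using square_sum2_le[of "a + b" "c + d"] square_sum2_le[of a b] square_sum2_le[of c d]
  by (simp add: add.assoc)

context good_design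
begin

text \<open>The squared norm of the interpolator is \<open>ip n \<mu> e\<close>, and
  \<open>\<mu>\<close> would be \<open>e / s\<close> for an exactly scalar Gram matrix. The defect
  \<open>s \<mu> - e\<close> consists of the tail deviation, of norm at most
  \<open>2 * \<eta> * nrm n e\<close>, and of the fitted head values \<open>X_head D\<close>, which
  the upper head condition bounds by means of the risk \<open>Vb\<close> of the interpolated
  noise.\<close>

lemma noise_energy_near:
  assumes Vb: "(\<Sum>i<p. lam i * (xT n x (gram_solve n p x e) i)\<^sup>2) \<le> Vb"
  shows "\<bar>s * (nrm p (xT n x (gram_solve n p x e)))\<^sup>2 - ip n e e\<bar> \<le> 2 * \<eta> * ip n e e + nrm n e * sqrt (2 * real n * Vb)"
proof -
  define \<mu> where "\<mu> = gram_solve n p x e"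
  define D where "D = xT n x \<mu>"
  have eq: "tail_op \<mu> j + ip k (x j) D = e j" if "j < n" for j
    using gram_solve[OF that, of e] by (simp add: ip_row_split tail_op_def D_def \<mu>_def)
  have q: "(nrm p D)\<^sup>2 = ip n \<mu> e"
  proof -
    have "ip p D D = ip n \<mu> (\<lambda>j. ip p (x j) D)" by (simp add: D_def ip_xT)
    thus ?thesis by (simp add: nrm_power2 ip_def[of n] D_def \<mu>_def gram_solve)
  qed
  have "s * (nrm p D)\<^sup>2 - ip n e e = ip n (\<lambda>j. s * \<mu> j - e j) e" by (simp add: q ip_linear)
  also have "\<bar>\<dots>\<bar> \<le> nrm n (\<lambda>j. s * \<mu> j - e j) * nrm n e" by (rule abs_ip_le)
  also have "nrm n (\<lambda>j. s * \<mu> j - e j) = nrm n (\<lambda>j. - ((tail_op \<mu> j - s * \<mu> j) + ip k (x j) D))"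
    unfolding nrm_def ip_def[of n] by (intro arg_cong[where f=sqrt] sum.cong refl) (auto simp: eq[symmetric] diff_diff_eq)
  also have "\<dots> \<le> nrm n (\<lambda>j. tail_op \<mu> j - s * \<mu> j) + nrm n (\<lambda>j. ip k (x j) D)"
    unfolding nrm_minus by (rule nrm_triangle)
  also have "\<dots> \<le> \<eta> * s * nrm n \<mu> + sqrt (2 * real n * Vb)"
  proof (rule add_mono[OF tail_op_near])
    have "(\<Sum>j<n. (ip k (x j) D)\<^sup>2) \<le> 2 * real n * (\<Sum>i<k. lam i * (D i)\<^sup>2)" by (rule head_upper)
    also have "\<dots> \<le> 2 * real n * Vb"
    proof (rule mult_left_mono)
      have "(\<Sum>i<k. lam i * (D i)\<^sup>2) \<le> (\<Sum>i<p. lam i * (D i)\<^sup>2)"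
        using k_le lam_pos by (intro sum_mono2) (auto simp: less_imp_le)
      also have "\<dots> \<le> Vb" using Vb by (simp add: D_def \<mu>_def)
      finally show "(\<Sum>i<k. lam i * (D i)\<^sup>2) \<le> Vb" .
    qed simp
    finally show "nrm n (\<lambda>j. ip k (x j) D) \<le> sqrt (2 * real n * Vb)"
      by (simp add: nrm_def ip_self)
  qed
  also have "\<dots> \<le> 2 * \<eta> * nrm n e + sqrt (2 * real n * Vb)"
  proof -
    have "s * nrm n \<mu> \<le> 2 * nrm n e" using nrm_gram_solve_le[of e] by (simp add: \<mu>_def)
    from mult_left_mono[OF this eta_nonneg] show ?thesis by (simp add: mult_ac)
  qed
  finally have "\<bar>s * (nrm p D)\<^sup>2 - ip n e e\<bar> \<le> (2 * \<eta> * nrm n e + sqrt (2 * real n * Vb)) * nrm n e"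
    by (simp add: mult_right_mono)
  thus ?thesis by (simp add: D_def \<mu>_def nrm_power2[of n, symmetric] power2_eq_square algebra_simps)
qed

text \<open>The estimator splits orthogonally into the minimum-norm interpolator of the responses and a
  kernel component of norm at most \<open>2/3 * sqrt (nrm p \<theta>) * nrm p w\<close>; orthogonality is what keeps the
  error in the norm bounded, rather than of order \<open>sqrt (nrm p \<theta>)\<close>.\<close>

lemma estimator_norm_near:
  assumes feas: "\<And>j. j < n \<Longrightarrow> ip p (x j) \<theta> = ip p (x j) th + e j"
    and stat: "\<And>h. (\<And>j. j < n \<Longrightarrow> ip p (x j) h = 0) \<Longrightarrow> ip p \<theta> h = 2/3 * sqrt (nrm p \<theta>) * ip p w h"
  shows "\<bar>nrm p \<theta> - nrm p (xT n x (gram_solve n p x e))\<bar> \<le> nrm p th + 4/9 * (nrm p w)\<^sup>2"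
proof -
  define y where "y j = ip p (x j) th + e j" for j
  define my where "my = gram_solve n p x y"
  define me where "me = gram_solve n p x e"
  define a where "a = nrm p (xT n x my)"
  define T where "T = nrm p \<theta>"
  define h where "h i = \<theta> i - xT n x my i" for i
  have Xh: "ip p (x j) h = 0" if "j < n" for j
    using feas[OF that] gram_solve[OF that, of y] by (simp add: h_def[abs_def] ip_linear my_def y_def)
  have orth: "ip p (xT n x my) h = 0"
    using ip_xT[of n my p x h] Xh by (simp add: ip_def[of n])
  have th: "ip p \<theta> h = 2/3 * sqrt T * ip p w h" unfolding T_def by (rule stat) (rule Xh)
  have hh: "ip p h h = ip p \<theta> h" using orth by (simp add: h_def[abs_def] ip_linear)
  have "nrm p h * nrm p h \<le> nrm p h * (2/3 * sqrt T * nrm p w)"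
  proof -
    have "nrm p h * nrm p h = 2/3 * sqrt T * ip p w h" using hh th by (simp add: nrm_power2[symmetric] power2_eq_square)
    also have "\<dots> \<le> 2/3 * sqrt T * (nrm p w * nrm p h)"
      using abs_ip_le[of p w h] by (intro mult_left_mono) (auto simp: T_def)
    finally show ?thesis by (simp add: mult_ac)
  qed
  hence nh: "nrm p h \<le> 2/3 * sqrt T * nrm p w"
    using nrm_nonneg[of p h] by (cases "nrm p h = 0") (auto simp: less_le mult_le_cancel_left T_def)
  have "\<theta> = (\<lambda>i. xT n x my i + h i)" by (simp add: h_def)
  hence "ip p \<theta> \<theta> = ip p (\<lambda>i. xT n x my i + h i) (\<lambda>i. xT n x my i + h i)" by simp
  hence T2: "T\<^sup>2 = a\<^sup>2 + (nrm p h)\<^sup>2"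
    using orth by (simp add: ip_linear T_def a_def nrm_power2 ip_commute[of p h "xT n x my"])
  have a0: "0 \<le> a" "0 \<le> T" by (simp_all add: a_def T_def)
  have "a\<^sup>2 \<le> T\<^sup>2" unfolding T2 by simp
  hence aT: "a \<le> T" using a0(2) by (rule power2_le_imp_le)
  have "(nrm p h)\<^sup>2 \<le> (2/3 * sqrt T * nrm p w)\<^sup>2" using nh by (intro power_mono) auto
  hence "T\<^sup>2 - a\<^sup>2 \<le> 4/9 * (nrm p w)\<^sup>2 * T" using T2 a0 by (simp add: power_mult_distrib power_divide mult_ac)
  also have "\<dots> \<le> 4/9 * (nrm p w)\<^sup>2 * (T + a)" using a0 by (intro mult_left_mono) auto
  finally have "(T - a) * (T + a) \<le> 4/9 * (nrm p w)\<^sup>2 * (T + a)" by (simp add: power2_eq_square algebra_simps)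
  \<comment> \<open>The factor \<open>T\<close> in the bound for \<open>T^2 - a^2\<close> cancels
    against \<open>T + a\<close>, leaving a bound independent of \<open>T\<close>.\<close>
  hence Ta: "T - a \<le> 4/9 * (nrm p w)\<^sup>2"
  proof (cases "T + a = 0")
    case True
    hence "T = 0" "a = 0" using a0 by linarith+
    thus ?thesis by simp
  qed (use a0 in \<open>simp add: mult_le_cancel_right\<close>)
  \<comment> \<open>\<open>z\<close> is the minimum-norm interpolator of the signal
    \<open>X th\<close>, a projection of \<open>th\<close>, hence of norm at most
    \<open>nrm p th\<close>.\<close>
  define z where "z = xT n x (\<lambda>j. my j - me j)"
  have zi: "z i = xT n x my i - xT n x me i" for i by (simp add: z_def xT_diff)
  have "ip p z z = ip n (\<lambda>j. my j - me j) (\<lambda>j. ip p (x j) z)" by (simp add: z_def ip_xT)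
  also have "\<dots> = ip n (\<lambda>j. my j - me j) (\<lambda>j. ip p (x j) th)"
    unfolding ip_def[of n] by (intro sum.cong refl)
      (auto simp: zi[abs_def] ip_linear my_def me_def gram_solve y_def)
  also have "\<dots> = ip p z th" by (simp add: z_def ip_xT)
  also have "\<dots> \<le> nrm p z * nrm p th" using abs_ip_le[of p z th] by linarith
  finally have "nrm p z * nrm p z \<le> nrm p z * nrm p th" by (simp add: nrm_power2[symmetric] power2_eq_square)
  hence nz: "nrm p z \<le> nrm p th"
    using nrm_nonneg[of p z] by (cases "nrm p z = 0") (auto simp: less_le mult_le_cancel_left)
  have "a \<le> nrm p (xT n x me) + nrm p z"
    using nrm_triangle[of p "xT n x me" z] by (simp add: zi a_def)
  moreover have "nrm p (xT n x me) \<le> a + nrm p z"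
    using nrm_triangle_diff[of p "xT n x my" z] by (simp add: zi a_def)
  ultimately show ?thesis using nz Ta aT by (simp add: T_def[symmetric] me_def[symmetric] abs_le_iff)
qed

text \<open>The difference \<open>g\<close> of the two sides lies in the kernel of the design, while
  stationarity and the range of \<open>X^T\<close> make it orthogonal to that kernel; hence
  \<open>ip p g g = 0\<close>. The number \<open>r\<close> is the relative error made in replacing
  the true multiple of the initialisation by \<open>ps\<close>.\<close>

lemma estimator_decomposition:
  assumes feas: "\<And>j. j < n \<Longrightarrow> ip p (x j) \<theta> = ip p (x j) th + e j"
    and stat: "\<And>h. (\<And>j. j < n \<Longrightarrow> ip p (x j) h = 0) \<Longrightarrow> ip p \<theta> h = (1 + r) * ip p ps h"
    and \<mu>1: "\<And>j. j < n \<Longrightarrow> ip p (x j) (\<lambda>i. (ps i - th i) + xT n x \<mu>1 i) = 0"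
    and \<mu>2: "\<And>j. j < n \<Longrightarrow> ip p (x j) (\<lambda>i. ps i + xT n x \<mu>2 i) = 0"
    and i: "i < p"
  shows "\<theta> i - th i = ((ps i - th i) + xT n x \<mu>1 i) + r * (ps i + xT n x \<mu>2 i) + xT n x (gram_solve n p x e) i"
proof -
  let ?m = "gram_solve n p x e"
  define g where "g i = \<theta> i - th i - ((ps i - th i) + xT n x \<mu>1 i) - r * (ps i + xT n x \<mu>2 i) - xT n x ?m i" for i
  have Xg: "ip p (x j) g = 0" if "j < n" for j
    unfolding g_def[abs_def]
    unfolding ip_diff_right[of p "x j" _ "xT n x ?m"] ip_diff_right[of p "x j" _ "\<lambda>i. r * (ps i + xT n x \<mu>2 i)"]
      ip_diff_right[of p "x j" _ "\<lambda>i. (ps i - th i) + xT n x \<mu>1 i"] ip_scale_right \<mu>1[OF that] \<mu>2[OF that] gram_solve[OF that]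
    using feas[OF that] by (simp add: ip_linear)
  have xg: "ip p (xT n x m) g = 0" for m
    using ip_xT[of n m p x g] Xg by (simp add: ip_def[of n])
  have "ip p g g = ip p \<theta> g - ip p th g - (ip p ps g - ip p th g) - r * ip p ps g"
    unfolding arg_cong[OF g_def[abs_def, THEN meta_eq_to_obj_eq], of "\<lambda>a. ip p a g"] ip_linear xg by simp
  also have "\<dots> = 0" using stat[OF Xg] by (simp add: algebra_simps)
  finally have "g i = 0" using i by (simp add: ip_self_eq_0_iff)
  thus ?thesis by (simp add: g_def)
qed

definition bias_form :: "(nat \<Rightarrow> real) \<Rightarrow> real" where
  "bias_form v = (s / real n)\<^sup>2 * (\<Sum>i<k. (v i)\<^sup>2 / lam i) + (\<Sum>i\<in>{k..<p}. lam i * (v i)\<^sup>2)"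

lemma bias_form_nonneg: "0 \<le> bias_form v"
  using lam_pos k_le by (auto simp: bias_form_def less_imp_le intro!: add_nonneg_nonneg mult_nonneg_nonneg sum_nonneg divide_nonneg_nonneg)

text \<open>The target norm is \<open>\<rho> = sig * sqrt (n / s)\<close>, and
  \<open>1 + r = sqrt (T / \<rho>)\<close>. The four summands bounding \<open>r\<close> come from
  the bounded error of \<open>estimator_norm_near\<close> (at most \<open>1 + 4/9\<close>), the tail
  deviation, the head fit of the noise, and the fluctuation of its energy. Three squares in the
  decomposition give \<open>1800 = 3 * 600\<close>, four squares in \<open>r\<close> give
  \<open>7200 = 4 * 1800\<close>.\<close>

lemma estimator_risk_le:
  assumes sig: "0 < sig"
    and feas: "\<And>j. j < n \<Longrightarrow> ip p (x j) \<theta> = ip p (x j) th + e j"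
    and stat: "\<And>h. (\<And>j. j < n \<Longrightarrow> ip p (x j) h = 0) \<Longrightarrow> ip p \<theta> h = 2/3 * sqrt (nrm p \<theta>) * ip p w h"
    and ps: "\<And>i. ps i = 2/3 * sqrt (sig * sqrt (real n / s)) * w i"
    and tail1: "(\<Sum>j<n. (\<Sum>i\<in>{k..<p}. x j i * (ps i - th i))\<^sup>2) \<le> 2 * real n * (\<Sum>i\<in>{k..<p}. lam i * (ps i - th i)\<^sup>2)"
    and tail2: "(\<Sum>j<n. (\<Sum>i\<in>{k..<p}. x j i * ps i)\<^sup>2) \<le> 2 * real n * (\<Sum>i\<in>{k..<p}. lam i * (ps i)\<^sup>2)"
    and Vb: "(\<Sum>i<p. lam i * (xT n x (gram_solve n p x e) i)\<^sup>2) \<le> Vb"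
    and noise: "\<bar>ip n e e - real n * sig\<^sup>2\<bar> \<le> real n * \<kappa>" and "0 \<le> \<kappa>"
    and norms: "nrm p th \<le> 1" "nrm p w \<le> 1"
  shows "(\<Sum>i<p. lam i * (\<theta> i - th i)\<^sup>2) \<le> 1800 * bias_form (\<lambda>i. ps i - th i) + 3 * Vb
     + 7200 * bias_form ps * (4 * s / (real n * sig\<^sup>2)
         + (4 * \<eta>\<^sup>2 * (sig\<^sup>2 + \<kappa>)\<^sup>2 + 2 * (sig\<^sup>2 + \<kappa>) * Vb + \<kappa>\<^sup>2) / sig ^ 4)"
proof -
  define \<rho> where "\<rho> = sig * sqrt (real n / s)"
  define T where "T = nrm p \<theta>"
  define q where "q = nrm p (xT n x (gram_solve n p x e))"
  define Eb where "Eb = sig\<^sup>2 + \<kappa>"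
  define r where "r = (sqrt T - sqrt \<rho>) / sqrt \<rho>"
  have n1: "real n > 0" using n_pos by simp
  have \<rho>: "\<rho> > 0" using sig s_pos n1 by (simp add: \<rho>_def)
  have \<rho>2: "\<rho>\<^sup>2 = sig\<^sup>2 * (real n / s)" using s_pos by (simp add: \<rho>_def power_mult_distrib)
  have nn: "0 \<le> T" "0 \<le> q" "0 < Eb" using sig \<open>0 \<le> \<kappa>\<close> by (auto simp: T_def q_def Eb_def add_pos_nonneg)
  have Vb0: "0 \<le> Vb"
    using lam_pos by (intro order_trans[OF sum_nonneg Vb]) (auto simp: less_imp_le)
  have ee: "ip n e e \<le> real n * Eb" using noise by (simp add: Eb_def abs_le_iff algebra_simps)
  have nrm_e: "nrm n e \<le> sqrt (real n * Eb)" unfolding nrm_def using ee by simp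

  have rel: "\<bar>r\<bar> \<le> 2 / \<rho> + 2 * \<eta> * Eb / sig\<^sup>2 + sqrt (2 * Eb * Vb) / sig\<^sup>2 + \<kappa> / sig\<^sup>2"
  proof -
    have "(nrm p w)\<^sup>2 \<le> 1" using norms by (simp add: power_le_one)
    hence Tq: "\<bar>T - q\<bar> \<le> 2" using estimator_norm_near[OF feas stat] norms by (simp add: T_def q_def)
    have "\<bar>s * q\<^sup>2 - real n * sig\<^sup>2\<bar> \<le> (2 * \<eta> * ip n e e + nrm n e * sqrt (2 * real n * Vb)) + real n * \<kappa>"
      using noise_energy_near[OF Vb] noise by (simp add: q_def)
    also have "\<dots> \<le> (2 * \<eta> * (real n * Eb) + sqrt (real n * Eb) * sqrt (2 * real n * Vb)) + real n * \<kappa>"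
      using eta_nonneg nrm_e Vb0 ee nn by (intro add_mono mult_mono order_refl) (auto simp: less_imp_le)
    also have "sqrt (real n * Eb) * sqrt (2 * real n * Vb) = real n * sqrt (2 * Eb * Vb)"
    proof -
      have "sqrt (real n * Eb) * sqrt (2 * real n * Vb) = sqrt ((real n)\<^sup>2 * (2 * Eb * Vb))"
        by (simp add: real_sqrt_mult[symmetric] power2_eq_square mult_ac)
      thus ?thesis by (simp add: real_sqrt_mult)
    qed
    finally have "\<bar>s * q\<^sup>2 - real n * sig\<^sup>2\<bar> \<le> real n * (2 * \<eta> * Eb + sqrt (2 * Eb * Vb) + \<kappa>)"
      by (simp add: algebra_simps)
    hence main: "\<bar>s * q\<^sup>2 - real n * sig\<^sup>2\<bar> / (real n * sig\<^sup>2) \<le> (2 * \<eta> * Eb + sqrt (2 * Eb * Vb) + \<kappa>) / sig\<^sup>2"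
      using n1 sig by (simp add: field_simps)
    have "\<bar>q - \<rho>\<bar> / \<rho> \<le> \<bar>q\<^sup>2 - \<rho>\<^sup>2\<bar> / \<rho> / \<rho>"
      using abs_diff_le_of_squares[OF \<rho>, of q] nn \<rho> by (intro divide_right_mono) auto
    also have "\<dots> = \<bar>q\<^sup>2 - \<rho>\<^sup>2\<bar> / \<rho>\<^sup>2" by (simp add: power2_eq_square)
    also have "\<dots> = \<bar>s * q\<^sup>2 - real n * sig\<^sup>2\<bar> / (real n * sig\<^sup>2)"
    proof -
      have "s * q\<^sup>2 - real n * sig\<^sup>2 = s * (q\<^sup>2 - \<rho>\<^sup>2)" using s_pos by (simp add: \<rho>2 field_simps)
      hence "\<bar>s * q\<^sup>2 - real n * sig\<^sup>2\<bar> = s * \<bar>q\<^sup>2 - \<rho>\<^sup>2\<bar>" using s_pos by (simp add: abs_mult)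
      thus ?thesis using s_pos n1 sig by (simp add: \<rho>2 field_simps)
    qed
    finally have qr: "\<bar>q - \<rho>\<bar> / \<rho> \<le> (2 * \<eta> * Eb + sqrt (2 * Eb * Vb) + \<kappa>) / sig\<^sup>2" using main by linarith
    have "\<bar>r\<bar> \<le> \<bar>T - \<rho>\<bar> / \<rho>" unfolding r_def by (rule sqrt_relative_error_le[OF \<rho> nn(1)])
    also have "\<dots> \<le> (\<bar>T - q\<bar> + \<bar>q - \<rho>\<bar>) / \<rho>" using \<rho> by (intro divide_right_mono) auto
    also have "\<dots> \<le> 2 / \<rho> + (2 * \<eta> * Eb + sqrt (2 * Eb * Vb) + \<kappa>) / sig\<^sup>2"
      unfolding add_divide_distrib[of "\<bar>T - q\<bar>"] using Tq \<rho> qr by (intro add_mono divide_right_mono) auto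
    finally show ?thesis by (simp add: add_divide_distrib)
  qed
  have r2: "r\<^sup>2 \<le> 4 * (4 * s / (real n * sig\<^sup>2) + (4 * \<eta>\<^sup>2 * Eb\<^sup>2 + 2 * Eb * Vb + \<kappa>\<^sup>2) / sig ^ 4)"
  proof -
    have "r\<^sup>2 = \<bar>r\<bar>\<^sup>2" by simp
    also have "\<dots> \<le> (2 / \<rho> + 2 * \<eta> * Eb / sig\<^sup>2 + sqrt (2 * Eb * Vb) / sig\<^sup>2 + \<kappa> / sig\<^sup>2)\<^sup>2"
      using rel by (intro power_mono) auto
    also have "\<dots> \<le> 4 * ((2 / \<rho>)\<^sup>2 + (2 * \<eta> * Eb / sig\<^sup>2)\<^sup>2 + (sqrt (2 * Eb * Vb) / sig\<^sup>2)\<^sup>2 + (\<kappa> / sig\<^sup>2)\<^sup>2)"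
      by (rule square_sum4_le)
    also have "(2 / \<rho>)\<^sup>2 = 4 * s / (real n * sig\<^sup>2)" by (simp add: power_divide \<rho>2)
    also have "(sqrt (2 * Eb * Vb) / sig\<^sup>2)\<^sup>2 = 2 * Eb * Vb / sig ^ 4" using nn Vb0 by (simp add: power_divide flip: power_mult)
    also have "(2 * \<eta> * Eb / sig\<^sup>2)\<^sup>2 = 4 * \<eta>\<^sup>2 * Eb\<^sup>2 / sig ^ 4" by (simp add: power_divide power_mult_distrib flip: power_mult)
    also have "(\<kappa> / sig\<^sup>2)\<^sup>2 = \<kappa>\<^sup>2 / sig ^ 4" by (simp add: power_divide flip: power_mult)
    finally show ?thesis by (simp add: add_divide_distrib add_ac)
  qed
  define \<mu>1 where "\<mu>1 = gram_solve n p x (\<lambda>j. - ip p (x j) (\<lambda>i. ps i - th i))"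
  define \<mu>2 where "\<mu>2 = gram_solve n p x (\<lambda>j. - ip p (x j) ps)"
  have o1: "ip p (x j) (\<lambda>i. (ps i - th i) + xT n x \<mu>1 i) = 0" if "j < n" for j
    unfolding ip_add_right \<mu>1_def using gram_solve[OF that] by simp
  have o2: "ip p (x j) (\<lambda>i. ps i + xT n x \<mu>2 i) = 0" if "j < n" for j
    unfolding ip_add_right \<mu>2_def using gram_solve[OF that] by simp
  have stat': "ip p \<theta> h = (1 + r) * ip p ps h" if "\<And>j. j < n \<Longrightarrow> ip p (x j) h = 0" for h
  proof -
    have "ps = (\<lambda>i. (2/3 * sqrt \<rho>) * w i)" by (auto simp: ps \<rho>_def)
    hence "ip p ps h = ip p (\<lambda>i. (2/3 * sqrt \<rho>) * w i) h" by (rule arg_cong)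
    hence "(1 + r) * ip p ps h = (1 + r) * (2/3 * sqrt \<rho>) * ip p w h" unfolding ip_scale_left by simp
    also have "(1 + r) * (2/3 * sqrt \<rho>) = 2/3 * sqrt T" using \<rho> by (simp add: r_def field_simps)
    finally show ?thesis using stat[OF that] by (simp add: T_def)
  qed
  let ?a = "\<lambda>i. (ps i - th i) + xT n x \<mu>1 i" and ?b = "\<lambda>i. ps i + xT n x \<mu>2 i"
    and ?c = "xT n x (gram_solve n p x e)"
  have "(\<Sum>i<p. lam i * (\<theta> i - th i)\<^sup>2) \<le> (\<Sum>i<p. 3 * (lam i * (?a i)\<^sup>2) + 3 * r\<^sup>2 * (lam i * (?b i)\<^sup>2) + 3 * (lam i * (?c i)\<^sup>2))"
  proof (rule sum_mono)
    fix i assume "i \<in> {..<p}"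
    hence i: "i < p" by simp
    have "\<theta> i - th i = ?a i + r * ?b i + ?c i"
      by (rule estimator_decomposition) (use feas stat' o1 o2 i in auto)
    hence "(\<theta> i - th i)\<^sup>2 \<le> 3 * ((?a i)\<^sup>2 + (r * ?b i)\<^sup>2 + (?c i)\<^sup>2)"
      by (simp only: square_sum3_le)
    hence "(\<theta> i - th i)\<^sup>2 \<le> 3 * ((?a i)\<^sup>2 + r\<^sup>2 * (?b i)\<^sup>2 + (?c i)\<^sup>2)"
      by (simp only: power_mult_distrib)
    from mult_left_mono[OF this, of "lam i"] lam_pos[OF i]
    show "lam i * (\<theta> i - th i)\<^sup>2 \<le> 3 * (lam i * (?a i)\<^sup>2) + 3 * r\<^sup>2 * (lam i * (?b i)\<^sup>2) + 3 * (lam i * (?c i)\<^sup>2)"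
      by (simp add: algebra_simps)
  qed
  also have "\<dots> = 3 * (\<Sum>i<p. lam i * (?a i)\<^sup>2) + 3 * r\<^sup>2 * (\<Sum>i<p. lam i * (?b i)\<^sup>2) + 3 * (\<Sum>i<p. lam i * (?c i)\<^sup>2)"
    by (simp add: sum.distrib sum_distrib_left)
  also have "\<dots> \<le> 3 * (600 * bias_form (\<lambda>i. ps i - th i)) + 3 * r\<^sup>2 * (600 * bias_form ps) + 3 * Vb"
    unfolding bias_form_def using Vb
    by (intro add_mono mult_left_mono bias_le o1 o2 tail1 tail2) auto
  also have "3 * r\<^sup>2 * (600 * bias_form ps) \<le> 3 * (4 * (4 * s / (real n * sig\<^sup>2) + (4 * \<eta>\<^sup>2 * Eb\<^sup>2 + 2 * Eb * Vb + \<kappa>\<^sup>2) / sig ^ 4)) * (600 * bias_form ps)"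
    using r2 bias_form_nonneg[of ps] by (intro mult_right_mono mult_left_mono) auto
  finally show ?thesis unfolding Eb_def by (simp add: mult_ac)
qed

end

section \<open>Concentration of squares of sub-Gaussian variables\<close>

text \<open>Stated with the nonnegative integral, so that finiteness of every exponential moment is
  part of the inequality.\<close>

definition subgaussian :: "'a measure \<Rightarrow> real \<Rightarrow> ('a \<Rightarrow> real) \<Rightarrow> bool" where
  "subgaussian M \<sigma> g \<longleftrightarrow> g \<in> borel_measurable M \<and>
     (\<forall>t. (\<integral>\<^sup>+\<omega>. ennreal (exp (t * g \<omega>)) \<partial>M) \<le> ennreal (exp (\<sigma>\<^sup>2 * t\<^sup>2 / 2)))"

lemma nn_integral_normal_density: "0 < \<sigma> \<Longrightarrow> (\<integral>\<^sup>+\<xi>. ennreal (normal_density \<mu> \<sigma> \<xi>) \<partial>lborel) = 1"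
  by (subst nn_integral_eq_integral) auto

lemma nn_integral_normal_exp:
  "(\<integral>\<^sup>+\<xi>. ennreal (normal_density 0 1 \<xi> * exp (a * \<xi>)) \<partial>lborel) = ennreal (exp (a\<^sup>2 / 2))"
proof -
  have "normal_density 0 1 \<xi> * exp (a * \<xi>) = exp (a\<^sup>2 / 2) * normal_density a 1 \<xi>" for \<xi>
  proof -
    have "- \<xi>\<^sup>2 / 2 + a * \<xi> = a\<^sup>2 / 2 + - (\<xi> - a)\<^sup>2 / 2" by (simp add: power2_eq_square field_simps)
    hence "exp (- \<xi>\<^sup>2 / 2) * exp (a * \<xi>) = exp (a\<^sup>2 / 2) * exp (- (\<xi> - a)\<^sup>2 / 2)"
      by (simp only: exp_add[symmetric])
    thus ?thesis by (simp add: normal_density_def)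
  qed
  thus ?thesis by (simp add: ennreal_mult nn_integral_cmult nn_integral_normal_density)
qed

lemma nn_integral_normal_exp_square:
  "(\<integral>\<^sup>+\<xi>. ennreal (normal_density 0 1 \<xi> * exp (\<xi>\<^sup>2 / 4)) \<partial>lborel) \<le> 2"
proof -
  have "normal_density 0 1 \<xi> * exp (\<xi>\<^sup>2 / 4) = sqrt 2 * normal_density 0 (sqrt 2) \<xi>" for \<xi>
  proof -
    have "exp (- \<xi>\<^sup>2 / 2) * exp (\<xi>\<^sup>2 / 4) = exp (- \<xi>\<^sup>2 / 4)"
      by (simp only: exp_add[symmetric]) (simp add: field_simps)
    thus ?thesis by (simp add: normal_density_def real_sqrt_mult field_simps)
  qed
  hence "(\<integral>\<^sup>+\<xi>. ennreal (normal_density 0 1 \<xi> * exp (\<xi>\<^sup>2 / 4)) \<partial>lborel) = ennreal (sqrt 2)"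
    by (simp add: ennreal_mult nn_integral_cmult nn_integral_normal_density)
  also have "\<dots> \<le> ennreal 2" by (intro ennreal_leI real_le_lsqrt) auto
  finally show ?thesis by simp
qed

text \<open>The square is linearised by writing \<open>exp (a\<^sup>2 / 2)\<close> as the Laplace transform of a Gaussian.\<close>

lemma nn_integral_exp_square_le:
  assumes "sigma_finite_measure M" and [measurable]: "F \<in> borel_measurable M" "g \<in> borel_measurable M"
    and \<sigma>: "0 < \<sigma>"
    and le: "\<And>t. (\<integral>\<^sup>+x. F x * ennreal (exp (t * g x)) \<partial>M) \<le> ennreal (exp (\<sigma>\<^sup>2 * t\<^sup>2 / 2)) * C"
  shows "(\<integral>\<^sup>+x. F x * ennreal (exp ((g x)\<^sup>2 / (4 * \<sigma>\<^sup>2))) \<partial>M) \<le> 2 * C"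
proof -
  interpret M: sigma_finite_measure M by fact
  interpret pair_sigma_finite lborel M by standard
  \<comment> \<open>At this scale the Gaussian integral of \<open>exp (c * g x * \<xi>)\<close> is
    the wanted exponential of the square, while the sub-Gaussian bound produces only
    \<open>exp (\<xi>^2 / 4)\<close>, still integrable against the standard Gaussian with value
    \<open>sqrt 2 <= 2\<close>.\<close>
  define c where "c = 1 / (sqrt 2 * \<sigma>)"
  have c2: "c\<^sup>2 = 1 / (2 * \<sigma>\<^sup>2)" by (simp add: c_def power_divide power_mult_distrib)
  let ?N = "normal_density 0 1"
  have "(\<integral>\<^sup>+x. F x * ennreal (exp ((g x)\<^sup>2 / (4 * \<sigma>\<^sup>2))) \<partial>M) =
     (\<integral>\<^sup>+x. (\<integral>\<^sup>+\<xi>. F x * ennreal (?N \<xi> * exp (c * g x * \<xi>)) \<partial>lborel) \<partial>M)"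
  proof (rule nn_integral_cong)
    fix x
    have "(c * g x)\<^sup>2 / 2 = (g x)\<^sup>2 / (4 * \<sigma>\<^sup>2)" by (simp add: power_mult_distrib c2)
    thus "F x * ennreal (exp ((g x)\<^sup>2 / (4 * \<sigma>\<^sup>2))) = (\<integral>\<^sup>+\<xi>. F x * ennreal (?N \<xi> * exp (c * g x * \<xi>)) \<partial>lborel)"
      by (subst nn_integral_cmult) (auto simp: nn_integral_normal_exp)
  qed
  also have "\<dots> = (\<integral>\<^sup>+\<xi>. (\<integral>\<^sup>+x. F x * ennreal (?N \<xi> * exp (c * g x * \<xi>)) \<partial>M) \<partial>lborel)"
    by (rule Fubini') measurable
  also have "\<dots> \<le> (\<integral>\<^sup>+\<xi>. ennreal (?N \<xi> * exp (\<xi>\<^sup>2 / 4)) * C \<partial>lborel)"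
  proof (rule nn_integral_mono)
    fix \<xi> :: real
    have "(\<integral>\<^sup>+x. F x * ennreal (?N \<xi> * exp (c * g x * \<xi>)) \<partial>M) = (\<integral>\<^sup>+x. ennreal (?N \<xi>) * (F x * ennreal (exp ((c * \<xi>) * g x))) \<partial>M)"
      by (intro nn_integral_cong) (simp add: ennreal_mult mult_ac)
    also have "\<dots> = ennreal (?N \<xi>) * (\<integral>\<^sup>+x. F x * ennreal (exp ((c * \<xi>) * g x)) \<partial>M)"
      by (rule nn_integral_cmult) measurable
    also have "\<dots> \<le> ennreal (?N \<xi>) * (ennreal (exp (\<sigma>\<^sup>2 * (c * \<xi>)\<^sup>2 / 2)) * C)"
      by (intro mult_left_mono le) auto
    also have "\<sigma>\<^sup>2 * (c * \<xi>)\<^sup>2 / 2 = \<xi>\<^sup>2 / 4" using \<sigma> by (simp add: power_mult_distrib c2)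
    finally show "(\<integral>\<^sup>+x. F x * ennreal (?N \<xi> * exp (c * g x * \<xi>)) \<partial>M) \<le> ennreal (?N \<xi> * exp (\<xi>\<^sup>2 / 4)) * C"
      by (simp add: ennreal_mult mult.assoc)
  qed
  also have "\<dots> = (\<integral>\<^sup>+\<xi>. ennreal (?N \<xi> * exp (\<xi>\<^sup>2 / 4)) \<partial>lborel) * C"
    by (rule nn_integral_multc) measurable
  also have "\<dots> \<le> 2 * C" by (intro mult_right_mono nn_integral_normal_exp_square) auto
  finally show ?thesis .
qed

text \<open>Second-order Taylor expansion: the intermediate point is at most \<open>|y| / 2\<close>,
  and the factor \<open>y^2\<close> is absorbed by spending another
  \<open>exp (|y| / 2)\<close>.\<close>

lemma exp_le_quadratic:
  fixes \<theta> y :: real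
  assumes "\<bar>\<theta>\<bar> \<le> 1/2"
  shows "exp (\<theta> * y) \<le> 1 + \<theta> * y + 4 * \<theta>\<^sup>2 * exp \<bar>y\<bar>"
proof -
  obtain t where t: "\<bar>t\<bar> \<le> \<bar>\<theta> * y\<bar>" "exp (\<theta> * y) = (\<Sum>m<2. (\<theta> * y) ^ m / fact m) + exp t / fact 2 * (\<theta> * y)\<^sup>2"
    using Maclaurin_exp_le[of "\<theta> * y" 2] by blast
  have "\<bar>\<theta> * y\<bar> \<le> 1/2 * \<bar>y\<bar>" unfolding abs_mult using assms by (intro mult_right_mono) auto
  hence "t \<le> \<bar>y\<bar> / 2" using t(1) by linarith
  hence "exp t / 2 * (\<theta> * y)\<^sup>2 \<le> exp (\<bar>y\<bar> / 2) / 2 * (\<theta> * y)\<^sup>2" by (intro mult_right_mono divide_right_mono) auto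
  also have "\<dots> = 4 * \<theta>\<^sup>2 * (exp (\<bar>y\<bar> / 2) * ((\<bar>y\<bar> / 2)\<^sup>2 / 2))" by (simp add: power_mult_distrib power_divide)
  also have "\<dots> \<le> 4 * \<theta>\<^sup>2 * (exp (\<bar>y\<bar> / 2) * exp (\<bar>y\<bar> / 2))"
  proof (intro mult_left_mono)
    have "1 + \<bar>y\<bar> / 2 + (\<bar>y\<bar> / 2)\<^sup>2 / 2 \<le> exp (\<bar>y\<bar> / 2)" by (rule exp_lower_Taylor_quadratic) simp
    thus "(\<bar>y\<bar> / 2)\<^sup>2 / 2 \<le> exp (\<bar>y\<bar> / 2)" using abs_ge_zero[of y] by linarith
  qed auto
  also have "exp (\<bar>y\<bar> / 2) * exp (\<bar>y\<bar> / 2) = exp \<bar>y\<bar>" by (simp flip: exp_add)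
  finally show ?thesis using t(2) by (simp add: numeral_2_eq_2)
qed

text \<open>Centring removes the linear term of the exponential and leaves a bound quadratic in
  \<open>s\<close> near zero, as Bernstein's inequality requires. With
  \<open>a = 1 / (4 \<sigma>^2)\<close>, the variable \<open>Y = a (g^2 - v)\<close> satisfies
  \<open>|Y| <= a g^2 + 2\<close>, so \<open>exp |Y|\<close> has mean at most
  \<open>2 * exp 2\<close>; then \<open>8 * exp 2 * (s / a)^2\<close> is the exponent in the
  conclusion.\<close>

lemma (in prob_space) subgaussian_square_centered:
  assumes sg: "subgaussian M \<sigma> g" and \<sigma>: "0 < \<sigma>"
    and int: "integrable M (\<lambda>x. (g x)\<^sup>2)" and v: "expectation (\<lambda>x. (g x)\<^sup>2) = v"
    and s: "\<bar>s\<bar> \<le> 1 / (8 * \<sigma>\<^sup>2)"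
  shows "(\<integral>\<^sup>+x. ennreal (exp (s * ((g x)\<^sup>2 - v))) \<partial>M) \<le> ennreal (exp (128 * exp 2 * \<sigma> ^ 4 * s\<^sup>2))"
proof -
  have [measurable]: "g \<in> borel_measurable M" using sg by (simp add: subgaussian_def)
  define a where "a = 1 / (4 * \<sigma>\<^sup>2)"
  have a: "a > 0" using \<sigma> by (simp add: a_def)
  have le2: "(\<integral>\<^sup>+x. ennreal (exp (a * (g x)\<^sup>2)) \<partial>M) \<le> 2"
    using nn_integral_exp_square_le[OF _ _ _ \<sigma>, of M "\<lambda>_. 1" g 1] sg
    by (simp add: subgaussian_def a_def sigma_finite_measure_axioms)
  have int_e: "integrable M (\<lambda>x. exp (a * (g x)\<^sup>2))"
    using le2 by (intro integrableI_nonneg) (auto simp: less_top[symmetric] top_unique intro: le_less_trans[OF le2])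
  have E2: "expectation (\<lambda>x. exp (a * (g x)\<^sup>2)) \<le> 2"
    using le2 nn_integral_eq_integral[OF int_e] by (simp add: ennreal_le_iff[where y=2, simplified])
  have v0: "0 \<le> v" unfolding v[symmetric] by simp
  have av: "a * v \<le> 2"
  proof -
    have "a * v = expectation (\<lambda>x. a * (g x)\<^sup>2)" using int by (simp add: v)
    also have "\<dots> \<le> expectation (\<lambda>x. exp (a * (g x)\<^sup>2))"
      using int int_e by (intro integral_mono) (auto intro: order_trans[OF _ exp_ge_add_one_self])
    finally show ?thesis using E2 by simp
  qed
  define \<theta> where "\<theta> = s / a"
  have \<theta>: "\<bar>\<theta>\<bar> \<le> 1/2" using s \<sigma> by (simp add: \<theta>_def a_def abs_mult field_simps)
  define Y where "Y x = a * ((g x)\<^sup>2 - v)" for x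
  have [measurable]: "Y \<in> borel_measurable M" unfolding Y_def by measurable
  have sY: "s * ((g x)\<^sup>2 - v) = \<theta> * Y x" for x using a by (simp add: \<theta>_def Y_def)
  have absY: "\<bar>Y x\<bar> \<le> a * (g x)\<^sup>2 + 2" for x
  proof -
    have "\<bar>Y x\<bar> \<le> a * (g x)\<^sup>2 + a * v" using a v0 by (auto simp: Y_def abs_le_iff algebra_simps)
    thus ?thesis using av by linarith
  qed
  have bnd: "exp (\<theta> * Y x) \<le> 1 + \<theta> * Y x + 4 * \<theta>\<^sup>2 * (exp 2 * exp (a * (g x)\<^sup>2))" for x
  proof -
    have "exp (\<theta> * Y x) \<le> 1 + \<theta> * Y x + 4 * \<theta>\<^sup>2 * exp \<bar>Y x\<bar>" by (rule exp_le_quadratic[OF \<theta>])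
    also have "exp \<bar>Y x\<bar> \<le> exp (a * (g x)\<^sup>2 + 2)" using absY by simp
    also have "\<dots> = exp 2 * exp (a * (g x)\<^sup>2)" by (simp add: exp_add)
    finally show ?thesis by (simp add: mult_left_mono)
  qed
  have intY: "integrable M Y" unfolding Y_def using int by simp
  have EY: "expectation Y = 0" unfolding Y_def using int v by (simp add: prob_space)
  have intR: "integrable M (\<lambda>x. 1 + \<theta> * Y x + 4 * \<theta>\<^sup>2 * (exp 2 * exp (a * (g x)\<^sup>2)))" using intY int_e by simp
  have intL: "integrable M (\<lambda>x. exp (\<theta> * Y x))"
    by (rule Bochner_Integration.integrable_bound[OF intR]) (auto intro!: AE_I2 order_trans[OF bnd])
  have "expectation (\<lambda>x. exp (\<theta> * Y x)) \<le> expectation (\<lambda>x. 1 + \<theta> * Y x + 4 * \<theta>\<^sup>2 * (exp 2 * exp (a * (g x)\<^sup>2)))"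
    by (rule integral_mono[OF intL intR]) (rule bnd)
  also have "\<dots> = 1 + 4 * \<theta>\<^sup>2 * (exp 2 * expectation (\<lambda>x. exp (a * (g x)\<^sup>2)))"
    using intY int_e by (simp add: EY prob_space)
  also have "\<dots> \<le> 1 + 4 * \<theta>\<^sup>2 * (exp 2 * 2)" using E2 by (intro add_left_mono mult_left_mono) auto
  also have "\<dots> = 1 + 128 * exp 2 * \<sigma> ^ 4 * s\<^sup>2"
    using \<sigma> by (simp add: \<theta>_def a_def power_mult_distrib power_divide)
  also have "\<dots> \<le> exp (128 * exp 2 * \<sigma> ^ 4 * s\<^sup>2)" by (rule exp_ge_add_one_self)
  finally have "expectation (\<lambda>x. exp (\<theta> * Y x)) \<le> exp (128 * exp 2 * \<sigma> ^ 4 * s\<^sup>2)" .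
  thus ?thesis unfolding sY using nn_integral_eq_integral[OF intL] by (simp add: ennreal_leI)
qed

text \<open>Chernoff's bound with the exponent \<open>\<tau>\<close> left free, because each
  application balances it against a different threshold and a different range restriction.\<close>

lemma (in prob_space) bernstein_upper:
  assumes L: "finite L" and ind: "indep_vars (\<lambda>_. borel) Y L"
    and mgf: "\<And>l t. l \<in> L \<Longrightarrow> \<bar>t\<bar> \<le> t0 \<Longrightarrow> (\<integral>\<^sup>+\<omega>. ennreal (exp (t * Y l \<omega>)) \<partial>M) \<le> ennreal (exp (K * t\<^sup>2))"
    and w: "\<And>l. l \<in> L \<Longrightarrow> \<bar>\<tau> * w l\<bar> \<le> t0" and \<tau>: "0 \<le> \<tau>"
  shows "prob {\<omega>\<in>space M. u < (\<Sum>l\<in>L. w l * Y l \<omega>)} \<le> exp (- \<tau> * u + K * \<tau>\<^sup>2 * (\<Sum>l\<in>L. (w l)\<^sup>2))"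
proof -
  have [measurable]: "l \<in> L \<Longrightarrow> Y l \<in> borel_measurable M" for l
    using ind by (auto simp: indep_vars_def)
  let ?S = "\<lambda>\<omega>. \<Sum>l\<in>L. w l * Y l \<omega>"
  have "(\<integral>\<^sup>+\<omega>. ennreal (exp (\<tau> * ?S \<omega>)) \<partial>M) = (\<integral>\<^sup>+\<omega>. (\<Prod>l\<in>L. ennreal (exp ((\<tau> * w l) * Y l \<omega>))) \<partial>M)"
    using L by (intro nn_integral_cong) (simp add: sum_distrib_left exp_sum prod_ennreal mult.assoc)
  also have "\<dots> = (\<Prod>l\<in>L. \<integral>\<^sup>+\<omega>. ennreal (exp ((\<tau> * w l) * Y l \<omega>)) \<partial>M)"
    by (intro indep_vars_nn_integral L indep_vars_compose2[OF ind]) auto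
  also have "\<dots> \<le> (\<Prod>l\<in>L. ennreal (exp (K * (\<tau> * w l)\<^sup>2)))"
    by (intro prod_mono_ennreal mgf w)
  also have "\<dots> = ennreal (exp (K * \<tau>\<^sup>2 * (\<Sum>l\<in>L. (w l)\<^sup>2)))"
    using L by (simp add: prod_ennreal exp_sum[symmetric] sum_distrib_left power_mult_distrib mult.assoc)
  finally have E: "(\<integral>\<^sup>+\<omega>. ennreal (exp (\<tau> * ?S \<omega>)) \<partial>M) \<le> ennreal (exp (K * \<tau>\<^sup>2 * (\<Sum>l\<in>L. (w l)\<^sup>2)))" .
  have "emeasure M {\<omega>\<in>space M. u < ?S \<omega>} = (\<integral>\<^sup>+\<omega>. indicator {\<omega>\<in>space M. u < ?S \<omega>} \<omega> \<partial>M)"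
    by simp
  also have "\<dots> \<le> (\<integral>\<^sup>+\<omega>. ennreal (exp (- \<tau> * u)) * ennreal (exp (\<tau> * ?S \<omega>)) \<partial>M)"
  proof (rule nn_integral_mono)
    fix \<omega>
    have "1 \<le> exp (- \<tau> * u) * exp (\<tau> * ?S \<omega>)" if "u < ?S \<omega>"
      using that \<tau> mult_left_mono[of u "?S \<omega>" \<tau>] by (simp flip: exp_add)
    thus "indicator {\<omega>\<in>space M. u < ?S \<omega>} \<omega> \<le> ennreal (exp (- \<tau> * u)) * ennreal (exp (\<tau> * ?S \<omega>))"
      by (auto simp: indicator_def ennreal_mult[symmetric])
  qed
  also have "\<dots> = ennreal (exp (- \<tau> * u)) * (\<integral>\<^sup>+\<omega>. ennreal (exp (\<tau> * ?S \<omega>)) \<partial>M)"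
    by (rule nn_integral_cmult) measurable
  also have "\<dots> \<le> ennreal (exp (- \<tau> * u)) * ennreal (exp (K * \<tau>\<^sup>2 * (\<Sum>l\<in>L. (w l)\<^sup>2)))"
    by (intro mult_left_mono E) auto
  also have "\<dots> = ennreal (exp (- \<tau> * u + K * \<tau>\<^sup>2 * (\<Sum>l\<in>L. (w l)\<^sup>2)))"
    unfolding exp_add by (simp add: ennreal_mult)
  finally show ?thesis by (simp add: emeasure_eq_measure)
qed

lemma (in prob_space) bernstein:
  assumes L: "finite L" and ind: "indep_vars (\<lambda>_. borel) Y L"
    and mgf: "\<And>l t. l \<in> L \<Longrightarrow> \<bar>t\<bar> \<le> t0 \<Longrightarrow> (\<integral>\<^sup>+\<omega>. ennreal (exp (t * Y l \<omega>)) \<partial>M) \<le> ennreal (exp (K * t\<^sup>2))"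
    and w: "\<And>l. l \<in> L \<Longrightarrow> \<bar>\<tau> * w l\<bar> \<le> t0" and \<tau>: "0 \<le> \<tau>"
  shows "prob {\<omega>\<in>space M. u < \<bar>\<Sum>l\<in>L. w l * Y l \<omega>\<bar>} \<le> 2 * exp (- \<tau> * u + K * \<tau>\<^sup>2 * (\<Sum>l\<in>L. (w l)\<^sup>2))"
proof -
  have [measurable]: "l \<in> L \<Longrightarrow> Y l \<in> borel_measurable M" for l
    using ind by (auto simp: indep_vars_def)
  let ?A = "{\<omega>\<in>space M. u < (\<Sum>l\<in>L. w l * Y l \<omega>)}" and ?B = "{\<omega>\<in>space M. u < (\<Sum>l\<in>L. (- w l) * Y l \<omega>)}"
  have "prob {\<omega>\<in>space M. u < \<bar>\<Sum>l\<in>L. w l * Y l \<omega>\<bar>} \<le> prob (?A \<union> ?B)"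
    by (intro finite_measure_mono) (auto simp: sum_negf abs_if split: if_splits)
  also have "\<dots> \<le> prob ?A + prob ?B" by (rule measure_Un_le) measurable
  also have "\<dots> \<le> exp (- \<tau> * u + K * \<tau>\<^sup>2 * (\<Sum>l\<in>L. (w l)\<^sup>2)) + exp (- \<tau> * u + K * \<tau>\<^sup>2 * (\<Sum>l\<in>L. (- w l)\<^sup>2))"
    by (intro add_mono bernstein_upper[OF L ind mgf] \<tau>) (use w in auto)
  finally show ?thesis by simp
qed

text \<open>The matrix is the weighted sum of the centred rank-one matrices
  \<open>z_l z_l^T - I\<close>. It serves both the tail Gram matrix (weights \<open>lam l\<close>,
  dimension \<open>n\<close>) and the whitened head covariance (unit weights, dimension
  \<open>k\<close>).\<close>

lemma net_quadratic_bound: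
  assumes L: "finite L"
    and net: "\<And>v. v \<in> ball_net d \<Longrightarrow> \<bar>\<Sum>l\<in>L. w l * ((\<Sum>i<d. v i * z l i)\<^sup>2 - ip d v v)\<bar> \<le> t"
  shows "\<bar>\<Sum>l\<in>L. w l * ((\<Sum>i<d. u i * z l i)\<^sup>2 - ip d u u)\<bar> \<le> 2 * t * ip d u u"
proof -
  define E where "E i j = (\<Sum>l\<in>L. w l * (z l i * z l j - (if i = j then 1 else 0)))" for i j
  have eq: "bform d E u u = (\<Sum>l\<in>L. w l * ((\<Sum>i<d. u i * z l i)\<^sup>2 - ip d u u))" for u
  proof -
    have "bform d E u u = (\<Sum>i<d. \<Sum>j<d. \<Sum>l\<in>L. w l * (u i * (z l i * z l j - (if i = j then 1 else 0)) * u j))"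
      unfolding bform_def ip_def E_def by (simp add: sum_distrib_left sum_distrib_right mult_ac)
    also have "\<dots> = (\<Sum>i<d. \<Sum>l\<in>L. \<Sum>j<d. w l * (u i * (z l i * z l j - (if i = j then 1 else 0)) * u j))"
      by (intro sum.cong refl sum.swap)
    also have "\<dots> = (\<Sum>l\<in>L. \<Sum>i<d. \<Sum>j<d. w l * (u i * (z l i * z l j - (if i = j then 1 else 0)) * u j))"
      by (rule sum.swap)
    also have "\<dots> = (\<Sum>l\<in>L. w l * ((\<Sum>i<d. u i * z l i)\<^sup>2 - ip d u u))"
    proof (rule sum.cong[OF refl])
      fix l
      have "(\<Sum>j<d. u i * (z l i * z l j - (if i = j then 1 else 0)) * u j)
          = (\<Sum>j<d. (u i * z l i) * (u j * z l j)) - u i * u i" if "i < d" for i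
      proof -
        have "(\<Sum>j<d. u i * (z l i * z l j - (if i = j then 1 else 0)) * u j)
          = (\<Sum>j<d. (u i * z l i) * (u j * z l j) - (if i = j then u i * u j else 0))"
          by (intro sum.cong refl) (auto simp: algebra_simps)
        thus ?thesis using that by (simp add: sum_subtractf)
      qed
      hence "(\<Sum>i<d. \<Sum>j<d. u i * (z l i * z l j - (if i = j then 1 else 0)) * u j)
          = (\<Sum>i<d. \<Sum>j<d. (u i * z l i) * (u j * z l j)) - ip d u u"
        by (simp add: ip_def sum_subtractf)
      also have "(\<Sum>i<d. \<Sum>j<d. (u i * z l i) * (u j * z l j)) = (\<Sum>i<d. u i * z l i)\<^sup>2"
        by (simp add: power2_eq_square sum_product)
      finally show "(\<Sum>i<d. \<Sum>j<d. w l * (u i * (z l i * z l j - (if i = j then 1 else 0)) * u j))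
          = w l * ((\<Sum>i<d. u i * z l i)\<^sup>2 - ip d u u)"
        by (simp add: sum_distrib_left[symmetric])
    qed
    finally show ?thesis .
  qed
  have "\<bar>bform d E u u\<bar> \<le> 2 * t * ip d u u"
  proof (rule bform_bound_of_net)
    show "E i j = E j i" for i j by (simp add: E_def mult.commute eq_commute)
    show "\<bar>bform d E v v\<bar> \<le> t" if "v \<in> ball_net d" for v unfolding eq by (rule net[OF that])
  qed
  thus ?thesis unfolding eq .
qed

section \<open>Conditionally sub-Gaussian noise\<close>

text \<open>Finitely many values, pointwise convergence, and modulus never above that of the
  argument; the last property keeps the Gaussian majorant valid along the approximation.\<close>

definition round_to_zero :: "nat \<Rightarrow> real \<Rightarrow> real" where
  "round_to_zero m a = sgn a * min (real m) (of_int \<lfloor>real m * \<bar>a\<bar>\<rfloor> / real m)"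

lemma round_to_zero_abs_le: "\<bar>round_to_zero m a\<bar> \<le> \<bar>a\<bar>"
proof (cases "m = 0")
  case False
  have fl: "0 \<le> real_of_int \<lfloor>real m * \<bar>a\<bar>\<rfloor>" by simp
  have "real_of_int \<lfloor>real m * \<bar>a\<bar>\<rfloor> \<le> real m * \<bar>a\<bar>" by simp
  hence "real_of_int \<lfloor>real m * \<bar>a\<bar>\<rfloor> / real m \<le> \<bar>a\<bar>" using False by (simp add: field_simps)
  moreover have "0 \<le> min (real m) (of_int \<lfloor>real m * \<bar>a\<bar>\<rfloor> / real m)" using fl by simp
  ultimately have "\<bar>min (real m) (of_int \<lfloor>real m * \<bar>a\<bar>\<rfloor> / real m)\<bar> \<le> \<bar>a\<bar>" by simp
  thus ?thesis by (auto simp: round_to_zero_def abs_mult sgn_if)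
qed (simp add: round_to_zero_def)

lemma round_to_zero_tendsto: "(\<lambda>m. round_to_zero m a) \<longlonglongrightarrow> a"
proof (rule LIMSEQ_I)
  fix r :: real assume r: "r > 0"
  obtain M where M: "real M > max \<bar>a\<bar> (1 / r)" using reals_Archimedean2 by blast
  have "norm (round_to_zero m a - a) < r" if "m \<ge> M" for m
  proof -
    have m: "real m > \<bar>a\<bar>" "real m > 1 / r" using that M by auto
    have m0: "real m > 0" using m(1) by linarith
    define b where "b = of_int \<lfloor>real m * \<bar>a\<bar>\<rfloor> / real m"
    have "real_of_int \<lfloor>real m * \<bar>a\<bar>\<rfloor> \<le> real m * \<bar>a\<bar>" "real m * \<bar>a\<bar> - 1 < real_of_int \<lfloor>real m * \<bar>a\<bar>\<rfloor>" by linarith+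
    moreover have "real_of_int \<lfloor>real m * \<bar>a\<bar>\<rfloor> = real m * b" using m0 by (simp add: b_def)
    ultimately have "real m * b \<le> real m * \<bar>a\<bar>" "real m * (\<bar>a\<bar> - b) < 1" by (simp_all add: right_diff_distrib)
    hence b: "b \<le> \<bar>a\<bar>" "\<bar>a\<bar> - b < 1 / real m" using m0 by (auto simp: field_simps)
    have "1 / real m < r" using m r m0 by (simp add: field_simps)
    moreover have "min (real m) b = b" using b m by auto
    ultimately have "\<bar>b - \<bar>a\<bar>\<bar> < r" and "round_to_zero m a = sgn a * b"
      using b by (simp_all add: round_to_zero_def b_def)
    moreover have "round_to_zero m a - a = sgn a * (b - \<bar>a\<bar>)" if "round_to_zero m a = sgn a * b"
      unfolding that right_diff_distrib by (simp add: sgn_mult_abs)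
    ultimately show ?thesis using r by (auto simp: abs_mult sgn_if)
  qed
  thus "\<exists>no. \<forall>m\<ge>no. norm (round_to_zero m a - a) < r" by blast
qed

lemma finite_range_round_to_zero: "finite (range (round_to_zero m))"
proof (cases "m = 0")
  case True
  hence "range (round_to_zero m) \<subseteq> {0}" by (auto simp: round_to_zero_def)
  thus ?thesis by (rule finite_subset) simp
next
  case False
  have "range (round_to_zero m) \<subseteq> (\<lambda>(\<epsilon>, i). \<epsilon> * min (real m) (of_int i / real m)) ` ({-1, 0, 1} \<times> {0..int (m * m)})"
  proof (rule subsetI, elim rangeE)
    fix y a assume y: "y = round_to_zero m a"
    let ?f = "\<lfloor>real m * \<bar>a\<bar>\<rfloor>"
    have m0: "real m > 0" using False by simp
    have s: "sgn a \<in> {-1, 0, 1}" by (auto simp: sgn_if)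
    show "y \<in> (\<lambda>(\<epsilon>, i). \<epsilon> * min (real m) (of_int i / real m)) ` ({-1, 0, 1} \<times> {0..int (m * m)})"
    proof (cases "?f \<le> int (m * m)")
      case True
      thus ?thesis using s unfolding y round_to_zero_def by (intro image_eqI[of _ _ "(sgn a, ?f)"]) auto
    next
      case f: False
      hence "real_of_int ?f \<ge> real m * real m" by (simp only: not_le) (metis of_int_less_iff of_int_of_nat_eq of_nat_mult less_imp_le)
      hence "real m \<le> of_int ?f / real m" using m0 by (simp add: field_simps)
      thus ?thesis using s m0 unfolding y round_to_zero_def by (intro image_eqI[of _ _ "(sgn a, int (m * m))"]) auto
    qed
  qed
  thus ?thesis by (rule finite_subset) auto
qed

lemma borel_measurable_round_to_zero [measurable]: "round_to_zero m \<in> borel_measurable borel"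
  unfolding round_to_zero_def[abs_def] sgn_if by measurable

text \<open>The constant exponent becomes a function of \<open>X\<close> in three stages: comparison
  of push-forward measures extends \<open>base\<close> from indicators to nonnegative weights,
  finitely valued exponents follow by summing over level sets, and Fatou's lemma removes the
  finiteness. Fatou acts on the left side alone, since rounding towards zero bounds all right-hand
  sides by the limiting one.\<close>

lemma conditional_subgaussian_varying:
  fixes X :: "'z \<Rightarrow> 'x" and N :: "'z \<Rightarrow> real"
  assumes X [measurable]: "X \<in> measurable D R" and N [measurable]: "N \<in> borel_measurable D"
    and base: "\<And>t B. B \<in> sets R \<Longrightarrow>
      (\<integral>\<^sup>+z. indicator B (X z) * ennreal (exp (t * N z)) \<partial>D) \<le> ennreal (exp (\<sigma>\<^sup>2 * t\<^sup>2 / 2)) * emeasure D (X -` B \<inter> space D)"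
    and \<alpha> [measurable]: "\<alpha> \<in> borel_measurable R" and h [measurable]: "h \<in> borel_measurable R"
  shows "(\<integral>\<^sup>+z. \<alpha> (X z) * ennreal (exp (h (X z) * N z)) \<partial>D) \<le> (\<integral>\<^sup>+z. \<alpha> (X z) * ennreal (exp (\<sigma>\<^sup>2 * (h (X z))\<^sup>2 / 2)) \<partial>D)"
proof -
  have const: "(\<integral>\<^sup>+z. \<beta> (X z) * ennreal (exp (t * N z)) \<partial>D) \<le> ennreal (exp (\<sigma>\<^sup>2 * t\<^sup>2 / 2)) * (\<integral>\<^sup>+z. \<beta> (X z) \<partial>D)"
    if [measurable]: "\<beta> \<in> borel_measurable R" for t and \<beta> :: "'x \<Rightarrow> ennreal"
  proof -
    let ?e = "ennreal (exp (\<sigma>\<^sup>2 * t\<^sup>2 / 2))"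
    define M1 where "M1 = distr (density D (\<lambda>z. ennreal (exp (t * N z)))) R X"
    define M2 where "M2 = distr (density D (\<lambda>_. ?e)) R X"
    have sets: "sets M1 = sets M2" by (simp add: M1_def M2_def)
    have "emeasure M1 B \<le> emeasure M2 B" for B
    proof (cases "B \<in> sets R")
      case True
      hence [measurable]: "X -` B \<inter> space D \<in> sets D" by measurable
      have "emeasure M1 B = (\<integral>\<^sup>+z. ennreal (exp (t * N z)) * indicator (X -` B \<inter> space D) z \<partial>D)"
        unfolding M1_def using True by (subst emeasure_distr) (auto simp: emeasure_density)
      also have "\<dots> = (\<integral>\<^sup>+z. indicator B (X z) * ennreal (exp (t * N z)) \<partial>D)"
        by (intro nn_integral_cong) (auto simp: indicator_def)
      also have "\<dots> \<le> ?e * emeasure D (X -` B \<inter> space D)" by (rule base[OF True])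
      also have "\<dots> = emeasure M2 B"
        unfolding M2_def using True by (subst emeasure_distr) (auto simp: emeasure_density nn_integral_cmult)
      finally show ?thesis .
    next
      case False
      thus ?thesis by (simp add: emeasure_notin_sets sets M1_def)
    qed
    hence "M1 \<le> M2" using sets by (auto simp: le_measure_iff le_fun_def dest: sets_eq_imp_space_eq)
    hence "(\<integral>\<^sup>+x. \<beta> x \<partial>M1) \<le> (\<integral>\<^sup>+x. \<beta> x \<partial>M2)" by (intro nn_integral_mono_measure sets)
    thus ?thesis unfolding M1_def M2_def
      by (simp add: nn_integral_distr nn_integral_density nn_integral_multc mult.commute)
  qed
  have simple: "(\<integral>\<^sup>+z. \<alpha> (X z) * ennreal (exp (g (X z) * N z)) \<partial>D) \<le> (\<integral>\<^sup>+z. \<alpha> (X z) * ennreal (exp (\<sigma>\<^sup>2 * (g (X z))\<^sup>2 / 2)) \<partial>D)"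
    if [measurable]: "g \<in> borel_measurable R" and fin: "finite (range g)" for g :: "'x \<Rightarrow> real"
  proof -
    have split: "(\<Sum>t\<in>range g. indicator {t} (g x) * f t) = f (g x)" for x and f :: "real \<Rightarrow> ennreal"
    proof -
      have "(\<Sum>t\<in>range g. indicator {t} (g x) * f t) = (\<Sum>t\<in>{g x}. indicator {t} (g x) * f t)"
        using fin by (intro sum.mono_neutral_right) (auto simp: indicator_def)
      thus ?thesis by simp
    qed
    have "(\<integral>\<^sup>+z. \<alpha> (X z) * ennreal (exp (g (X z) * N z)) \<partial>D) =
        (\<integral>\<^sup>+z. (\<Sum>t\<in>range g. (\<alpha> (X z) * indicator {t} (g (X z))) * ennreal (exp (t * N z))) \<partial>D)"
    proof (rule nn_integral_cong)
      fix z
      show "\<alpha> (X z) * ennreal (exp (g (X z) * N z)) = (\<Sum>t\<in>range g. (\<alpha> (X z) * indicator {t} (g (X z))) * ennreal (exp (t * N z)))"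
        using split[of "X z" "\<lambda>t. ennreal (exp (t * N z))"] by (simp add: mult.assoc sum_distrib_left[symmetric])
    qed
    also have "\<dots> = (\<Sum>t\<in>range g. \<integral>\<^sup>+z. (\<alpha> (X z) * indicator {t} (g (X z))) * ennreal (exp (t * N z)) \<partial>D)"
      by (rule nn_integral_sum) measurable
    also have "\<dots> \<le> (\<Sum>t\<in>range g. ennreal (exp (\<sigma>\<^sup>2 * t\<^sup>2 / 2)) * (\<integral>\<^sup>+z. \<alpha> (X z) * indicator {t} (g (X z)) \<partial>D))"
      by (intro sum_mono const[of "\<lambda>x. \<alpha> x * indicator {_} (g x)"]) measurable
    also have "\<dots> = (\<integral>\<^sup>+z. (\<Sum>t\<in>range g. ennreal (exp (\<sigma>\<^sup>2 * t\<^sup>2 / 2)) * (\<alpha> (X z) * indicator {t} (g (X z)))) \<partial>D)"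
      by (subst nn_integral_sum) (auto simp: nn_integral_cmult)
    also have "\<dots> = (\<integral>\<^sup>+z. \<alpha> (X z) * ennreal (exp (\<sigma>\<^sup>2 * (g (X z))\<^sup>2 / 2)) \<partial>D)"
    proof (rule nn_integral_cong)
      fix z
      have "(\<Sum>t\<in>range g. ennreal (exp (\<sigma>\<^sup>2 * t\<^sup>2 / 2)) * (\<alpha> (X z) * indicator {t} (g (X z))))
          = \<alpha> (X z) * (\<Sum>t\<in>range g. indicator {t} (g (X z)) * ennreal (exp (\<sigma>\<^sup>2 * t\<^sup>2 / 2)))"
        by (simp add: sum_distrib_left mult_ac)
      thus "(\<Sum>t\<in>range g. ennreal (exp (\<sigma>\<^sup>2 * t\<^sup>2 / 2)) * (\<alpha> (X z) * indicator {t} (g (X z))))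
          = \<alpha> (X z) * ennreal (exp (\<sigma>\<^sup>2 * (g (X z))\<^sup>2 / 2))" by (simp only: split)
    qed
    finally show ?thesis .
  qed
  let ?I = "\<lambda>m z. \<alpha> (X z) * ennreal (exp (round_to_zero m (h (X z)) * N z))"
  have "(\<integral>\<^sup>+z. \<alpha> (X z) * ennreal (exp (h (X z) * N z)) \<partial>D) \<le> (\<integral>\<^sup>+z. liminf (\<lambda>m. ?I m z) \<partial>D)"
  proof (rule nn_integral_mono)
    fix z
    have "(\<lambda>m. ?I m z) \<longlonglongrightarrow> \<alpha> (X z) * ennreal (exp (h (X z) * N z))"
      by (intro tendsto_mult_ennreal tendsto_const tendsto_ennrealI tendsto_exp tendsto_mult round_to_zero_tendsto) auto
    thus "\<alpha> (X z) * ennreal (exp (h (X z) * N z)) \<le> liminf (\<lambda>m. ?I m z)" by (simp add: lim_imp_Liminf)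
  qed
  also have "\<dots> \<le> liminf (\<lambda>m. \<integral>\<^sup>+z. ?I m z \<partial>D)"
    by (rule nn_integral_liminf) measurable
  also have "\<dots> \<le> (\<integral>\<^sup>+z. \<alpha> (X z) * ennreal (exp (\<sigma>\<^sup>2 * (h (X z))\<^sup>2 / 2)) \<partial>D)"
  proof (rule Liminf_le)
    have "(\<integral>\<^sup>+z. ?I m z \<partial>D) \<le> (\<integral>\<^sup>+z. \<alpha> (X z) * ennreal (exp (\<sigma>\<^sup>2 * (h (X z))\<^sup>2 / 2)) \<partial>D)" for m
    proof -
      have "(\<integral>\<^sup>+z. ?I m z \<partial>D) \<le> (\<integral>\<^sup>+z. \<alpha> (X z) * ennreal (exp (\<sigma>\<^sup>2 * (round_to_zero m (h (X z)))\<^sup>2 / 2)) \<partial>D)"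
        by (rule simple) (auto intro: finite_subset[OF _ finite_range_round_to_zero[of m]])
      also have "\<dots> \<le> (\<integral>\<^sup>+z. \<alpha> (X z) * ennreal (exp (\<sigma>\<^sup>2 * (h (X z))\<^sup>2 / 2)) \<partial>D)"
        by (intro nn_integral_mono mult_left_mono ennreal_leI)
          (auto intro!: mult_left_mono abs_le_square_iff[THEN iffD1] round_to_zero_abs_le)
      finally show ?thesis .
    qed
    thus "\<forall>\<^sub>F m in sequentially. (\<integral>\<^sup>+z. ?I m z \<partial>D) \<le> (\<integral>\<^sup>+z. \<alpha> (X z) * ennreal (exp (\<sigma>\<^sup>2 * (h (X z))\<^sup>2 / 2)) \<partial>D)" by simp
  qed simp
  finally show ?thesis .
qed

text \<open>Induction on the rows, where each coefficient \<open>h j\<close> may depend on the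
  covariates of all rows. With the other rows frozen, row \<open>i\<close> is handled by
  \<open>cond\<close>; its majorant involves covariates only and is absorbed into the weight. The
  order of integration is then reversed, so that the induction hypothesis applies with row
  \<open>i\<close> frozen.\<close>

lemma conditional_subgaussian_PiM:
  fixes X :: "'z \<Rightarrow> 'x" and N :: "'z \<Rightarrow> real"
  assumes D: "prob_space D" and X [measurable]: "X \<in> measurable D R" and N [measurable]: "N \<in> borel_measurable D"
    and cond: "\<And>\<alpha> h. \<alpha> \<in> borel_measurable R \<Longrightarrow> h \<in> borel_measurable R \<Longrightarrow>
       (\<integral>\<^sup>+z. \<alpha> (X z) * ennreal (exp (h (X z) * N z)) \<partial>D) \<le> (\<integral>\<^sup>+z. \<alpha> (X z) * ennreal (exp (\<sigma>\<^sup>2 * (h (X z))\<^sup>2 / 2)) \<partial>D)"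
    and J: "finite (J :: nat set)"
    and F: "F \<in> borel_measurable (PiM J (\<lambda>_. R))" and h: "\<And>j. j \<in> J \<Longrightarrow> h j \<in> borel_measurable (PiM J (\<lambda>_. R))"
  shows "(\<integral>\<^sup>+\<omega>. F (\<lambda>j\<in>J. X (\<omega> j)) * ennreal (exp (\<Sum>j\<in>J. h j (\<lambda>j\<in>J. X (\<omega> j)) * N (\<omega> j))) \<partial>PiM J (\<lambda>_. D))
    \<le> (\<integral>\<^sup>+\<omega>. F (\<lambda>j\<in>J. X (\<omega> j)) * ennreal (exp (\<Sum>j\<in>J. \<sigma>\<^sup>2 * (h j (\<lambda>j\<in>J. X (\<omega> j)))\<^sup>2 / 2)) \<partial>PiM J (\<lambda>_. D))"
  using J F h
proof (induction J arbitrary: F h rule: finite_induct)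
  case empty
  show ?case by simp
next
  case (insert i J)
  note insert.prems[measurable]
  interpret D: prob_space D by fact
  interpret product_sigma_finite "\<lambda>_::nat. D" by standard
  let ?x = "\<lambda>\<omega>. \<lambda>j\<in>J. X (\<omega> j)" and ?xi = "\<lambda>\<omega>. \<lambda>j\<in>insert i J. X (\<omega> j)"
  have upd: "?xi (\<omega> (i := z)) = (?x \<omega>)(i := X z)" for \<omega> z
    using insert.hyps by (auto simp: fun_eq_iff restrict_def)
  have sumJ: "(\<Sum>j\<in>J. h j \<xi> * N (if j = i then z else \<omega> j)) = (\<Sum>j\<in>J. h j \<xi> * N (\<omega> j))" for \<xi> \<omega> z
    using insert.hyps by (intro sum.cong) auto
  have xJ [measurable]: "?x \<in> measurable (PiM J (\<lambda>_. D)) (PiM J (\<lambda>_. R))" by measurable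
  have xiJ [measurable]: "?xi \<in> measurable (PiM (insert i J) (\<lambda>_. D)) (PiM (insert i J) (\<lambda>_. R))" by measurable
  have hJ: "h j \<in> borel_measurable (PiM (insert i J) (\<lambda>_. R))" if "j \<in> insert i J" for j using insert.prems that by simp
  have hi [measurable]: "h i \<in> borel_measurable (PiM (insert i J) (\<lambda>_. R))" by (rule hJ) simp
  have hj [measurable]: "j \<in> J \<Longrightarrow> h j \<in> borel_measurable (PiM (insert i J) (\<lambda>_. R))" for j by (rule hJ) simp
  define s where "s u = \<sigma>\<^sup>2 * u\<^sup>2 / 2" for u :: real
  have [measurable]: "s \<in> borel_measurable borel" unfolding s_def by measurable
  have upd_meas: "(\<lambda>x. \<xi>(i := x)) \<in> measurable R (PiM (insert i J) (\<lambda>_. R))" if "\<xi> \<in> space (PiM J (\<lambda>_. R))" for \<xi>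
    using that insert.hyps by (intro measurable_component_update)
  have upd_meas2: "(\<lambda>\<xi>. \<xi>(i := x)) \<in> measurable (PiM J (\<lambda>_. R)) (PiM (insert i J) (\<lambda>_. R))" if "x \<in> space R" for x
    using that by (intro measurable_fun_upd[where J=J]) auto
  have "(\<integral>\<^sup>+\<omega>. F (?xi \<omega>) * ennreal (exp (\<Sum>j\<in>insert i J. h j (?xi \<omega>) * N (\<omega> j))) \<partial>PiM (insert i J) (\<lambda>_. D))
     = (\<integral>\<^sup>+\<omega>. (\<integral>\<^sup>+z. (F ((?x \<omega>)(i := X z)) * ennreal (exp (\<Sum>j\<in>J. h j ((?x \<omega>)(i := X z)) * N (\<omega> j))))
           * ennreal (exp (h i ((?x \<omega>)(i := X z)) * N z)) \<partial>D) \<partial>PiM J (\<lambda>_. D))"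
    using insert.hyps
    by (subst product_nn_integral_insert, simp, simp, measurable)
      (intro nn_integral_cong, simp only: upd, simp add: sumJ exp_add ennreal_mult, simp add: mult_ac)
  also have "\<dots> \<le> (\<integral>\<^sup>+\<omega>. (\<integral>\<^sup>+z. (F ((?x \<omega>)(i := X z)) * ennreal (exp (\<Sum>j\<in>J. h j ((?x \<omega>)(i := X z)) * N (\<omega> j))))
           * ennreal (exp (s (h i ((?x \<omega>)(i := X z))))) \<partial>D) \<partial>PiM J (\<lambda>_. D))"
  proof (rule nn_integral_mono)
    fix \<omega> assume "\<omega> \<in> space (PiM J (\<lambda>_. D))"
    hence "?x \<omega> \<in> space (PiM J (\<lambda>_. R))" by (rule measurable_space[OF xJ])
    note [measurable] = upd_meas[OF this]
    show "(\<integral>\<^sup>+z. (F ((?x \<omega>)(i := X z)) * ennreal (exp (\<Sum>j\<in>J. h j ((?x \<omega>)(i := X z)) * N (\<omega> j))))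
           * ennreal (exp (h i ((?x \<omega>)(i := X z)) * N z)) \<partial>D)
      \<le> (\<integral>\<^sup>+z. (F ((?x \<omega>)(i := X z)) * ennreal (exp (\<Sum>j\<in>J. h j ((?x \<omega>)(i := X z)) * N (\<omega> j))))
           * ennreal (exp (s (h i ((?x \<omega>)(i := X z))))) \<partial>D)"
      unfolding s_def
      by (rule cond[of "\<lambda>x. F ((?x \<omega>)(i := x)) * ennreal (exp (\<Sum>j\<in>J. h j ((?x \<omega>)(i := x)) * N (\<omega> j)))"
            "\<lambda>x. h i ((?x \<omega>)(i := x))"]) measurable
  qed
  also have "\<dots> = (\<integral>\<^sup>+\<omega>. F (?xi \<omega>) * ennreal (exp (s (h i (?xi \<omega>)))) * ennreal (exp (\<Sum>j\<in>J. h j (?xi \<omega>) * N (\<omega> j))) \<partial>PiM (insert i J) (\<lambda>_. D))"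
    using insert.hyps
    by (subst product_nn_integral_insert, simp, simp, measurable)
      (intro nn_integral_cong, simp only: upd, simp add: sumJ, simp add: mult_ac)
  also have "\<dots> = (\<integral>\<^sup>+z. (\<integral>\<^sup>+\<omega>. (F ((?x \<omega>)(i := X z)) * ennreal (exp (s (h i ((?x \<omega>)(i := X z))))))
            * ennreal (exp (\<Sum>j\<in>J. h j ((?x \<omega>)(i := X z)) * N (\<omega> j))) \<partial>PiM J (\<lambda>_. D)) \<partial>D)"
    using insert.hyps
    by (subst product_nn_integral_insert_rev, simp, simp, measurable)
      (intro nn_integral_cong, simp only: upd, simp add: sumJ)
  also have "\<dots> \<le> (\<integral>\<^sup>+z. (\<integral>\<^sup>+\<omega>. (F ((?x \<omega>)(i := X z)) * ennreal (exp (s (h i ((?x \<omega>)(i := X z))))))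
            * ennreal (exp (\<Sum>j\<in>J. s (h j ((?x \<omega>)(i := X z))))) \<partial>PiM J (\<lambda>_. D)) \<partial>D)"
  proof (rule nn_integral_mono)
    fix z assume "z \<in> space D"
    hence "X z \<in> space R" by (rule measurable_space[OF X])
    note [measurable] = upd_meas2[OF this]
    show "(\<integral>\<^sup>+\<omega>. (F ((?x \<omega>)(i := X z)) * ennreal (exp (s (h i ((?x \<omega>)(i := X z))))))
            * ennreal (exp (\<Sum>j\<in>J. h j ((?x \<omega>)(i := X z)) * N (\<omega> j))) \<partial>PiM J (\<lambda>_. D))
       \<le> (\<integral>\<^sup>+\<omega>. (F ((?x \<omega>)(i := X z)) * ennreal (exp (s (h i ((?x \<omega>)(i := X z))))))
            * ennreal (exp (\<Sum>j\<in>J. s (h j ((?x \<omega>)(i := X z))))) \<partial>PiM J (\<lambda>_. D))"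
      unfolding s_def
      by (rule insert.IH[of "\<lambda>\<xi>. F (\<xi>(i := X z)) * ennreal (exp (\<sigma>\<^sup>2 * (h i (\<xi>(i := X z)))\<^sup>2 / 2))" "\<lambda>j \<xi>. h j (\<xi>(i := X z))"])
        measurable
  qed
  also have "\<dots> = (\<integral>\<^sup>+\<omega>. F (?xi \<omega>) * ennreal (exp (\<Sum>j\<in>insert i J. s (h j (?xi \<omega>)))) \<partial>PiM (insert i J) (\<lambda>_. D))"
    using insert.hyps
    by (subst product_nn_integral_insert_rev, simp, simp, measurable)
      (intro nn_integral_cong, simp only: upd, simp add: exp_add ennreal_mult mult_ac)
  finally show ?case unfolding s_def .
qed

section \<open>The regression model\<close>

lemma integral_quadratic:
  fixes f :: "nat \<Rightarrow> nat \<Rightarrow> 'a \<Rightarrow> real"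
  assumes int: "\<And>i j. i < d \<Longrightarrow> j < d \<Longrightarrow> integrable M (f i j)"
  shows "(\<integral>x. (\<Sum>i<d. \<Sum>j<d. (u i * u j) * f i j x) \<partial>M) = (\<Sum>i<d. \<Sum>j<d. (u i * u j) * (\<integral>x. f i j x \<partial>M))"
proof -
  have "(\<integral>x. (\<Sum>i<d. \<Sum>j<d. (u i * u j) * f i j x) \<partial>M) = (\<Sum>i<d. (\<integral>x. (\<Sum>j<d. (u i * u j) * f i j x) \<partial>M))"
    by (rule Bochner_Integration.integral_sum, rule Bochner_Integration.integrable_sum) (simp add: int)
  also have "\<dots> = (\<Sum>i<d. \<Sum>j<d. (\<integral>x. (u i * u j) * f i j x \<partial>M))"
    by (rule sum.cong[OF refl], rule Bochner_Integration.integral_sum) (simp add: int)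
  finally show ?thesis by simp
qed

locale regression =
  fixes sx sy sig c :: real and n p :: nat and D :: "pt measure" and lam th :: "nat \<Rightarrow> real"
  assumes setting: "setting sx sy sig c n p D lam th"
    and sx_pos: "0 < sx" and sy_pos: "0 < sy" and sig_pos: "0 < sig" and n_pos: "0 < n"
begin

abbreviation "covariates \<equiv> PiM {..<p} (\<lambda>_. borel :: real measure)"

definition white :: "nat \<Rightarrow> pt \<Rightarrow> real" where
  "white i z = fst z i / sqrt (lam i)"

lemma p_gt_n: "n < p" and lam_pos: "\<And>i. i < p \<Longrightarrow> 0 < lam i"
  and lam_antimono: "\<And>i j. i \<le> j \<Longrightarrow> j < p \<Longrightarrow> lam j \<le> lam i"
  using setting by (auto simp: setting_def)

sublocale D: prob_space D
  using setting by (simp add: setting_def)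

sublocale rows: product_prob_space "\<lambda>_::nat. D" "{..<n}"
  by standard

sublocale S: prob_space "sample n D"
  unfolding sample_def by (rule prob_space_PiM) (rule D.prob_space_axioms)

lemma sets_D [measurable_cong]: "sets D = sets (covariates \<Otimes>\<^sub>M borel)"
  using setting by (simp add: setting_def pt_space_def)

lemma sets_sample [measurable_cong]: "sets (sample n D) = sets (PiM {..<n} (\<lambda>_. D))"
  by (simp add: sample_def)

lemma measurable_covariate [measurable]: "i < p \<Longrightarrow> (\<lambda>z. fst z i) \<in> borel_measurable D"
  by measurable

lemma measurable_white [measurable]: "i < p \<Longrightarrow> white i \<in> borel_measurable D"
  unfolding white_def by measurable

lemma measurable_noise [measurable]: "noise p th \<in> borel_measurable D"
  unfolding noise_def ip_def by measurable

lemma measurable_row [measurable]: "j < n \<Longrightarrow> (\<lambda>\<omega>. \<omega> j) \<in> measurable (sample n D) D"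
  unfolding sample_def by (rule measurable_component_singleton) simp

lemma distr_row: "j < n \<Longrightarrow> distr (sample n D) D (\<lambda>\<omega>. \<omega> j) = D"
  unfolding sample_def by (rule distr_PiM_component[where M="\<lambda>_. D"]) (auto intro: D.prob_space_axioms)

lemma nn_integral_row:
  assumes [measurable]: "f \<in> borel_measurable D" and j: "j < n"
  shows "(\<integral>\<^sup>+\<omega>. f (\<omega> j) \<partial>sample n D) = (\<integral>\<^sup>+z. f z \<partial>D)"
proof -
  have "(\<integral>\<^sup>+z. f z \<partial>D) = (\<integral>\<^sup>+z. f z \<partial>distr (sample n D) D (\<lambda>\<omega>. \<omega> j))" by (simp add: distr_row[OF j])
  also have "\<dots> = (\<integral>\<^sup>+\<omega>. f (\<omega> j) \<partial>sample n D)" using j by (intro nn_integral_distr) auto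
  finally show ?thesis ..
qed

lemma integral_row:
  fixes f :: "pt \<Rightarrow> real"
  assumes [measurable]: "f \<in> borel_measurable D" and j: "j < n"
  shows "S.expectation (\<lambda>\<omega>. f (\<omega> j)) = D.expectation f"
    and "integrable (sample n D) (\<lambda>\<omega>. f (\<omega> j)) \<longleftrightarrow> integrable D f"
proof -
  have [measurable]: "(\<lambda>\<omega>. \<omega> j) \<in> measurable (sample n D) D" using j by simp
  show "S.expectation (\<lambda>\<omega>. f (\<omega> j)) = D.expectation f"
    using integral_distr[of "\<lambda>\<omega>. \<omega> j" "sample n D" D f] by (simp add: distr_row[OF j])
  show "integrable (sample n D) (\<lambda>\<omega>. f (\<omega> j)) \<longleftrightarrow> integrable D f"
    using integrable_distr_eq[of "\<lambda>\<omega>. \<omega> j" "sample n D" D f] by (simp add: distr_row[OF j])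
qed

section \<open>Independence of rows, entries and columns\<close>

lemma indep_rows: "S.indep_vars (\<lambda>_. D) (\<lambda>j \<omega>. \<omega> j) {..<n}"
proof (subst S.indep_vars_iff_distr_eq_PiM')
  show "{..<n} \<noteq> {}" using n_pos by auto
  show "distr (sample n D) (PiM {..<n} (\<lambda>_. D)) (\<lambda>\<omega>. \<lambda>j\<in>{..<n}. \<omega> j) = PiM {..<n} (\<lambda>j. distr (sample n D) D (\<lambda>\<omega>. \<omega> j))"
  proof -
    have "distr (sample n D) (PiM {..<n} (\<lambda>_. D)) (\<lambda>\<omega>. \<lambda>j\<in>{..<n}. \<omega> j) = distr (sample n D) (PiM {..<n} (\<lambda>_. D)) (\<lambda>\<omega>. \<omega>)"
      by (rule distr_cong) (auto simp: sample_def space_PiM PiE_restrict)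
    also have "\<dots> = PiM {..<n} (\<lambda>_. D)" by (simp add: sample_def distr_id2)
    also have "\<dots> = PiM {..<n} (\<lambda>j. distr (sample n D) D (\<lambda>\<omega>. \<omega> j))" by (rule PiM_cong) (simp_all add: distr_row)
    finally show ?thesis .
  qed
qed simp

lemma indep_rows_fun:
  assumes "\<And>j. j < n \<Longrightarrow> f j \<in> borel_measurable D"
  shows "S.indep_vars (\<lambda>_. borel) (\<lambda>j \<omega>. f j (\<omega> j)) {..<n}"
  by (rule S.indep_vars_compose2[OF indep_rows]) (use assms in auto)

lemma indep_white: "D.indep_vars (\<lambda>_. borel) white {..<p}"
  using setting by (simp add: setting_def white_def[abs_def])

text \<open>The probability of a rectangle is factored twice: over the rows by the product measure,
  and inside each row by independence of the whitened coordinates. \<open>B j\<close> collects the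
  conditions on row \<open>j\<close>.\<close>

lemma indep_entries: "S.indep_vars (\<lambda>_. borel) (\<lambda>(j, i) \<omega>. white i (\<omega> j)) ({..<n} \<times> {..<p})"
proof (subst S.indep_vars_finite)
  show "{..<n} \<times> {..<p} \<noteq> {}" using n_pos p_gt_n by auto
  show "sets borel = sigma_sets (space borel) (sets (borel :: real measure))" by (rule sets.sigma_sets_eq[symmetric])
  show "Int_stable (sets (borel :: real measure))" by (rule sets.Int_stable)
  show "\<forall>A\<in>{..<n} \<times> {..<p} \<rightarrow> sets borel.
     S.prob (\<Inter>a\<in>{..<n} \<times> {..<p}. (case a of (j, i) \<Rightarrow> \<lambda>\<omega>. white i (\<omega> j)) -` A a \<inter> space (sample n D)) =
     (\<Prod>a\<in>{..<n} \<times> {..<p}. S.prob ((case a of (j, i) \<Rightarrow> \<lambda>\<omega>. white i (\<omega> j)) -` A a \<inter> space (sample n D)))"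
  proof
    fix A :: "nat \<times> nat \<Rightarrow> real set" assume A: "A \<in> {..<n} \<times> {..<p} \<rightarrow> sets borel"
    have A' [measurable]: "j < n \<Longrightarrow> i < p \<Longrightarrow> A (j, i) \<in> sets borel" for j i using A by auto
    define B where "B j = (\<Inter>i\<in>{..<p}. white i -` A (j, i) \<inter> space D)" for j
    have p0: "{..<p} \<noteq> {}" using p_gt_n by auto
    have B [measurable]: "j < n \<Longrightarrow> B j \<in> sets D" for j
      unfolding B_def using p0 by (intro sets.finite_INT) (auto intro!: measurable_sets[OF measurable_white])
    have prob_row: "S.prob ((\<lambda>\<omega>. \<omega> j) -` C \<inter> space (sample n D)) = D.prob C" if "j < n" "C \<in> sets D" for j C
      using that distr_row[OF that(1)] measure_distr[OF measurable_row[OF that(1)] that(2)] by simp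
    have "(\<Inter>a\<in>{..<n} \<times> {..<p}. (case a of (j, i) \<Rightarrow> \<lambda>\<omega>. white i (\<omega> j)) -` A a \<inter> space (sample n D)) =
      (\<Inter>j\<in>{..<n}. (\<lambda>\<omega>. \<omega> j) -` B j \<inter> space (sample n D))"
    proof (rule Set.set_eqI)
      fix \<omega>
      have sp: "\<omega> \<in> space (sample n D) \<Longrightarrow> j < n \<Longrightarrow> \<omega> j \<in> space D" for j
        using measurable_space[OF measurable_row] by blast
      have "(0, 0) \<in> {..<n} \<times> {..<p}" "0 \<in> {..<n}" "0 \<in> {..<p}" using n_pos p_gt_n by auto
      hence "\<omega> \<in> (\<Inter>a\<in>{..<n} \<times> {..<p}. (case a of (j, i) \<Rightarrow> \<lambda>\<omega>. white i (\<omega> j)) -` A a \<inter> space (sample n D)) \<longleftrightarrow>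
          \<omega> \<in> space (sample n D) \<and> (\<forall>j<n. \<forall>i<p. white i (\<omega> j) \<in> A (j, i))" by auto
      also have "\<dots> \<longleftrightarrow> \<omega> \<in> (\<Inter>j\<in>{..<n}. (\<lambda>\<omega>. \<omega> j) -` B j \<inter> space (sample n D))"
        using \<open>0 \<in> {..<n}\<close> sp by (auto simp: B_def)
      finally show "\<omega> \<in> (\<Inter>a\<in>{..<n} \<times> {..<p}. (case a of (j, i) \<Rightarrow> \<lambda>\<omega>. white i (\<omega> j)) -` A a \<inter> space (sample n D)) \<longleftrightarrow>
          \<omega> \<in> (\<Inter>j\<in>{..<n}. (\<lambda>\<omega>. \<omega> j) -` B j \<inter> space (sample n D))" .
    qed
    also have "S.prob \<dots> = (\<Prod>j\<in>{..<n}. S.prob ((\<lambda>\<omega>. \<omega> j) -` B j \<inter> space (sample n D)))"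
      by (rule S.indep_varsD_finite[OF indep_rows]) (use n_pos B in auto)
    also have "\<dots> = (\<Prod>j<n. D.prob (B j))" by (intro prod.cong refl prob_row B) auto
    also have "\<dots> = (\<Prod>j<n. \<Prod>i<p. D.prob (white i -` A (j, i) \<inter> space D))"
    proof (intro prod.cong refl)
      fix j assume "j \<in> {..<n}"
      thus "D.prob (B j) = (\<Prod>i<p. D.prob (white i -` A (j, i) \<inter> space D))"
        unfolding B_def by (intro D.indep_varsD_finite[OF indep_white p0]) auto
    qed
    also have "\<dots> = (\<Prod>j<n. \<Prod>i<p. S.prob ((\<lambda>\<omega>. white i (\<omega> j)) -` A (j, i) \<inter> space (sample n D)))"
    proof (intro prod.cong refl)
      fix j i assume ji: "j \<in> {..<n}" "i \<in> {..<p}"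
      hence "white i -` A (j, i) \<inter> space D \<in> sets D" by (auto intro!: measurable_sets[OF measurable_white])
      from prob_row[OF _ this, of j] ji
      have "D.prob (white i -` A (j, i) \<inter> space D) = S.prob ((\<lambda>\<omega>. \<omega> j) -` (white i -` A (j, i) \<inter> space D) \<inter> space (sample n D))" by simp
      also have "(\<lambda>\<omega>. \<omega> j) -` (white i -` A (j, i) \<inter> space D) \<inter> space (sample n D) = (\<lambda>\<omega>. white i (\<omega> j)) -` A (j, i) \<inter> space (sample n D)"
        using ji measurable_space[OF measurable_row] by auto
      finally show "D.prob (white i -` A (j, i) \<inter> space D) = S.prob ((\<lambda>\<omega>. white i (\<omega> j)) -` A (j, i) \<inter> space (sample n D))" .
    qed
    also have "\<dots> = (\<Prod>a\<in>{..<n} \<times> {..<p}. S.prob ((case a of (j, i) \<Rightarrow> \<lambda>\<omega>. white i (\<omega> j)) -` A a \<inter> space (sample n D)))"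
      by (simp add: prod.cartesian_product case_prod_beta')
    finally show "S.prob (\<Inter>a\<in>{..<n} \<times> {..<p}. (case a of (j, i) \<Rightarrow> \<lambda>\<omega>. white i (\<omega> j)) -` A a \<inter> space (sample n D)) =
     (\<Prod>a\<in>{..<n} \<times> {..<p}. S.prob ((case a of (j, i) \<Rightarrow> \<lambda>\<omega>. white i (\<omega> j)) -` A a \<inter> space (sample n D)))" .
  qed
  show "(case a of (j, i) \<Rightarrow> \<lambda>\<omega>. white i (\<omega> j)) \<in> borel_measurable (sample n D)" if "a \<in> {..<n} \<times> {..<p}" for a
    using that by auto
qed auto

text \<open>Grouping the independent entries by column gives independent blocks. The tail Gram
  matrix is a sum over eigendirections and needs this independence; the head covariance is a sum
  over rows.\<close>

lemma indep_columns:
  "S.indep_vars (\<lambda>_. borel) (\<lambda>l \<omega>. \<Sum>j<n. u j * white l (\<omega> j)) {..<p}"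
proof -
  have "S.indep_vars (\<lambda>l. PiM ({..<n} \<times> {l}) (\<lambda>_. borel))
     (\<lambda>l \<omega>. restrict (\<lambda>a. (case a of (j, i) \<Rightarrow> \<lambda>\<omega>. white i (\<omega> j)) \<omega>) ({..<n} \<times> {l})) {..<p}"
    by (rule S.indep_vars_restrict[OF indep_entries]) (auto simp: disjoint_family_on_def)
  hence "S.indep_vars (\<lambda>_. borel) (\<lambda>l \<omega>. (\<lambda>l f. \<Sum>j<n. u j * f (j, l)) l
     (restrict (\<lambda>a. (case a of (j, i) \<Rightarrow> \<lambda>\<omega>. white i (\<omega> j)) \<omega>) ({..<n} \<times> {l}))) {..<p}"
    by (rule S.indep_vars_compose2) measurable
  moreover have "(\<Sum>j<n. u j * restrict (\<lambda>a. (case a of (j, i) \<Rightarrow> \<lambda>\<omega>. white i (\<omega> j)) \<omega>) ({..<n} \<times> {l}) (j, l))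
     = (\<Sum>j<n. u j * white l (\<omega> j))" for l \<omega>
    by (intro sum.cong) auto
  ultimately show ?thesis by (simp only:)
qed

lemma white_mean: "i < p \<Longrightarrow> D.expectation (white i) = 0" "i < p \<Longrightarrow> integrable D (white i)"
  using setting unfolding white_def setting_def by auto

lemma white_cov:
  assumes "i < p" "j < p"
  shows "integrable D (\<lambda>z. white i z * white j z)" "D.expectation (\<lambda>z. white i z * white j z) = (if i = j then 1 else 0)"
proof -
  have eq: "white i z * white j z = fst z i * fst z j / (sqrt (lam i) * sqrt (lam j))" for z by (simp add: white_def)
  have "integrable D (\<lambda>z. fst z i * fst z j)" "D.expectation (\<lambda>z. fst z i * fst z j) = (if i = j then lam i else 0)"
    using setting assms unfolding setting_def by auto
  thus "integrable D (\<lambda>z. white i z * white j z)" "D.expectation (\<lambda>z. white i z * white j z) = (if i = j then 1 else 0)"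
    unfolding eq using lam_pos[OF assms(1)] by auto
qed

lemma white_mgf: "(\<integral>\<^sup>+z. ennreal (exp (\<Sum>i<p. \<phi> i * white i z)) \<partial>D) \<le> ennreal (exp (sx\<^sup>2 * ip p \<phi> \<phi> / 2))"
proof -
  have "integrable D (\<lambda>z. exp (\<Sum>i<p. \<phi> i * white i z))"
    "D.expectation (\<lambda>z. exp (\<Sum>i<p. \<phi> i * white i z)) \<le> exp (sx\<^sup>2 * ip p \<phi> \<phi> / 2)"
    using setting unfolding setting_def white_def by auto
  thus ?thesis by (subst nn_integral_eq_integral) (auto intro: ennreal_leI)
qed

lemma row_subgaussian:
  assumes j: "j < n" and u: "ip p u u \<le> 1"
  shows "subgaussian (sample n D) sx (\<lambda>\<omega>. \<Sum>i<p. u i * white i (\<omega> j))"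
  unfolding subgaussian_def
proof (intro conjI allI)
  show "(\<lambda>\<omega>. \<Sum>i<p. u i * white i (\<omega> j)) \<in> borel_measurable (sample n D)" using j by measurable
  fix t
  have "(\<integral>\<^sup>+\<omega>. ennreal (exp (t * (\<Sum>i<p. u i * white i (\<omega> j)))) \<partial>sample n D)
      = (\<integral>\<^sup>+z. ennreal (exp (t * (\<Sum>i<p. u i * white i z))) \<partial>D)"
    by (rule nn_integral_row[OF _ j, of "\<lambda>z. ennreal (exp (t * (\<Sum>i<p. u i * white i z)))"]) measurable
  also have "\<dots> = (\<integral>\<^sup>+z. ennreal (exp (\<Sum>i<p. (t * u i) * white i z)) \<partial>D)" by (simp add: sum_distrib_left mult.assoc)
  also have "\<dots> \<le> ennreal (exp (sx\<^sup>2 * ip p (\<lambda>i. t * u i) (\<lambda>i. t * u i) / 2))" by (rule white_mgf)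
  also have "\<dots> \<le> ennreal (exp (sx\<^sup>2 * t\<^sup>2 / 2))"
  proof -
    have "ip p (\<lambda>i. t * u i) (\<lambda>i. t * u i) \<le> t\<^sup>2"
      unfolding ip_linear using mult_left_mono[OF u, of "t * t"] by (simp add: power2_eq_square mult.assoc)
    thus ?thesis by (intro ennreal_leI) (auto intro!: mult_left_mono)
  qed
  finally show "(\<integral>\<^sup>+\<omega>. ennreal (exp (t * (\<Sum>i<p. u i * white i (\<omega> j)))) \<partial>sample n D) \<le> ennreal (exp (sx\<^sup>2 * t\<^sup>2 / 2))" .
qed

lemma row_second_moment:
  assumes j: "j < n"
  shows "integrable (sample n D) (\<lambda>\<omega>. (\<Sum>i<p. u i * white i (\<omega> j))\<^sup>2)"
    and "S.expectation (\<lambda>\<omega>. (\<Sum>i<p. u i * white i (\<omega> j))\<^sup>2) = ip p u u"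
proof -
  have eq: "(\<Sum>i<p. u i * white i z)\<^sup>2 = (\<Sum>i<p. \<Sum>l<p. (u i * u l) * (white i z * white l z))" for z
    by (simp add: power2_eq_square sum_product mult_ac)
  have int: "integrable D (\<lambda>z. (\<Sum>i<p. u i * white i z)\<^sup>2)"
    unfolding eq by (intro Bochner_Integration.integrable_sum integrable_mult_right white_cov) auto
  thus "integrable (sample n D) (\<lambda>\<omega>. (\<Sum>i<p. u i * white i (\<omega> j))\<^sup>2)"
    using integral_row(2)[of "\<lambda>z. (\<Sum>i<p. u i * white i z)\<^sup>2" j] j by simp
  have "S.expectation (\<lambda>\<omega>. (\<Sum>i<p. u i * white i (\<omega> j))\<^sup>2) = D.expectation (\<lambda>z. (\<Sum>i<p. u i * white i z)\<^sup>2)"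
    using integral_row(1)[of "\<lambda>z. (\<Sum>i<p. u i * white i z)\<^sup>2" j] j by simp
  also have "\<dots> = (\<Sum>i<p. \<Sum>l<p. (u i * u l) * D.expectation (\<lambda>z. white i z * white l z))"
    unfolding eq by (rule integral_quadratic) (auto intro: white_cov)
  also have "\<dots> = (\<Sum>i<p. \<Sum>l<p. if l = i then u i * u l else 0)"
    by (intro sum.cong refl) (auto simp: white_cov)
  also have "\<dots> = ip p u u" by (simp add: ip_def)
  finally show "S.expectation (\<lambda>\<omega>. (\<Sum>i<p. u i * white i (\<omega> j))\<^sup>2) = ip p u u" .
qed

text \<open>Rows are independent, so exponential moments multiply; each factor is the sub-Gaussian
  bound for a vector supported on the single coordinate \<open>l\<close>.\<close>

lemma column_subgaussian:
  assumes l: "l < p" and u: "ip n u u \<le> 1"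
  shows "subgaussian (sample n D) sx (\<lambda>\<omega>. \<Sum>j<n. u j * white l (\<omega> j))"
  unfolding subgaussian_def
proof (intro conjI allI)
  show "(\<lambda>\<omega>. \<Sum>j<n. u j * white l (\<omega> j)) \<in> borel_measurable (sample n D)" using l by measurable
  fix t
  have "(\<integral>\<^sup>+\<omega>. ennreal (exp (t * (\<Sum>j<n. u j * white l (\<omega> j)))) \<partial>sample n D)
      = (\<integral>\<^sup>+\<omega>. (\<Prod>j<n. ennreal (exp ((t * u j) * white l (\<omega> j)))) \<partial>PiM {..<n} (\<lambda>_. D))"
    unfolding sample_def by (intro nn_integral_cong) (simp add: sum_distrib_left exp_sum prod_ennreal mult.assoc)
  also have "\<dots> = (\<Prod>j<n. \<integral>\<^sup>+z. ennreal (exp ((t * u j) * white l z)) \<partial>D)"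
    using l by (intro rows.product_nn_integral_prod) auto
  also have "\<dots> \<le> (\<Prod>j<n. ennreal (exp (sx\<^sup>2 * (t * u j)\<^sup>2 / 2)))"
  proof (rule prod_mono_ennreal)
    fix j
    have "(\<Sum>i<p. (if i = l then t * u j else 0) * white i z) = (\<Sum>i<p. if i = l then (t * u j) * white i z else 0)" for z
      by (intro sum.cong) auto
    hence "(\<Sum>i<p. (if i = l then t * u j else 0) * white i z) = (t * u j) * white l z" for z using l by simp
    moreover have "ip p (\<lambda>i. if i = l then t * u j else 0) (\<lambda>i. if i = l then t * u j else 0) = (\<Sum>i<p. if i = l then (t * u j)\<^sup>2 else 0)"
      unfolding ip_self by (intro sum.cong) auto
    ultimately show "(\<integral>\<^sup>+z. ennreal (exp ((t * u j) * white l z)) \<partial>D) \<le> ennreal (exp (sx\<^sup>2 * (t * u j)\<^sup>2 / 2))"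
      using white_mgf[of "\<lambda>i. if i = l then t * u j else 0"] l by simp
  qed
  also have "\<dots> = ennreal (exp (sx\<^sup>2 * t\<^sup>2 * ip n u u / 2))"
    by (simp add: prod_ennreal exp_sum[symmetric] ip_self sum_distrib_left sum_divide_distrib power_mult_distrib mult.assoc)
  also have "\<dots> \<le> ennreal (exp (sx\<^sup>2 * t\<^sup>2 / 2))"
    using mult_left_mono[OF u, of "sx\<^sup>2 * t\<^sup>2"] by (intro ennreal_leI) simp
  finally show "(\<integral>\<^sup>+\<omega>. ennreal (exp (t * (\<Sum>j<n. u j * white l (\<omega> j)))) \<partial>sample n D) \<le> ennreal (exp (sx\<^sup>2 * t\<^sup>2 / 2))" .
qed

lemma column_cov:
  assumes l: "l < p" and j: "j < n" "j' < n"
  shows "integrable (sample n D) (\<lambda>\<omega>. white l (\<omega> j) * white l (\<omega> j'))"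
    and "S.expectation (\<lambda>\<omega>. white l (\<omega> j) * white l (\<omega> j')) = (if j = j' then 1 else 0)"
proof (atomize(full), cases "j = j'")
  case True
  show "integrable (sample n D) (\<lambda>\<omega>. white l (\<omega> j) * white l (\<omega> j')) \<and>
    S.expectation (\<lambda>\<omega>. white l (\<omega> j) * white l (\<omega> j')) = (if j = j' then 1 else 0)"
    using integral_row[of "\<lambda>z. white l z * white l z" j] white_cov[OF l l] True j l by simp
next
  case False
  have ind: "S.indep_vars (\<lambda>_. borel) (\<lambda>j \<omega>. white l (\<omega> j)) {j, j'}"
    by (rule S.indep_vars_subset[OF indep_rows_fun]) (use l j in auto)
  have int: "integrable (sample n D) (\<lambda>\<omega>. white l (\<omega> i))" "S.expectation (\<lambda>\<omega>. white l (\<omega> i)) = 0" if "i < n" for i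
    using integral_row[of "white l" i] white_mean[OF l] that l by auto
  show "integrable (sample n D) (\<lambda>\<omega>. white l (\<omega> j) * white l (\<omega> j')) \<and>
    S.expectation (\<lambda>\<omega>. white l (\<omega> j) * white l (\<omega> j')) = (if j = j' then 1 else 0)"
    using S.indep_vars_lebesgue_integral[OF _ ind] S.indep_vars_integrable[OF _ ind] int j False by auto
qed

lemma column_second_moment:
  assumes l: "l < p"
  shows "integrable (sample n D) (\<lambda>\<omega>. (\<Sum>j<n. u j * white l (\<omega> j))\<^sup>2)"
    and "S.expectation (\<lambda>\<omega>. (\<Sum>j<n. u j * white l (\<omega> j))\<^sup>2) = ip n u u"
proof -
  have eq: "(\<Sum>j<n. u j * white l (\<omega> j))\<^sup>2 = (\<Sum>j<n. \<Sum>j'<n. (u j * u j') * (white l (\<omega> j) * white l (\<omega> j')))" for \<omega> :: "nat \<Rightarrow> pt"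
    by (simp add: power2_eq_square sum_product mult_ac)
  show "integrable (sample n D) (\<lambda>\<omega>. (\<Sum>j<n. u j * white l (\<omega> j))\<^sup>2)"
    unfolding eq by (intro Bochner_Integration.integrable_sum integrable_mult_right column_cov[OF l]) auto
  have "S.expectation (\<lambda>\<omega>. (\<Sum>j<n. u j * white l (\<omega> j))\<^sup>2) = (\<Sum>j<n. \<Sum>j'<n. (u j * u j') * S.expectation (\<lambda>\<omega>. white l (\<omega> j) * white l (\<omega> j')))"
    unfolding eq by (rule integral_quadratic) (auto intro: column_cov[OF l])
  also have "\<dots> = (\<Sum>j<n. \<Sum>j'<n. if j' = j then u j * u j' else 0)"
    by (intro sum.cong refl) (auto simp: column_cov[OF l])
  also have "\<dots> = ip n u u" by (simp add: ip_def)
  finally show "S.expectation (\<lambda>\<omega>. (\<Sum>j<n. u j * white l (\<omega> j))\<^sup>2) = ip n u u" .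
qed

end

section \<open>Noise given the design\<close>

context regression
begin

text \<open>Restricted to \<open>{..<n}\<close> so that it is a point of the product space
  \<open>designs\<close>, on which the coefficients in the conditional noise estimates are
  measurable functions.\<close>

definition design :: "(nat \<Rightarrow> pt) \<Rightarrow> nat \<Rightarrow> nat \<Rightarrow> real" where
  "design \<omega> = (\<lambda>j\<in>{..<n}. fst (\<omega> j))"

abbreviation "designs \<equiv> PiM {..<n} (\<lambda>_. covariates)"

lemma measurable_design [measurable]: "design \<in> measurable (sample n D) designs"
  unfolding design_def by measurable

lemma measurable_design_entry [measurable]: "j < n \<Longrightarrow> i < p \<Longrightarrow> (\<lambda>x. x j i) \<in> borel_measurable designs"
  by (rule measurable_compose[OF measurable_component_singleton[of j] measurable_component_singleton]) auto

definition noises :: "(nat \<Rightarrow> pt) \<Rightarrow> nat \<Rightarrow> real" where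
  "noises \<omega> j = noise p th (\<omega> j)"

lemma measurable_noises [measurable]: "j < n \<Longrightarrow> (\<lambda>\<omega>. noises \<omega> j) \<in> borel_measurable (sample n D)"
  unfolding noises_def by measurable

lemma subalgebra_xalg: "finite_measure_subalgebra D (xalg p D)"
proof
  have fst_D [measurable]: "fst \<in> measurable D covariates" by measurable
  show "subalgebra D (xalg p D)"
    unfolding subalgebra_def xalg_def
  proof
    show "sets (vimage_algebra (space D) fst covariates) \<subseteq> sets D"
      unfolding sets_vimage_algebra by (rule sets.sigma_sets_subset) (auto intro: measurable_sets[OF fst_D])
  qed simp
qed

text \<open>The defining identity of the conditional expectation on the event that the covariates
  lie in \<open>B\<close>, followed by the almost sure bound. It supplies \<open>base\<close> for
  covariate-dependent exponents.\<close>

lemma noise_conditional_mgf: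
  assumes B: "B \<in> sets covariates"
  shows "(\<integral>\<^sup>+z. indicator B (fst z) * ennreal (exp (t * noise p th z)) \<partial>D)
    \<le> ennreal (exp (sy\<^sup>2 * t\<^sup>2 / 2)) * emeasure D (fst -` B \<inter> space D)"
proof -
  have fst_D [measurable]: "fst \<in> measurable D covariates" by measurable
  interpret C: finite_measure_subalgebra D "xalg p D" by (rule subalgebra_xalg)
  define A where "A = fst -` B \<inter> space D"
  have A: "A \<in> sets (xalg p D)" unfolding A_def xalg_def by (rule in_vimage_algebra[OF B])
  have AD [measurable]: "A \<in> sets D" unfolding A_def using B by measurable
  have int: "integrable D (\<lambda>z. exp (t * noise p th z))"
    and le: "AE z in D. real_cond_exp D (xalg p D) (\<lambda>z. exp (t * noise p th z)) z \<le> exp (sy\<^sup>2 * t\<^sup>2 / 2)"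
    using setting unfolding setting_def by blast+
  have intA: "integrable D (\<lambda>z. indicator A z * exp (t * noise p th z))"
    using integrable_mult_indicator[OF AD int] by simp
  have "(\<integral>\<^sup>+z. indicator B (fst z) * ennreal (exp (t * noise p th z)) \<partial>D) = (\<integral>\<^sup>+z. ennreal (indicator A z * exp (t * noise p th z)) \<partial>D)"
    by (intro nn_integral_cong) (auto simp: A_def indicator_def)
  also have "\<dots> = ennreal (\<integral>z. indicator A z * exp (t * noise p th z) \<partial>D)"
    by (rule nn_integral_eq_integral[OF intA]) auto
  also have "(\<integral>z. indicator A z * exp (t * noise p th z) \<partial>D) = (\<integral>z. indicator A z * real_cond_exp D (xalg p D) (\<lambda>z. exp (t * noise p th z)) z \<partial>D)"
    using C.real_cond_exp_intA[OF int A] by (simp add: set_lebesgue_integral_def)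
  also have "\<dots> \<le> (\<integral>z. indicator A z * exp (sy\<^sup>2 * t\<^sup>2 / 2) \<partial>D)"
  proof (rule integral_mono_AE)
    show "integrable D (\<lambda>z. indicator A z * real_cond_exp D (xalg p D) (\<lambda>z. exp (t * noise p th z)) z)"
      using integrable_mult_indicator[OF AD C.real_cond_exp_int(1)[OF int]] by simp
    show "AE z in D. indicator A z * real_cond_exp D (xalg p D) (\<lambda>z. exp (t * noise p th z)) z \<le> indicator A z * exp (sy\<^sup>2 * t\<^sup>2 / 2)"
      using le by eventually_elim (auto simp: indicator_def)
  qed (auto simp: less_top[symmetric])
  also have "\<dots> = exp (sy\<^sup>2 * t\<^sup>2 / 2) * D.prob A" by simp
  finally show ?thesis by (simp add: ennreal_leI D.emeasure_eq_measure A_def ennreal_mult)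
qed

lemma noise_conditional_subgaussian:
  fixes F :: "(nat \<Rightarrow> nat \<Rightarrow> real) \<Rightarrow> ennreal"
  assumes F: "F \<in> borel_measurable designs" and h: "\<And>j. j < n \<Longrightarrow> (\<lambda>x. h x j) \<in> borel_measurable designs"
  shows "(\<integral>\<^sup>+\<omega>. F (design \<omega>) * ennreal (exp (ip n (h (design \<omega>)) (noises \<omega>))) \<partial>sample n D)
    \<le> (\<integral>\<^sup>+\<omega>. F (design \<omega>) * ennreal (exp (sy\<^sup>2 * ip n (h (design \<omega>)) (h (design \<omega>)) / 2)) \<partial>sample n D)"
proof -
  have fst_D [measurable]: "fst \<in> measurable D covariates" by measurable
  have "(\<integral>\<^sup>+\<omega>. F (\<lambda>j\<in>{..<n}. fst (\<omega> j)) * ennreal (exp (\<Sum>j\<in>{..<n}. (\<lambda>j x. h x j) j (\<lambda>j\<in>{..<n}. fst (\<omega> j)) * noise p th (\<omega> j))) \<partial>PiM {..<n} (\<lambda>_. D))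
    \<le> (\<integral>\<^sup>+\<omega>. F (\<lambda>j\<in>{..<n}. fst (\<omega> j)) * ennreal (exp (\<Sum>j\<in>{..<n}. sy\<^sup>2 * ((\<lambda>j x. h x j) j (\<lambda>j\<in>{..<n}. fst (\<omega> j)))\<^sup>2 / 2)) \<partial>PiM {..<n} (\<lambda>_. D))"
  proof (rule conditional_subgaussian_PiM[OF D.prob_space_axioms fst_D measurable_noise])
    fix \<alpha> :: "(nat \<Rightarrow> real) \<Rightarrow> ennreal" and g :: "(nat \<Rightarrow> real) \<Rightarrow> real"
    assume "\<alpha> \<in> borel_measurable covariates" "g \<in> borel_measurable covariates"
    thus "(\<integral>\<^sup>+z. \<alpha> (fst z) * ennreal (exp (g (fst z) * noise p th z)) \<partial>D) \<le> (\<integral>\<^sup>+z. \<alpha> (fst z) * ennreal (exp (sy\<^sup>2 * (g (fst z))\<^sup>2 / 2)) \<partial>D)"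
      by (intro conditional_subgaussian_varying[OF fst_D measurable_noise noise_conditional_mgf]) auto
  qed (use F h in auto)
  thus ?thesis by (simp add: sample_def design_def ip_def noises_def power2_eq_square sum_distrib_left sum_divide_distrib)
qed

lemma noise_subgaussian: "subgaussian D sy (noise p th)"
  unfolding subgaussian_def
proof (intro conjI allI measurable_noise)
  fix t
  have "(\<integral>\<^sup>+z. ennreal (exp (t * noise p th z)) \<partial>D) = (\<integral>\<^sup>+z. indicator (space covariates) (fst z) * ennreal (exp (t * noise p th z)) \<partial>D)"
    using measurable_space[of fst D covariates] by (intro nn_integral_cong) (auto simp: indicator_def)
  also have "\<dots> \<le> ennreal (exp (sy\<^sup>2 * t\<^sup>2 / 2)) * emeasure D (fst -` space covariates \<inter> space D)"
    by (rule noise_conditional_mgf) auto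
  also have "\<dots> \<le> ennreal (exp (sy\<^sup>2 * t\<^sup>2 / 2)) * 1"
    by (intro mult_left_mono D.emeasure_le_1) auto
  finally show "(\<integral>\<^sup>+z. ennreal (exp (t * noise p th z)) \<partial>D) \<le> ennreal (exp (sy\<^sup>2 * t\<^sup>2 / 2))" by simp
qed

lemma noise_variance: "integrable D (\<lambda>z. (noise p th z)\<^sup>2)" "D.expectation (\<lambda>z. (noise p th z)\<^sup>2) = sig\<^sup>2"
proof -
  have fst_D [measurable]: "fst \<in> measurable D covariates" by measurable
  interpret C: finite_measure_subalgebra D "xalg p D" by (rule subalgebra_xalg)
  show int: "integrable D (\<lambda>z. (noise p th z)\<^sup>2)" using setting unfolding setting_def by blast
  have ae: "AE z in D. real_cond_exp D (xalg p D) (\<lambda>z. (noise p th z)\<^sup>2) z = sig\<^sup>2"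
    using setting unfolding setting_def by blast
  have "D.expectation (\<lambda>z. (noise p th z)\<^sup>2) = D.expectation (real_cond_exp D (xalg p D) (\<lambda>z. (noise p th z)\<^sup>2))"
    by (rule C.real_cond_exp_int(2)[OF int, symmetric])
  also have "\<dots> = D.expectation (\<lambda>z. sig\<^sup>2)"
    by (rule integral_cong_AE) (use ae in auto)
  also have "\<dots> = sig\<^sup>2" by (simp add: D.prob_space)
  finally show "D.expectation (\<lambda>z. (noise p th z)\<^sup>2) = sig\<^sup>2" .
qed

text \<open>Convexity of the exponential reduces the quadratic form to single squares, at the price of
  replacing its operator norm by its trace.\<close>

lemma exp_weighted_sum_le:
  fixes w y :: "nat \<Rightarrow> real"
  assumes w: "\<And>i. i < d \<Longrightarrow> 0 \<le> w i" and sum: "(\<Sum>i<d. w i) \<le> 1"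
  shows "exp (\<Sum>i<d. w i * y i) \<le> (1 - (\<Sum>i<d. w i)) + (\<Sum>i<d. w i * exp (y i))"
proof -
  \<comment> \<open>The missing mass goes to an extra point with value 0, where the exponential is
    1; Jensen's inequality then has weights summing to 1.\<close>
  define w' where "w' i = (if i < d then w i else 1 - (\<Sum>i<d. w i))" for i
  define y' where "y' i = (if i < d then y i else 0)" for i
  have "exp (\<Sum>i\<in>{..d}. w' i *\<^sub>R y' i) \<le> (\<Sum>i\<in>{..d}. w' i * exp (y' i))"
  proof (rule convex_on_sum[where C=UNIV])
    show "convex_on UNIV (exp :: real \<Rightarrow> real)" by (rule exp_convex)
    show "sum w' {..d} = 1" by (simp add: lessThan_Suc_atMost[symmetric] w'_def)
  qed (use w sum in \<open>auto simp: w'_def\<close>)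
  thus ?thesis by (simp add: lessThan_Suc_atMost[symmetric] w'_def y'_def add.commute)
qed

text \<open>The form is \<open>\<tau>\<close> times a combination, with weights
  \<open>ip n (q x i) (q x i) / \<tau>\<close> of total at most 1, of squares of normalised linear
  forms in the noise. Each square, scaled by \<open>a\<close>, has exponential moment at most 2
  relative to any weight depending on the design, hence so has the combination, and Markov's
  inequality gives the tail. Being a design event, \<open>G\<close> can be carried as such a
  weight.\<close>

lemma noise_quadratic_tail:
  fixes q :: "(nat \<Rightarrow> nat \<Rightarrow> real) \<Rightarrow> nat \<Rightarrow> nat \<Rightarrow> real"
  assumes q [measurable]: "\<And>i j. i < d \<Longrightarrow> j < n \<Longrightarrow> (\<lambda>x. q x i j) \<in> borel_measurable designs"
    and G [measurable]: "Measurable.pred designs G"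
    and tr: "\<And>x. G x \<Longrightarrow> (\<Sum>i<d. ip n (q x i) (q x i)) \<le> \<tau>" and \<tau>: "0 < \<tau>"
  shows "S.prob {\<omega>\<in>space (sample n D). G (design \<omega>) \<and> 4 * sy\<^sup>2 * \<tau> * L < (\<Sum>i<d. (ip n (q (design \<omega>) i) (noises \<omega>))\<^sup>2)} \<le> 2 * exp (- L)"
proof -
  define a where "a = 1 / (4 * sy\<^sup>2)"
  have a: "a > 0" using sy_pos by (simp add: a_def)
  define w where "w x i = ip n (q x i) (q x i) / \<tau>" for x i
  \<comment> \<open>A vanishing row gives \<open>u = 0\<close> through division by zero,
    consistently with its weight being 0.\<close>
  define u where "u x i j = q x i j / nrm n (q x i)" for x i j
  have w0: "0 \<le> w x i" for x i using \<tau> by (simp add: w_def)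
  have w1: "(\<Sum>i<d. w x i) \<le> 1" if "G x" for x
    using tr[OF that] \<tau> by (simp add: w_def sum_divide_distrib[symmetric])
  have [measurable]: "(\<lambda>x. ip n (q x i) (q x i)) \<in> borel_measurable designs" if "i < d" for i
    unfolding ip_def using that by measurable
  have [measurable]: "(\<lambda>x. w x i) \<in> borel_measurable designs" if "i < d" for i
    unfolding w_def using that by measurable
  have [measurable]: "(\<lambda>x. u x i j) \<in> borel_measurable designs" if "i < d" "j < n" for i j
    unfolding u_def nrm_def using that by measurable
  have [measurable]: "(\<lambda>\<omega>. ip n (u (design \<omega>) i) (noises \<omega>)) \<in> borel_measurable (sample n D)" if "i < d" for i
    unfolding ip_def using that by measurable
  have [measurable]: "(\<lambda>\<omega>. ip n (q (design \<omega>) i) (noises \<omega>)) \<in> borel_measurable (sample n D)" if "i < d" for i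
    unfolding ip_def using that by measurable
  have ipu: "ip n (u x i) (u x i) \<le> 1" for x i
  proof -
    have "u x i = (\<lambda>j. (1 / nrm n (q x i)) * q x i j)" by (simp add: u_def fun_eq_iff)
    hence "ip n (u x i) (u x i) = (1 / nrm n (q x i)) * ((1 / nrm n (q x i)) * (nrm n (q x i))\<^sup>2)"
      by (simp only: ip_linear nrm_power2)
    thus ?thesis by (simp add: power2_eq_square)
  qed
  have qu: "(ip n (q x i) e)\<^sup>2 = \<tau> * (w x i * (ip n (u x i) e)\<^sup>2)" for x i e
  proof (cases "nrm n (q x i) = 0")
    case True
    thus ?thesis by (simp add: nrm_eq_0_iff ip_def w_def)
  next
    case False
    have "u x i = (\<lambda>j. (1 / nrm n (q x i)) * q x i j)" by (simp add: u_def fun_eq_iff)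
    hence "ip n (u x i) e = (1 / nrm n (q x i)) * ip n (q x i) e" by (simp only: ip_linear)
    thus ?thesis using False \<tau> by (simp add: w_def nrm_power2[symmetric] power_divide)
  qed
  have each: "(\<integral>\<^sup>+\<omega>. (indicator {x. G x} (design \<omega>) * ennreal (w (design \<omega>) i)) * ennreal (exp (a * (ip n (u (design \<omega>) i) (noises \<omega>))\<^sup>2)) \<partial>sample n D)
      \<le> 2 * (\<integral>\<^sup>+\<omega>. indicator {x. G x} (design \<omega>) * ennreal (w (design \<omega>) i) \<partial>sample n D)" if i: "i < d" for i
  proof -
    let ?F = "\<lambda>x. indicator {x. G x} x * ennreal (w x i)"
    have F [measurable]: "?F \<in> borel_measurable designs" using i by measurable
    have "(\<integral>\<^sup>+\<omega>. ?F (design \<omega>) * ennreal (exp ((ip n (u (design \<omega>) i) (noises \<omega>))\<^sup>2 / (4 * sy\<^sup>2))) \<partial>sample n D)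
      \<le> 2 * (\<integral>\<^sup>+\<omega>. ?F (design \<omega>) \<partial>sample n D)"
    proof (rule nn_integral_exp_square_le)
      show "sigma_finite_measure (sample n D)" by (rule S.sigma_finite_measure_axioms)
      show "(\<lambda>\<omega>. ?F (design \<omega>)) \<in> borel_measurable (sample n D)" by measurable
      show "(\<lambda>\<omega>. ip n (u (design \<omega>) i) (noises \<omega>)) \<in> borel_measurable (sample n D)" using i by measurable
      show "0 < sy" by (rule sy_pos)
      fix t
      have "(\<integral>\<^sup>+\<omega>. ?F (design \<omega>) * ennreal (exp (t * ip n (u (design \<omega>) i) (noises \<omega>))) \<partial>sample n D)
          = (\<integral>\<^sup>+\<omega>. ?F (design \<omega>) * ennreal (exp (ip n ((\<lambda>x j. t * u x i j) (design \<omega>)) (noises \<omega>))) \<partial>sample n D)"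
        by (simp add: ip_linear)
      also have "\<dots> \<le> (\<integral>\<^sup>+\<omega>. ?F (design \<omega>) * ennreal (exp (sy\<^sup>2 * ip n ((\<lambda>x j. t * u x i j) (design \<omega>)) ((\<lambda>x j. t * u x i j) (design \<omega>)) / 2)) \<partial>sample n D)"
        by (rule noise_conditional_subgaussian[OF F]) (use i in measurable)
      also have "\<dots> \<le> (\<integral>\<^sup>+\<omega>. ?F (design \<omega>) * ennreal (exp (sy\<^sup>2 * t\<^sup>2 / 2)) \<partial>sample n D)"
      proof (intro nn_integral_mono mult_left_mono ennreal_leI)
        fix \<omega>
        have "ip n (\<lambda>j. t * u (design \<omega>) i j) (\<lambda>j. t * u (design \<omega>) i j) \<le> t\<^sup>2"
          unfolding ip_linear using mult_left_mono[OF ipu, of "t * t"] by (simp add: power2_eq_square mult.assoc)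
        thus "exp (sy\<^sup>2 * ip n ((\<lambda>x j. t * u x i j) (design \<omega>)) ((\<lambda>x j. t * u x i j) (design \<omega>)) / 2) \<le> exp (sy\<^sup>2 * t\<^sup>2 / 2)"
          by (auto intro!: mult_left_mono)
      qed auto
      also have "\<dots> = (\<integral>\<^sup>+\<omega>. ?F (design \<omega>) \<partial>sample n D) * ennreal (exp (sy\<^sup>2 * t\<^sup>2 / 2))"
        by (rule nn_integral_multc) measurable
      finally show "(\<integral>\<^sup>+\<omega>. ?F (design \<omega>) * ennreal (exp (t * ip n (u (design \<omega>) i) (noises \<omega>))) \<partial>sample n D)
          \<le> ennreal (exp (sy\<^sup>2 * t\<^sup>2 / 2)) * (\<integral>\<^sup>+\<omega>. ?F (design \<omega>) \<partial>sample n D)" by (simp add: mult.commute)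
    qed
    thus ?thesis by (simp add: a_def)
  qed
  let ?Q = "\<lambda>\<omega>. \<Sum>i<d. (ip n (q (design \<omega>) i) (noises \<omega>))\<^sup>2"
  let ?I = "\<lambda>\<omega>. indicator {x. G x} (design \<omega>) :: ennreal"
  define W where "W x = (\<Sum>i<d. w x i)" for x
  have [measurable]: "W \<in> borel_measurable designs" unfolding W_def by measurable
  have total: "(\<integral>\<^sup>+\<omega>. ?I \<omega> * ennreal (exp (a / \<tau> * ?Q \<omega>)) \<partial>sample n D) \<le> 2"
  proof -
    have "(\<integral>\<^sup>+\<omega>. ?I \<omega> * ennreal (exp (a / \<tau> * ?Q \<omega>)) \<partial>sample n D)
      \<le> (\<integral>\<^sup>+\<omega>. ?I \<omega> * ennreal (1 - W (design \<omega>)) + (\<Sum>i<d. (?I \<omega> * ennreal (w (design \<omega>) i)) * ennreal (exp (a * (ip n (u (design \<omega>) i) (noises \<omega>))\<^sup>2))) \<partial>sample n D)"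
    proof (rule nn_integral_mono)
      fix \<omega>
      let ?e = "\<lambda>i. a * (ip n (u (design \<omega>) i) (noises \<omega>))\<^sup>2"
      show "?I \<omega> * ennreal (exp (a / \<tau> * ?Q \<omega>)) \<le> ?I \<omega> * ennreal (1 - W (design \<omega>)) + (\<Sum>i<d. (?I \<omega> * ennreal (w (design \<omega>) i)) * ennreal (exp (?e i)))"
      proof (cases "G (design \<omega>)")
        case True
        have "a / \<tau> * ?Q \<omega> = (\<Sum>i<d. w (design \<omega>) i * ?e i)"
          using \<tau> by (simp add: qu sum_distrib_left mult_ac)
        hence "exp (a / \<tau> * ?Q \<omega>) = exp (\<Sum>i<d. w (design \<omega>) i * ?e i)" by simp
        also have "\<dots> \<le> (1 - W (design \<omega>)) + (\<Sum>i<d. w (design \<omega>) i * exp (?e i))"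
          unfolding W_def by (rule exp_weighted_sum_le) (use w0 w1[OF True] in auto)
        finally have "ennreal (exp (a / \<tau> * ?Q \<omega>)) \<le> ennreal ((1 - W (design \<omega>)) + (\<Sum>i<d. w (design \<omega>) i * exp (?e i)))" by (rule ennreal_leI)
        also have "\<dots> = ennreal (1 - W (design \<omega>)) + (\<Sum>i<d. ennreal (w (design \<omega>) i) * ennreal (exp (?e i)))"
          using w0 w1[OF True]
          by (subst ennreal_plus) (auto simp: W_def sum_nonneg ennreal_mult[symmetric] intro!: sum_ennreal[symmetric] sum_nonneg)
        finally show ?thesis using True by simp
      qed simp
    qed
    also have "\<dots> = (\<integral>\<^sup>+\<omega>. ?I \<omega> * ennreal (1 - W (design \<omega>)) \<partial>sample n D)
        + (\<Sum>i<d. \<integral>\<^sup>+\<omega>. (?I \<omega> * ennreal (w (design \<omega>) i)) * ennreal (exp (a * (ip n (u (design \<omega>) i) (noises \<omega>))\<^sup>2)) \<partial>sample n D)"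
      by (subst nn_integral_add, measurable) (subst nn_integral_sum, auto)
    also have "\<dots> \<le> (\<integral>\<^sup>+\<omega>. ?I \<omega> * ennreal (1 - W (design \<omega>)) \<partial>sample n D)
        + (\<Sum>i<d. 2 * (\<integral>\<^sup>+\<omega>. ?I \<omega> * ennreal (w (design \<omega>) i) \<partial>sample n D))"
      by (intro add_left_mono sum_mono each) auto
    also have "\<dots> = (\<integral>\<^sup>+\<omega>. ?I \<omega> * ennreal (1 - W (design \<omega>)) + (\<Sum>i<d. 2 * (?I \<omega> * ennreal (w (design \<omega>) i))) \<partial>sample n D)"
      by (subst nn_integral_add, measurable) (subst nn_integral_sum, auto simp: nn_integral_cmult)
    also have "\<dots> \<le> (\<integral>\<^sup>+\<omega>. 2 \<partial>sample n D)"
    proof (rule nn_integral_mono)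
      fix \<omega>
      show "?I \<omega> * ennreal (1 - W (design \<omega>)) + (\<Sum>i<d. 2 * (?I \<omega> * ennreal (w (design \<omega>) i))) \<le> 2"
      proof (cases "G (design \<omega>)")
        case True
        have "(\<Sum>i<d. ennreal (w (design \<omega>) i)) = ennreal (W (design \<omega>))" unfolding W_def using w0 by (intro sum_ennreal) auto
        hence "?I \<omega> * ennreal (1 - W (design \<omega>)) + (\<Sum>i<d. 2 * (?I \<omega> * ennreal (w (design \<omega>) i)))
            = ennreal (1 - W (design \<omega>)) + ennreal 2 * ennreal (W (design \<omega>))"
          using True by (simp add: sum_distrib_left[symmetric])
        also have "\<dots> = ennreal ((1 - W (design \<omega>)) + 2 * W (design \<omega>))"
        proof -
          have "0 \<le> 1 - W (design \<omega>)" "0 \<le> W (design \<omega>)" using w0 w1[OF True] by (auto simp: W_def sum_nonneg)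
          thus ?thesis by (subst ennreal_plus) (auto simp: ennreal_mult)
        qed
        also have "\<dots> \<le> ennreal 2" using w1[OF True] by (intro ennreal_leI) (simp add: W_def)
        finally show ?thesis by simp
      qed simp
    qed
    also have "\<dots> = 2" by (simp add: S.emeasure_space_1)
    finally show ?thesis .
  qed
  let ?E = "{\<omega>\<in>space (sample n D). G (design \<omega>) \<and> 4 * sy\<^sup>2 * \<tau> * L < ?Q \<omega>}"
  have "emeasure (sample n D) ?E = (\<integral>\<^sup>+\<omega>. indicator ?E \<omega> \<partial>sample n D)" by simp
  also have "\<dots> \<le> (\<integral>\<^sup>+\<omega>. ennreal (exp (- L)) * (?I \<omega> * ennreal (exp (a / \<tau> * ?Q \<omega>))) \<partial>sample n D)"
  proof (rule nn_integral_mono)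
    fix \<omega>
    have "1 \<le> exp (- L) * exp (a / \<tau> * ?Q \<omega>)" if "4 * sy\<^sup>2 * \<tau> * L < ?Q \<omega>"
    proof -
      have "a / \<tau> * (4 * sy\<^sup>2 * \<tau> * L) \<le> a / \<tau> * ?Q \<omega>" using that a \<tau> by (intro mult_left_mono) auto
      hence "L \<le> a / \<tau> * ?Q \<omega>" using \<tau> sy_pos by (simp add: a_def)
      thus ?thesis by (simp flip: exp_add)
    qed
    thus "indicator ?E \<omega> \<le> ennreal (exp (- L)) * (?I \<omega> * ennreal (exp (a / \<tau> * ?Q \<omega>)))"
      by (auto simp: indicator_def ennreal_mult[symmetric])
  qed
  also have "\<dots> = ennreal (exp (- L)) * (\<integral>\<^sup>+\<omega>. ?I \<omega> * ennreal (exp (a / \<tau> * ?Q \<omega>)) \<partial>sample n D)"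
    by (rule nn_integral_cmult) measurable
  also have "\<dots> \<le> ennreal (exp (- L)) * 2" by (intro mult_left_mono total) auto
  also have "\<dots> = ennreal (2 * exp (- L))" by (simp add: ennreal_mult mult.commute)
  finally show ?thesis by (simp add: S.emeasure_eq_measure)
qed

end

section \<open>Good designs have high probability\<close>

context regression
begin

abbreviation "mgf_const \<equiv> 128 * exp 2 * sx ^ 4"

lemma column_bernstein:
  assumes u: "ip n u u \<le> 1" and \<tau>: "0 \<le> \<tau>" "\<And>l. l \<in> {k..<p} \<Longrightarrow> \<tau> * lam l \<le> 1 / (8 * sx\<^sup>2)"
  shows "S.prob {\<omega>\<in>space (sample n D). t < \<bar>\<Sum>l\<in>{k..<p}. lam l * ((\<Sum>j<n. u j * white l (\<omega> j))\<^sup>2 - ip n u u)\<bar>}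
    \<le> 2 * exp (- \<tau> * t + mgf_const * \<tau>\<^sup>2 * (\<Sum>l\<in>{k..<p}. (lam l)\<^sup>2))"
proof (rule S.bernstein[where ?t0.0 = "1 / (8 * sx\<^sup>2)"])
  show "S.indep_vars (\<lambda>_. borel) (\<lambda>l \<omega>. (\<Sum>j<n. u j * white l (\<omega> j))\<^sup>2 - ip n u u) {k..<p}"
    by (rule S.indep_vars_compose2[OF S.indep_vars_subset[OF indep_columns]]) auto
  show "\<bar>\<tau> * lam l\<bar> \<le> 1 / (8 * sx\<^sup>2)" if "l \<in> {k..<p}" for l
    using \<tau> that lam_pos[of l] by (simp add: abs_mult)
  show "(\<integral>\<^sup>+\<omega>. ennreal (exp (t * ((\<Sum>j<n. u j * white l (\<omega> j))\<^sup>2 - ip n u u))) \<partial>sample n D) \<le> ennreal (exp (mgf_const * t\<^sup>2))"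
    if "l \<in> {k..<p}" "\<bar>t\<bar> \<le> 1 / (8 * sx\<^sup>2)" for l t
    using that by (intro S.subgaussian_square_centered[OF column_subgaussian sx_pos] column_second_moment u) auto
qed (use \<tau> in auto)

lemma row_bernstein:
  assumes u: "ip p u u \<le> 1" and \<tau>: "0 \<le> \<tau>" "\<tau> \<le> 1 / (8 * sx\<^sup>2)"
  shows "S.prob {\<omega>\<in>space (sample n D). t < \<bar>\<Sum>j<n. 1 * ((\<Sum>i<p. u i * white i (\<omega> j))\<^sup>2 - ip p u u)\<bar>}
    \<le> 2 * exp (- \<tau> * t + mgf_const * \<tau>\<^sup>2 * real n)"
proof -
  have "S.prob {\<omega>\<in>space (sample n D). t < \<bar>\<Sum>j<n. 1 * ((\<Sum>i<p. u i * white i (\<omega> j))\<^sup>2 - ip p u u)\<bar>}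
    \<le> 2 * exp (- \<tau> * t + mgf_const * \<tau>\<^sup>2 * (\<Sum>j<n. 1\<^sup>2))"
  proof (rule S.bernstein[where ?t0.0 = "1 / (8 * sx\<^sup>2)"])
    show "S.indep_vars (\<lambda>_. borel) (\<lambda>j \<omega>. (\<Sum>i<p. u i * white i (\<omega> j))\<^sup>2 - ip p u u) {..<n}"
      by (rule indep_rows_fun[of "\<lambda>j z. (\<Sum>i<p. u i * white i z)\<^sup>2 - ip p u u"]) measurable
    show "(\<integral>\<^sup>+\<omega>. ennreal (exp (t * ((\<Sum>i<p. u i * white i (\<omega> j))\<^sup>2 - ip p u u))) \<partial>sample n D) \<le> ennreal (exp (mgf_const * t\<^sup>2))"
      if "j \<in> {..<n}" "\<bar>t\<bar> \<le> 1 / (8 * sx\<^sup>2)" for j t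
      using that by (intro S.subgaussian_square_centered[OF row_subgaussian sx_pos] row_second_moment u) auto
  qed (use \<tau> in auto)
  thus ?thesis by simp
qed

text \<open>The weighted trace of the tail is a single number, so one sum over all independent tail
  entries with weights \<open>(lam l)^2\<close> suffices and no net is involved.\<close>

lemma entry_bernstein:
  assumes \<tau>: "0 \<le> \<tau>" "\<And>l. l \<in> {k..<p} \<Longrightarrow> \<tau> * (lam l)\<^sup>2 \<le> 1 / (8 * sx\<^sup>2)"
  shows "S.prob {\<omega>\<in>space (sample n D). t < \<bar>\<Sum>a\<in>{..<n} \<times> {k..<p}. (lam (snd a))\<^sup>2 * ((white (snd a) (\<omega> (fst a)))\<^sup>2 - 1)\<bar>}
    \<le> 2 * exp (- \<tau> * t + mgf_const * \<tau>\<^sup>2 * (real n * (\<Sum>l\<in>{k..<p}. (lam l) ^ 4)))"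
proof -
  have "S.prob {\<omega>\<in>space (sample n D). t < \<bar>\<Sum>a\<in>{..<n} \<times> {k..<p}. (lam (snd a))\<^sup>2 * ((white (snd a) (\<omega> (fst a)))\<^sup>2 - 1)\<bar>}
    \<le> 2 * exp (- \<tau> * t + mgf_const * \<tau>\<^sup>2 * (\<Sum>a\<in>{..<n} \<times> {k..<p}. ((lam (snd a))\<^sup>2)\<^sup>2))"
  proof (rule S.bernstein[where ?t0.0 = "1 / (8 * sx\<^sup>2)"])
    have "S.indep_vars (\<lambda>_. borel) (\<lambda>(j, i) \<omega>. white i (\<omega> j)) ({..<n} \<times> {k..<p})"
      by (rule S.indep_vars_subset[OF indep_entries]) auto
    hence "S.indep_vars (\<lambda>_. borel) (\<lambda>a \<omega>. (\<lambda>_ y. y\<^sup>2 - 1) a ((case a of (j, i) \<Rightarrow> \<lambda>\<omega>. white i (\<omega> j)) \<omega>)) ({..<n} \<times> {k..<p})"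
      by (rule S.indep_vars_compose2) measurable
    thus "S.indep_vars (\<lambda>_. borel) (\<lambda>a \<omega>. (white (snd a) (\<omega> (fst a)))\<^sup>2 - 1) ({..<n} \<times> {k..<p})"
      by (simp add: case_prod_beta')
    show "\<bar>\<tau> * (lam (snd a))\<^sup>2\<bar> \<le> 1 / (8 * sx\<^sup>2)" if "a \<in> {..<n} \<times> {k..<p}" for a
      using \<tau> that by (auto simp: abs_mult)
    fix a t assume a: "a \<in> {..<n} \<times> {k..<p}" and t: "\<bar>t\<bar> \<le> 1 / (8 * sx\<^sup>2)"
    define u where "u i = (if i = snd a then 1 else 0 :: real)" for i
    have sum: "(\<Sum>i<p. u i * f i) = f (snd a)" for f :: "nat \<Rightarrow> real"
    proof -
      have "(\<Sum>i<p. u i * f i) = (\<Sum>i<p. if i = snd a then f i else 0)" by (intro sum.cong) (auto simp: u_def)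
      thus ?thesis using a by auto
    qed
    have u1: "ip p u u = 1" unfolding ip_def sum by (simp add: u_def)
    have "(\<integral>\<^sup>+\<omega>. ennreal (exp (t * ((\<Sum>i<p. u i * white i (\<omega> (fst a)))\<^sup>2 - 1))) \<partial>sample n D) \<le> ennreal (exp (mgf_const * t\<^sup>2))"
      using a t row_second_moment[of "fst a" u] by (intro S.subgaussian_square_centered[OF row_subgaussian sx_pos]) (auto simp: u1)
    thus "(\<integral>\<^sup>+\<omega>. ennreal (exp (t * ((white (snd a) (\<omega> (fst a)))\<^sup>2 - 1))) \<partial>sample n D) \<le> ennreal (exp (mgf_const * t\<^sup>2))"
      by (simp only: sum)
  qed (use \<tau> in auto)
  moreover have "(\<Sum>a\<in>{..<n} \<times> {k..<p}. ((lam (snd a))\<^sup>2)\<^sup>2) = real n * (\<Sum>l\<in>{k..<p}. (lam l) ^ 4)"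
  proof -
    have "(\<Sum>a\<in>{..<n} \<times> {k..<p}. ((lam (snd a))\<^sup>2)\<^sup>2) = (\<Sum>j<n. \<Sum>l\<in>{k..<p}. (lam l) ^ 4)"
      unfolding sum.cartesian_product by (intro sum.cong) (auto simp flip: power_mult)
    thus ?thesis by simp
  qed
  ultimately show ?thesis by simp
qed

lemma noise_bernstein:
  assumes \<tau>: "0 \<le> \<tau>" "\<tau> \<le> 1 / (8 * sy\<^sup>2)"
  shows "S.prob {\<omega>\<in>space (sample n D). t < \<bar>ip n (noises \<omega>) (noises \<omega>) - real n * sig\<^sup>2\<bar>}
    \<le> 2 * exp (- \<tau> * t + 128 * exp 2 * sy ^ 4 * \<tau>\<^sup>2 * real n)"
proof -
  have "S.prob {\<omega>\<in>space (sample n D). t < \<bar>\<Sum>j<n. 1 * ((noise p th (\<omega> j))\<^sup>2 - sig\<^sup>2)\<bar>}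
    \<le> 2 * exp (- \<tau> * t + 128 * exp 2 * sy ^ 4 * \<tau>\<^sup>2 * (\<Sum>j<n. 1\<^sup>2))"
  proof (rule S.bernstein[where ?t0.0 = "1 / (8 * sy\<^sup>2)"])
    show "S.indep_vars (\<lambda>_. borel) (\<lambda>j \<omega>. (noise p th (\<omega> j))\<^sup>2 - sig\<^sup>2) {..<n}"
      by (rule indep_rows_fun[of "\<lambda>j z. (noise p th z)\<^sup>2 - sig\<^sup>2"]) measurable
    fix j t assume j: "j \<in> {..<n}" and t: "\<bar>t\<bar> \<le> 1 / (8 * sy\<^sup>2)"
    have "(\<integral>\<^sup>+\<omega>. ennreal (exp (t * ((noise p th (\<omega> j))\<^sup>2 - sig\<^sup>2))) \<partial>sample n D) = (\<integral>\<^sup>+z. ennreal (exp (t * ((noise p th z)\<^sup>2 - sig\<^sup>2))) \<partial>D)"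
      using j by (intro nn_integral_row[of "\<lambda>z. ennreal (exp (t * ((noise p th z)\<^sup>2 - sig\<^sup>2)))"]) auto
    also have "\<dots> \<le> ennreal (exp (128 * exp 2 * sy ^ 4 * t\<^sup>2))"
      by (rule D.subgaussian_square_centered[OF noise_subgaussian sy_pos noise_variance t])
    finally show "(\<integral>\<^sup>+\<omega>. ennreal (exp (t * ((noise p th (\<omega> j))\<^sup>2 - sig\<^sup>2))) \<partial>sample n D) \<le> ennreal (exp (128 * exp 2 * sy ^ 4 * t\<^sup>2))" .
  qed (use \<tau> in auto)
  moreover have "(\<Sum>j<n. 1 * ((noise p th (\<omega> j))\<^sup>2 - sig\<^sup>2)) = ip n (noises \<omega>) (noises \<omega>) - real n * sig\<^sup>2" for \<omega>
    by (simp add: ip_self noises_def sum_subtractf)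
  ultimately show ?thesis by simp
qed

text \<open>Testing only finitely many net points makes this a measurable condition on the design;
  the net argument recovers the full quadratic form at twice the threshold.\<close>

definition tail_ok :: "nat \<Rightarrow> real \<Rightarrow> (nat \<Rightarrow> nat \<Rightarrow> real) \<Rightarrow> bool" where
  "tail_ok k t x \<longleftrightarrow> (\<forall>v\<in>ball_net n. \<bar>\<Sum>l\<in>{k..<p}. lam l * ((\<Sum>j<n. v j * (x j l / sqrt (lam l)))\<^sup>2 - ip n v v)\<bar> \<le> t)"

definition head_ok :: "nat \<Rightarrow> (nat \<Rightarrow> nat \<Rightarrow> real) \<Rightarrow> bool" where
  "head_ok k x \<longleftrightarrow> (\<forall>v\<in>ball_net k. \<bar>\<Sum>j<n. 1 * ((\<Sum>i<k. v i * (x j i / sqrt (lam i)))\<^sup>2 - ip k v v)\<bar> \<le> real n / 4)"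

definition trace_ok :: "nat \<Rightarrow> (nat \<Rightarrow> nat \<Rightarrow> real) \<Rightarrow> bool" where
  "trace_ok k x \<longleftrightarrow> (\<Sum>i\<in>{k..<p}. lam i * (\<Sum>j<n. (x j i)\<^sup>2)) \<le> 2 * real n * (\<Sum>i\<in>{k..<p}. (lam i)\<^sup>2)"

definition vec_ok :: "nat \<Rightarrow> (nat \<Rightarrow> real) \<Rightarrow> (nat \<Rightarrow> nat \<Rightarrow> real) \<Rightarrow> bool" where
  "vec_ok k v x \<longleftrightarrow> (\<Sum>j<n. (\<Sum>i\<in>{k..<p}. x j i * v i)\<^sup>2) \<le> 2 * real n * (\<Sum>i\<in>{k..<p}. lam i * (v i)\<^sup>2)"

lemma measurable_ok [measurable]:
  shows "Measurable.pred designs (tail_ok k t)" and "k \<le> p \<Longrightarrow> Measurable.pred designs (head_ok k)"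
    and "Measurable.pred designs (trace_ok k)" and "Measurable.pred designs (vec_ok k v)"
proof -
  show "Measurable.pred designs (tail_ok k t)" unfolding tail_ok_def
    by (intro pred_intros_finite finite_ball_net) measurable
  show "Measurable.pred designs (head_ok k)" if "k \<le> p" unfolding head_ok_def using that
    by (intro pred_intros_finite finite_ball_net) measurable
  show "Measurable.pred designs (trace_ok k)" unfolding trace_ok_def by measurable
  show "Measurable.pred designs (vec_ok k v)" unfolding vec_ok_def by measurable
qed

lemma design_white: "j < n \<Longrightarrow> design \<omega> j i / sqrt (lam i) = white i (\<omega> j)"
  by (simp add: design_def white_def)

lemma net_union_bound:
  assumes meas: "\<And>v. v \<in> ball_net d \<Longrightarrow> {\<omega>\<in>space (sample n D). P v \<omega>} \<in> sets (sample n D)"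
    and le: "\<And>v. v \<in> ball_net d \<Longrightarrow> S.prob {\<omega>\<in>space (sample n D). P v \<omega>} \<le> q"
  shows "S.prob {\<omega>\<in>space (sample n D). \<exists>v\<in>ball_net d. P v \<omega>} \<le> (3 * 2 ^ 16) ^ d * q"
proof -
  obtain v where "v \<in> ball_net d" using ball_net_dense[of d "\<lambda>_. 0"] by (auto simp: ip_def)
  hence q0: "0 \<le> q" using order_trans[OF measure_nonneg le] by blast
  have "{\<omega>\<in>space (sample n D). \<exists>v\<in>ball_net d. P v \<omega>} = (\<Union>v\<in>ball_net d. {\<omega>\<in>space (sample n D). P v \<omega>})" by auto
  also have "S.prob \<dots> \<le> (\<Sum>v\<in>ball_net d. S.prob {\<omega>\<in>space (sample n D). P v \<omega>})"
    by (rule S.finite_measure_subadditive_finite) (use meas in \<open>auto simp: finite_ball_net\<close>)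
  also have "\<dots> \<le> (\<Sum>v\<in>ball_net d. q)" by (rule sum_mono) (rule le)
  also have "\<dots> = real (card (ball_net d)) * q" by simp
  also have "\<dots> \<le> (3 * 2 ^ 16) ^ d * q" by (rule mult_right_mono[OF card_ball_net q0])
  finally show ?thesis .
qed

lemma prob_not_tail_ok:
  assumes \<tau>: "0 \<le> \<tau>" "\<And>l. l \<in> {k..<p} \<Longrightarrow> \<tau> * lam l \<le> 1 / (8 * sx\<^sup>2)"
  shows "S.prob {\<omega>\<in>space (sample n D). \<not> tail_ok k t (design \<omega>)}
    \<le> (3 * 2 ^ 16) ^ n * (2 * exp (- \<tau> * t + mgf_const * \<tau>\<^sup>2 * (\<Sum>l\<in>{k..<p}. (lam l)\<^sup>2)))"
proof -
  have "{\<omega>\<in>space (sample n D). \<not> tail_ok k t (design \<omega>)} =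
    {\<omega>\<in>space (sample n D). \<exists>v\<in>ball_net n. t < \<bar>\<Sum>l\<in>{k..<p}. lam l * ((\<Sum>j<n. v j * white l (\<omega> j))\<^sup>2 - ip n v v)\<bar>}"
    by (simp add: tail_ok_def design_white not_le)
  also have "S.prob \<dots> \<le> (3 * 2 ^ 16) ^ n * (2 * exp (- \<tau> * t + mgf_const * \<tau>\<^sup>2 * (\<Sum>l\<in>{k..<p}. (lam l)\<^sup>2)))"
  proof (rule net_union_bound)
    fix v assume "v \<in> ball_net n"
    thus "S.prob {\<omega>\<in>space (sample n D). t < \<bar>\<Sum>l\<in>{k..<p}. lam l * ((\<Sum>j<n. v j * white l (\<omega> j))\<^sup>2 - ip n v v)\<bar>}
      \<le> 2 * exp (- \<tau> * t + mgf_const * \<tau>\<^sup>2 * (\<Sum>l\<in>{k..<p}. (lam l)\<^sup>2))"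
      by (intro column_bernstein ball_net_norm_le \<tau>)
  qed measurable
  finally show ?thesis .
qed

text \<open>Head vectors are extended by zero to \<open>p\<close> coordinates so that the row bound
  applies, while the union bound runs over a net of dimension \<open>k\<close> only.\<close>

lemma prob_not_head_ok:
  assumes k: "k \<le> p" and \<tau>: "0 \<le> \<tau>" "\<tau> \<le> 1 / (8 * sx\<^sup>2)"
  shows "S.prob {\<omega>\<in>space (sample n D). \<not> head_ok k (design \<omega>)}
    \<le> (3 * 2 ^ 16) ^ k * (2 * exp (- \<tau> * (real n / 4) + mgf_const * \<tau>\<^sup>2 * real n))"
proof -
  define e where "e v i = (if i < k then v i else 0 :: real)" for v i
  have e1: "(\<Sum>i<p. e v i * f i) = (\<Sum>i<k. v i * f i)" for v f
  proof -
    have "(\<Sum>i<p. e v i * f i) = (\<Sum>i<k. e v i * f i) + (\<Sum>i\<in>{k..<p}. e v i * f i)" by (rule sum_lessThan_split[OF k])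
    thus ?thesis by (simp add: e_def)
  qed
  have e2: "ip p (e v) (e v) = ip k v v" for v
    unfolding ip_def e1 by (intro sum.cong) (auto simp: e_def)
  have "{\<omega>\<in>space (sample n D). \<not> head_ok k (design \<omega>)} =
    {\<omega>\<in>space (sample n D). \<exists>v\<in>ball_net k. real n / 4 < \<bar>\<Sum>j<n. 1 * ((\<Sum>i<p. e v i * white i (\<omega> j))\<^sup>2 - ip p (e v) (e v))\<bar>}"
    by (simp add: head_ok_def design_white not_le e1 e2)
  also have "S.prob \<dots> \<le> (3 * 2 ^ 16) ^ k * (2 * exp (- \<tau> * (real n / 4) + mgf_const * \<tau>\<^sup>2 * real n))"
  proof (rule net_union_bound)
    fix v assume "v \<in> ball_net k"
    hence "ip p (e v) (e v) \<le> 1" unfolding e2 by (rule ball_net_norm_le)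
    thus "S.prob {\<omega>\<in>space (sample n D). real n / 4 < \<bar>\<Sum>j<n. 1 * ((\<Sum>i<p. e v i * white i (\<omega> j))\<^sup>2 - ip p (e v) (e v))\<bar>}
      \<le> 2 * exp (- \<tau> * (real n / 4) + mgf_const * \<tau>\<^sup>2 * real n)"
      by (rule row_bernstein[OF _ \<tau>])
  qed measurable
  finally show ?thesis .
qed

text \<open>For one fixed vector no net is required: its whitened tail, normalised, has norm at most
  1, and failure means that its empirical second moment exceeds the mean by more than
  \<open>n\<close>. A vanishing tail satisfies the condition trivially.\<close>

lemma prob_not_vec_ok:
  assumes k: "k \<le> p" and \<tau>: "0 \<le> \<tau>" "\<tau> \<le> 1 / (8 * sx\<^sup>2)"
  shows "S.prob {\<omega>\<in>space (sample n D). \<not> vec_ok k v (design \<omega>)} \<le> 2 * exp (- \<tau> * real n + mgf_const * \<tau>\<^sup>2 * real n)"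
proof -
  define W where "W = (\<Sum>i\<in>{k..<p}. lam i * (v i)\<^sup>2)"
  have W0: "0 \<le> W" unfolding W_def using lam_pos by (auto intro!: sum_nonneg simp: less_imp_le)
  define u where "u i = (if k \<le> i then sqrt (lam i) * v i / sqrt W else 0)" for i
  have split: "(\<Sum>i<p. u i * f i) = (\<Sum>i\<in>{k..<p}. sqrt (lam i) * v i / sqrt W * f i)" for f
  proof -
    have "(\<Sum>i<p. u i * f i) = (\<Sum>i<k. u i * f i) + (\<Sum>i\<in>{k..<p}. u i * f i)" by (rule sum_lessThan_split[OF k])
    thus ?thesis by (simp add: u_def)
  qed
  have x_eq: "(\<Sum>i\<in>{k..<p}. design \<omega> j i * v i) = sqrt W * (\<Sum>i<p. u i * white i (\<omega> j))" if "j < n" "W \<noteq> 0" for \<omega> j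
    unfolding split sum_distrib_left using that lam_pos
    by (intro sum.cong refl) (auto simp: white_def design_def less_imp_neq[symmetric])
  have uu: "ip p u u \<le> 1"
  proof -
    have "ip p u u = (\<Sum>i\<in>{k..<p}. lam i * (v i)\<^sup>2 / W)"
      unfolding ip_def split using W0 lam_pos
      by (intro sum.cong refl) (auto simp: u_def power2_eq_square less_imp_le mult_ac)
    also have "\<dots> = W / W" by (simp add: W_def sum_divide_distrib[symmetric])
    finally show ?thesis by simp
  qed
  have "{\<omega>\<in>space (sample n D). \<not> vec_ok k v (design \<omega>)} \<subseteq>
    {\<omega>\<in>space (sample n D). real n < \<bar>\<Sum>j<n. 1 * ((\<Sum>i<p. u i * white i (\<omega> j))\<^sup>2 - ip p u u)\<bar>}"
  proof safe
    fix \<omega> assume bad: "\<not> vec_ok k v (design \<omega>)"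
    have "W \<noteq> 0"
    proof
      assume "W = 0"
      hence "\<forall>i\<in>{k..<p}. lam i * (v i)\<^sup>2 = 0"
        unfolding W_def using lam_pos by (subst (asm) sum_nonneg_eq_0_iff) (auto simp: less_imp_le)
      hence "\<forall>i\<in>{k..<p}. v i = 0" using lam_pos by (auto simp: less_imp_neq[symmetric])
      thus False using bad by (simp add: vec_ok_def)
    qed
    hence "2 * real n * W < (\<Sum>j<n. W * (\<Sum>i<p. u i * white i (\<omega> j))\<^sup>2)"
      using bad W0 by (simp add: vec_ok_def W_def[symmetric] x_eq power_mult_distrib not_le)
    hence "W * (2 * real n) < W * (\<Sum>j<n. (\<Sum>i<p. u i * white i (\<omega> j))\<^sup>2)" by (simp add: sum_distrib_left mult_ac)
    hence "2 * real n < (\<Sum>j<n. (\<Sum>i<p. u i * white i (\<omega> j))\<^sup>2)" using W0 \<open>W \<noteq> 0\<close> by (simp add: mult_less_cancel_left)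
    moreover have "real n * ip p u u \<le> real n" using uu mult_left_mono[OF uu, of "real n"] by simp
    ultimately show "real n < \<bar>\<Sum>j<n. 1 * ((\<Sum>i<p. u i * white i (\<omega> j))\<^sup>2 - ip p u u)\<bar>"
      by (simp add: sum_subtractf)
  qed
  hence "S.prob {\<omega>\<in>space (sample n D). \<not> vec_ok k v (design \<omega>)} \<le>
    S.prob {\<omega>\<in>space (sample n D). real n < \<bar>\<Sum>j<n. 1 * ((\<Sum>i<p. u i * white i (\<omega> j))\<^sup>2 - ip p u u)\<bar>}"
    by (intro S.finite_measure_mono) measurable
  also have "\<dots> \<le> 2 * exp (- \<tau> * real n + mgf_const * \<tau>\<^sup>2 * real n)" by (rule row_bernstein[OF uu \<tau>])
  finally show ?thesis .
qed

text \<open>Dividing the free exponent by \<open>(lam k)^2\<close> meets the range restriction at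
  the largest weight. Since \<open>W >= (lam k)^2\<close>, the resulting exponent is at least as
  good as for \<open>n\<close> unit weights; \<open>neg\<close> fixes the sign needed in that
  comparison.\<close>

lemma prob_not_trace_ok:
  assumes k: "k < p" and \<tau>: "0 \<le> \<tau>" "\<tau> \<le> 1 / (8 * sx\<^sup>2)" and neg: "mgf_const * \<tau>\<^sup>2 \<le> \<tau>"
  shows "S.prob {\<omega>\<in>space (sample n D). \<not> trace_ok k (design \<omega>)} \<le> 2 * exp (- \<tau> * real n + mgf_const * \<tau>\<^sup>2 * real n)"
proof -
  let ?T = "{k..<p}"
  define W where "W = (\<Sum>i\<in>?T. (lam i)\<^sup>2)"
  have lk: "lam k > 0" using lam_pos[OF k] .
  have le: "0 < lam i" "lam i \<le> lam k" if "i \<in> ?T" for i using that lam_pos lam_antimono by auto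
  have Wk: "(lam k)\<^sup>2 \<le> W" unfolding W_def using k by (intro member_le_sum) auto
  have "{\<omega>\<in>space (sample n D). \<not> trace_ok k (design \<omega>)} \<subseteq>
     {\<omega>\<in>space (sample n D). real n * W < \<bar>\<Sum>a\<in>{..<n} \<times> ?T. (lam (snd a))\<^sup>2 * ((white (snd a) (\<omega> (fst a)))\<^sup>2 - 1)\<bar>}"
  proof safe
    fix \<omega> assume bad: "\<not> trace_ok k (design \<omega>)"
    have eq: "lam i * (design \<omega> j i)\<^sup>2 = (lam i)\<^sup>2 * (white i (\<omega> j))\<^sup>2" if "i \<in> ?T" "j < n" for i j
      using le[OF that(1)] that by (simp add: white_def design_def power_divide power2_eq_square)
    have "(\<Sum>a\<in>{..<n} \<times> ?T. (lam (snd a))\<^sup>2 * ((white (snd a) (\<omega> (fst a)))\<^sup>2 - 1))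
      = (\<Sum>j<n. \<Sum>i\<in>?T. (lam i)\<^sup>2 * ((white i (\<omega> j))\<^sup>2 - 1))" by (simp add: sum.cartesian_product case_prod_beta')
    also have "\<dots> = (\<Sum>j<n. (\<Sum>i\<in>?T. lam i * (design \<omega> j i)\<^sup>2) - W)"
      by (intro sum.cong refl) (simp add: W_def eq right_diff_distrib sum_subtractf)
    also have "\<dots> = (\<Sum>i\<in>?T. \<Sum>j<n. lam i * (design \<omega> j i)\<^sup>2) - real n * W"
      by (simp add: sum_subtractf sum.swap[of _ ?T])
    also have "\<dots> > real n * W" using bad by (simp add: trace_ok_def not_le W_def sum_distrib_left mult.assoc)
    finally show "real n * W < \<bar>\<Sum>a\<in>{..<n} \<times> ?T. (lam (snd a))\<^sup>2 * ((white (snd a) (\<omega> (fst a)))\<^sup>2 - 1)\<bar>" by linarith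
  qed
  hence "S.prob {\<omega>\<in>space (sample n D). \<not> trace_ok k (design \<omega>)} \<le>
     S.prob {\<omega>\<in>space (sample n D). real n * W < \<bar>\<Sum>a\<in>{..<n} \<times> ?T. (lam (snd a))\<^sup>2 * ((white (snd a) (\<omega> (fst a)))\<^sup>2 - 1)\<bar>}"
  proof (rule S.finite_measure_mono)
    have [measurable]: "(\<lambda>\<omega>. white (snd a) (\<omega> (fst a))) \<in> borel_measurable (sample n D)" if "a \<in> {..<n} \<times> ?T" for a
      using that by (intro measurable_compose[OF measurable_row measurable_white]) auto
    show "{\<omega>\<in>space (sample n D). real n * W < \<bar>\<Sum>a\<in>{..<n} \<times> ?T. (lam (snd a))\<^sup>2 * ((white (snd a) (\<omega> (fst a)))\<^sup>2 - 1)\<bar>}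
      \<in> sets (sample n D)" by measurable
  qed
  also have "\<dots> \<le> 2 * exp (- (\<tau> / (lam k)\<^sup>2) * (real n * W) + mgf_const * (\<tau> / (lam k)\<^sup>2)\<^sup>2 * (real n * (\<Sum>l\<in>?T. (lam l) ^ 4)))"
  proof (rule entry_bernstein)
    show "0 \<le> \<tau> / (lam k)\<^sup>2" using \<tau> by simp
    fix l assume "l \<in> ?T"
    hence "(lam l)\<^sup>2 \<le> (lam k)\<^sup>2" using le by (intro power_mono) (auto simp: less_imp_le)
    hence "\<tau> / (lam k)\<^sup>2 * (lam l)\<^sup>2 \<le> \<tau> / (lam k)\<^sup>2 * (lam k)\<^sup>2" using \<tau> by (intro mult_left_mono) auto
    also have "\<dots> = \<tau>" using lk by simp
    finally show "\<tau> / (lam k)\<^sup>2 * (lam l)\<^sup>2 \<le> 1 / (8 * sx\<^sup>2)" using \<tau> by linarith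
  qed
  also have "\<dots> \<le> 2 * exp (- \<tau> * real n + mgf_const * \<tau>\<^sup>2 * real n)"
  proof -
    have "(\<Sum>l\<in>?T. (lam l) ^ 4) \<le> (\<Sum>l\<in>?T. (lam k)\<^sup>2 * (lam l)\<^sup>2)"
    proof (rule sum_mono)
      fix l assume "l \<in> ?T"
      hence "(lam l)\<^sup>2 \<le> (lam k)\<^sup>2" using le by (intro power_mono) (auto simp: less_imp_le)
      from mult_right_mono[OF this, of "(lam l)\<^sup>2"] show "(lam l) ^ 4 \<le> (lam k)\<^sup>2 * (lam l)\<^sup>2"
        by (simp flip: power_add)
    qed
    also have "\<dots> = (lam k)\<^sup>2 * W" by (simp add: W_def sum_distrib_left)
    finally have "mgf_const * (\<tau> / (lam k)\<^sup>2)\<^sup>2 * (real n * (\<Sum>l\<in>?T. (lam l) ^ 4)) \<le> mgf_const * (\<tau> / (lam k)\<^sup>2)\<^sup>2 * (real n * ((lam k)\<^sup>2 * W))"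
      by (intro mult_left_mono) auto
    also have "\<dots> = mgf_const * \<tau>\<^sup>2 * real n * (W / (lam k)\<^sup>2)"
      using lk by (simp add: power_divide power2_eq_square)
    finally have "- (\<tau> / (lam k)\<^sup>2) * (real n * W) + mgf_const * (\<tau> / (lam k)\<^sup>2)\<^sup>2 * (real n * (\<Sum>l\<in>?T. (lam l) ^ 4))
      \<le> - (real n * (\<tau> - mgf_const * \<tau>\<^sup>2) * (W / (lam k)\<^sup>2))" by (simp add: algebra_simps)
    also have "\<dots> \<le> - (real n * (\<tau> - mgf_const * \<tau>\<^sup>2) * 1)"
    proof -
      have "1 \<le> W / (lam k)\<^sup>2" using Wk lk by simp
      thus ?thesis using neg by (intro le_imp_neg_le mult_left_mono) auto
    qed
    finally show ?thesis by (simp add: algebra_simps)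
  qed
  finally show ?thesis .
qed

text \<open>Each threshold doubles in passing from the net to all vectors: \<open>t\<close> becomes
  the relative deviation \<open>2 * t / s\<close>, and \<open>n / 4\<close> becomes
  \<open>n / 2\<close> for the head. Substituting \<open>sqrt (lam i) * u i\<close> undoes the
  whitening there.\<close>

lemma good_design_of_ok:
  assumes tail: "tail_ok k t x" and head: "head_ok k x" and k: "k \<le> p"
    and s: "s = (\<Sum>i\<in>{k..<p}. lam i)" "0 < s" and t: "0 \<le> t" "4 * t \<le> s"
    and small: "\<And>i. k \<le> i \<Longrightarrow> i < p \<Longrightarrow> lam i \<le> s / real n"
  shows "good_design n k p lam x s (2 * t / s)"
proof
  show "0 < n" by (rule n_pos)
  show "k \<le> p" by (rule k)
  show "0 < s" by (rule s)
  show "0 \<le> 2 * t / s" using t s by simp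
  show "2 * t / s \<le> 1 / 2" using t s by (simp add: field_simps)
  show "0 < lam i" if "i < p" for i using lam_pos that .
  show "lam i \<le> s / real n" if "k \<le> i" "i < p" for i by (rule small[OF that])
  show "\<bar>(\<Sum>i\<in>{k..<p}. (xT n x m i)\<^sup>2) - s * ip n m m\<bar> \<le> 2 * t / s * s * ip n m m" for m
  proof -
    have "\<bar>\<Sum>l\<in>{k..<p}. lam l * ((\<Sum>j<n. m j * (x j l / sqrt (lam l)))\<^sup>2 - ip n m m)\<bar> \<le> 2 * t * ip n m m"
      by (rule net_quadratic_bound[where z="\<lambda>l j. x j l / sqrt (lam l)"]) (use tail in \<open>auto simp: tail_ok_def\<close>)
    moreover have "lam l * ((\<Sum>j<n. m j * (x j l / sqrt (lam l)))\<^sup>2 - ip n m m) = (xT n x m l)\<^sup>2 - lam l * ip n m m" if "l \<in> {k..<p}" for l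
      using lam_pos[of l] that by (simp add: xT_def sum_divide_distrib[symmetric] power_divide right_diff_distrib)
    ultimately have "\<bar>\<Sum>l\<in>{k..<p}. ((xT n x m l)\<^sup>2 - lam l * ip n m m)\<bar> \<le> 2 * t * ip n m m" by simp
    thus ?thesis using s by (simp add: sum_subtractf sum_distrib_right)
  qed
  have head': "\<bar>(\<Sum>j<n. (ip k (x j) u)\<^sup>2) - real n * (\<Sum>i<k. lam i * (u i)\<^sup>2)\<bar> \<le> real n / 2 * (\<Sum>i<k. lam i * (u i)\<^sup>2)" for u
  proof -
    define v where "v i = sqrt (lam i) * u i" for i
    have "\<bar>\<Sum>j<n. 1 * ((\<Sum>i<k. v i * (x j i / sqrt (lam i)))\<^sup>2 - ip k v v)\<bar> \<le> 2 * (real n / 4) * ip k v v"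
      by (rule net_quadratic_bound[where z="\<lambda>j i. x j i / sqrt (lam i)"]) (use head in \<open>auto simp: head_ok_def\<close>)
    moreover have "(\<Sum>i<k. v i * (x j i / sqrt (lam i))) = ip k (x j) u" for j
      unfolding ip_def v_def using lam_pos k by (intro sum.cong refl) (auto simp: less_imp_neq[symmetric])
    moreover have "ip k v v = (\<Sum>i<k. lam i * (u i)\<^sup>2)"
      unfolding ip_self v_def using lam_pos k by (intro sum.cong refl) (auto simp: power_mult_distrib less_imp_le)
    ultimately show ?thesis by (simp add: sum_subtractf)
  qed
  show "real n / 2 * (\<Sum>i<k. lam i * (u i)\<^sup>2) \<le> (\<Sum>j<n. (ip k (x j) u)\<^sup>2)" for u
    using head'[of u] by linarith
  show "(\<Sum>j<n. (ip k (x j) u)\<^sup>2) \<le> 2 * real n * (\<Sum>i<k. lam i * (u i)\<^sup>2)" for u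
  proof -
    have "0 \<le> real n * (\<Sum>i<k. lam i * (u i)\<^sup>2)"
      using lam_pos k by (auto intro!: mult_nonneg_nonneg sum_nonneg simp: less_imp_le)
    thus ?thesis using head'[of u] by linarith
  qed
qed

end

section \<open>Population risk and tail bounds\<close>

text \<open>\<open>3 * 2^16 <= 2^18 <= exp 18\<close>: the origin of every 18 below.\<close>

lemma net_cardinality_exp: "(3 * 2 ^ 16 :: real) ^ d \<le> exp (18 * real d)"
proof -
  have "(2::real) ^ 18 \<le> (exp 1) ^ 18" using exp_ge_add_one_self[of 1] by (intro power_mono) auto
  hence "3 * 2 ^ 16 \<le> exp (18 :: real)" by (simp add: exp_of_nat_mult[of 18 1, simplified, symmetric])
  hence "(3 * 2 ^ 16 :: real) ^ d \<le> exp 18 ^ d" by (intro power_mono) auto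
  thus ?thesis by (simp add: exp_of_nat_mult[symmetric] mult.commute)
qed

context regression
begin

text \<open>Expanding the square leaves the quadratic form of the covariance and a term linear in
  the cross-moments \<open>c'\<close> of noise and covariates. Minimality of \<open>th\<close> makes
  the risk nonnegative everywhere, which forces those cross-moments to vanish.\<close>

lemma risk_eq: "risk p D th \<theta> = (\<Sum>i<p. lam i * (\<theta> i - th i)\<^sup>2)"
proof -
  define c' where "c' i = D.expectation (\<lambda>z. noise p th z * fst z i)" for i
  have cov: "integrable D (\<lambda>z. fst z i * fst z j)" "D.expectation (\<lambda>z. fst z i * fst z j) = (if i = j then lam i else 0)"
    if "i < p" "j < p" for i j using setting that unfolding setting_def by auto
  have intc: "integrable D (\<lambda>z. noise p th z * fst z i)" if "i < p" for i
  proof (rule Bochner_Integration.integrable_bound)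
    show "integrable D (\<lambda>z. (noise p th z)\<^sup>2 + fst z i * fst z i)" using noise_variance(1) cov(1)[OF that that] by simp
    show "AE z in D. norm (noise p th z * fst z i) \<le> norm ((noise p th z)\<^sup>2 + fst z i * fst z i)"
    proof (rule AE_I2)
      fix z
      have "2 * (\<bar>noise p th z\<bar> * \<bar>fst z i\<bar>) \<le> (noise p th z)\<^sup>2 + (fst z i)\<^sup>2"
        using zero_le_power2[of "\<bar>noise p th z\<bar> - \<bar>fst z i\<bar>"] by (simp add: power2_diff)
      moreover have "0 \<le> \<bar>noise p th z\<bar> * \<bar>fst z i\<bar>" by simp
      ultimately have "\<bar>noise p th z\<bar> * \<bar>fst z i\<bar> \<le> (noise p th z)\<^sup>2 + (fst z i)\<^sup>2" by linarith
      thus "norm (noise p th z * fst z i) \<le> norm ((noise p th z)\<^sup>2 + fst z i * fst z i)"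
        by (simp add: abs_mult power2_eq_square)
    qed
  qed (use that in measurable)
  have main: "risk p D th \<theta> = (\<Sum>i<p. lam i * (\<theta> i - th i)\<^sup>2) - 2 * (\<Sum>i<p. (\<theta> i - th i) * c' i)"
    and sq_int: "integrable D (\<lambda>z. (snd z - ip p (fst z) \<theta>)\<^sup>2)" for \<theta>
  proof -
    define d where "d i = \<theta> i - th i" for i
    define A where "A z = (\<Sum>i<p. \<Sum>j<p. (d i * d j) * (fst z i * fst z j))" for z :: pt
    define B where "B z = (\<Sum>i<p. d i * (noise p th z * fst z i))" for z :: pt
    have A: "(ip p (fst z) d)\<^sup>2 = A z" for z
      by (simp add: A_def ip_def power2_eq_square sum_product mult_ac)
    have B: "noise p th z * ip p (fst z) d = B z" for z
      by (simp add: B_def ip_def sum_distrib_left mult_ac)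
    have "snd z - ip p (fst z) \<theta> = noise p th z - ip p (fst z) d" for z
      by (simp add: noise_def d_def[abs_def] ip_linear)
    hence eq: "(snd z - ip p (fst z) \<theta>)\<^sup>2 = (noise p th z)\<^sup>2 + (A z - 2 * B z)" for z
      by (simp add: power2_diff A B[symmetric] mult.assoc)
    have intA: "integrable D A" unfolding A_def
      by (intro Bochner_Integration.integrable_sum integrable_mult_right cov) auto
    have intB: "integrable D B" unfolding B_def
      by (intro Bochner_Integration.integrable_sum integrable_mult_right intc) auto
    show "integrable D (\<lambda>z. (snd z - ip p (fst z) \<theta>)\<^sup>2)"
      unfolding eq using noise_variance(1) intA intB by simp
    have "D.expectation A = (\<Sum>i<p. \<Sum>j<p. (d i * d j) * D.expectation (\<lambda>z. fst z i * fst z j))"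
      unfolding A_def by (rule integral_quadratic) (rule cov)
    also have "\<dots> = (\<Sum>i<p. \<Sum>j<p. if j = i then lam i * (d i * d j) else 0)"
      by (intro sum.cong refl) (auto simp: cov)
    also have "\<dots> = (\<Sum>i<p. lam i * (d i)\<^sup>2)" by (simp add: power2_eq_square)
    finally have EA: "D.expectation A = (\<Sum>i<p. lam i * (d i)\<^sup>2)" .
    have EB: "D.expectation B = (\<Sum>i<p. d i * c' i)"
      unfolding B_def c'_def by (subst Bochner_Integration.integral_sum) (auto intro: intc)
    have "risk p D th \<theta> = D.expectation (\<lambda>z. A z - 2 * B z)"
      unfolding risk_def eq by (simp add: noise_def)
    also have "\<dots> = D.expectation A - 2 * D.expectation B" using intA intB by simp
    finally show "risk p D th \<theta> = (\<Sum>i<p. lam i * (\<theta> i - th i)\<^sup>2) - 2 * (\<Sum>i<p. (\<theta> i - th i) * c' i)"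
      by (simp add: EA EB d_def)
  qed
  have nonneg: "0 \<le> risk p D th \<theta>" for \<theta>
  proof -
    have "D.expectation (\<lambda>z. (snd z - ip p (fst z) th)\<^sup>2) \<le> D.expectation (\<lambda>z. (snd z - ip p (fst z) \<theta>)\<^sup>2)"
      using setting unfolding setting_def by blast
    thus ?thesis unfolding risk_def using sq_int by simp
  qed
  have "c' i = 0" if i: "i < p" for i
  proof -
    \<comment> \<open>The best shift of coordinate \<open>i\<close>; it would lower the population
      loss by \<open>(c' i)^2 / lam i\<close>.\<close>
    define t where "t = c' i / lam i"
    define \<theta>' where "\<theta>' l = th l + (if l = i then t else 0)" for l
    have "(\<Sum>l<p. lam l * (\<theta>' l - th l)\<^sup>2) = (\<Sum>l<p. if l = i then lam l * t\<^sup>2 else 0)"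
      "(\<Sum>l<p. (\<theta>' l - th l) * c' l) = (\<Sum>l<p. if l = i then t * c' l else 0)"
      by (intro sum.cong; auto simp: \<theta>'_def)+
    hence "risk p D th \<theta>' = lam i * t\<^sup>2 - 2 * (t * c' i)" unfolding main using i by simp
    also have "\<dots> = - ((c' i)\<^sup>2 / lam i)" using lam_pos[OF i] by (simp add: t_def power2_eq_square field_simps)
    finally have "(c' i)\<^sup>2 / lam i \<le> 0" using nonneg[of \<theta>'] by simp
    thus ?thesis using lam_pos[OF i] by (simp add: divide_le_0_iff)
  qed
  thus ?thesis unfolding main by simp
qed

text \<open>From index \<open>p\<close> on the tail sum is empty and \<open>r_tail\<close> is 0,
  which forces \<open>k < p\<close>. Minimality of \<open>k\<close> gives the inequality for the
  head indices, and the defining inequality at \<open>k\<close> the one for the tail.\<close>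

lemma kidx_properties:
  assumes b: "1 \<le> b" and ex: "\<exists>j. b * real n \<le> r_tail p lam j" and k: "k = kidx b n p lam"
  shows "k < p" and "b * real n \<le> r_tail p lam k" and "0 < s_tail p lam k"
    and "\<And>i. i < k \<Longrightarrow> s_tail p lam k \<le> b * real n * lam i"
    and "\<And>i. k \<le> i \<Longrightarrow> i < p \<Longrightarrow> lam i \<le> s_tail p lam k / real n"
proof -
  have n1: "real n > 0" using n_pos by simp
  have bn: "b * real n > 0" using b n1 by simp
  show r: "b * real n \<le> r_tail p lam k" unfolding k kidx_def using ex by (rule LeastI_ex)
  show kp: "k < p"
  proof (rule ccontr)
    assume "\<not> k < p"
    hence "r_tail p lam k = 0" by (simp add: r_tail_def s_tail_def)
    thus False using r bn by simp
  qed
  show s: "0 < s_tail p lam k" unfolding s_tail_def using kp lam_pos by (intro sum_pos) auto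
  show "s_tail p lam k \<le> b * real n * lam i" if "i < k" for i
  proof -
    have "r_tail p lam i < b * real n" using not_less_Least[of i] that unfolding k kidx_def by fastforce
    hence "s_tail p lam i < b * real n * lam i" using lam_pos[of i] that kp by (simp add: r_tail_def field_simps)
    moreover have "s_tail p lam k \<le> s_tail p lam i" unfolding s_tail_def
      using that lam_pos by (intro sum_mono2) (auto simp: less_imp_le)
    ultimately show ?thesis by linarith
  qed
  show "lam i \<le> s_tail p lam k / real n" if "k \<le> i" "i < p" for i
  proof -
    have "1 * real n \<le> b * real n" using b by (intro mult_right_mono) auto
    hence "real n \<le> s_tail p lam k / lam k" using r by (simp add: r_tail_def)
    hence "real n * lam k \<le> s_tail p lam k" using lam_pos[OF kp] by (simp add: field_simps)
    hence "lam k \<le> s_tail p lam k / real n" using n1 by (simp add: field_simps)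
    thus ?thesis using lam_antimono[OF that] by linarith
  qed
qed

text \<open>Head indices satisfy \<open>s / n <= b * lam i\<close>, so
  \<open>(s / n)^2 / lam i <= b * s / n\<close>; tail indices have \<open>lam i <= s / n\<close>
  outright. This is how \<open>b\<close> enters the final constant.\<close>

lemma bias_form_le:
  assumes "1 \<le> b" and kp: "k \<le> p" and s: "0 < s"
    and head: "\<And>i. i < k \<Longrightarrow> s \<le> b * real n * lam i" and tail: "\<And>i. k \<le> i \<Longrightarrow> i < p \<Longrightarrow> lam i \<le> s / real n"
  shows "(s / real n)\<^sup>2 * (\<Sum>i<k. (v i)\<^sup>2 / lam i) + (\<Sum>i\<in>{k..<p}. lam i * (v i)\<^sup>2) \<le> b * (nrm p v)\<^sup>2 * s / real n"
proof -
  have n1: "real n > 0" using n_pos by simp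
  have "(s / real n)\<^sup>2 * (\<Sum>i<k. (v i)\<^sup>2 / lam i) \<le> (\<Sum>i<k. b * s / real n * (v i)\<^sup>2)"
    unfolding sum_distrib_left
  proof (rule sum_mono)
    fix i assume "i \<in> {..<k}"
    hence i: "i < k" "0 < lam i" using lam_pos kp by auto
    have "(s / real n)\<^sup>2 * ((v i)\<^sup>2 / lam i) = s * (s * (v i)\<^sup>2) / ((real n)\<^sup>2 * lam i)" by (simp add: power_divide power2_eq_square)
    also have "\<dots> \<le> (b * real n * lam i) * (s * (v i)\<^sup>2) / ((real n)\<^sup>2 * lam i)"
      using head[OF i(1)] s i by (intro divide_right_mono mult_right_mono) auto
    also have "\<dots> = b * s / real n * (v i)\<^sup>2" using i n1 by (simp add: power2_eq_square)
    finally show "(s / real n)\<^sup>2 * ((v i)\<^sup>2 / lam i) \<le> b * s / real n * (v i)\<^sup>2" .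
  qed
  moreover have "(\<Sum>i\<in>{k..<p}. lam i * (v i)\<^sup>2) \<le> (\<Sum>i\<in>{k..<p}. b * s / real n * (v i)\<^sup>2)"
  proof (intro sum_mono mult_right_mono)
    fix i assume "i \<in> {k..<p}"
    hence "lam i \<le> s / real n" using tail by simp
    also have "\<dots> \<le> b * s / real n" using assms(1) s n1 by (intro divide_right_mono) auto
    finally show "lam i \<le> b * s / real n" .
  qed simp
  ultimately have "(s / real n)\<^sup>2 * (\<Sum>i<k. (v i)\<^sup>2 / lam i) + (\<Sum>i\<in>{k..<p}. lam i * (v i)\<^sup>2) \<le> (\<Sum>i<p. b * s / real n * (v i)\<^sup>2)"
    by (simp add: sum_lessThan_split[OF kp])
  also have "\<dots> = b * (nrm p v)\<^sup>2 * s / real n" by (simp add: nrm_power2 ip_self sum_distrib_left sum_divide_distrib mult_ac)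
  finally show ?thesis .
qed

lemma measurable_gram_solve [measurable]:
  assumes "j < n" "i < p"
  shows "(\<lambda>x. gram_solve n p x (\<lambda>j. x j i) j) \<in> borel_measurable designs"
  unfolding gram_solve_def
proof (intro borel_measurable_sum borel_measurable_times borel_measurable_inv_entry)
  fix a b assume "a < n" "b < n"
  thus "(\<lambda>x. ip p (x a) (x b)) \<in> borel_measurable designs" unfolding ip_def by measurable
qed (use assms in auto)

text \<open>The exponent \<open>\<tau>\<close> is the smaller of the range limit
  \<open>t0 / lam k\<close> and the balance point \<open>sqrt (n / \<Lambda>)\<close>. Either way
  its product with \<open>sqrt (n \<Lambda>) + n * lam k\<close> is at least \<open>m * n\<close>,
  while the quadratic term costs at most \<open>mgf_const * n\<close>. The additional 19 pays 18 for
  the net and leaves 1 for the bound.\<close>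

lemma prob_not_tail_ok_le:
  fixes t k
  defines "m \<equiv> min 1 (1 / (8 * sx\<^sup>2))" and "\<Lambda> \<equiv> \<Sum>l\<in>{k..<p}. (lam l)\<^sup>2"
  assumes k: "k < p" and t: "t = (mgf_const + 19) / m * (sqrt (real n * \<Lambda>) + real n * lam k)"
  shows "S.prob {\<omega>\<in>space (sample n D). \<not> tail_ok k t (design \<omega>)} \<le> 2 * exp (- real n)"
proof -
  define t0 where "t0 = 1 / (8 * sx\<^sup>2)"
  have t0: "t0 > 0" using sx_pos by (simp add: t0_def)
  have m: "0 < m" "m \<le> 1" "m \<le> t0" using t0 by (auto simp: m_def t0_def)
  have lk: "lam k > 0" by (rule lam_pos[OF k])
  have "(lam k)\<^sup>2 \<le> \<Lambda>" unfolding \<Lambda>_def using k by (intro member_le_sum) auto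
  hence \<Lambda>: "\<Lambda> > 0" using lk by (meson less_le_trans zero_less_power)
  have n1: "real n > 0" using n_pos by simp
  define \<tau> where "\<tau> = min (t0 / lam k) (sqrt (real n / \<Lambda>))"
  have \<tau>: "0 < \<tau>" using t0 lk n1 \<Lambda> by (simp add: \<tau>_def)
  have K0: "0 \<le> mgf_const" by simp
  have \<tau>2: "\<tau>\<^sup>2 * \<Lambda> \<le> real n"
  proof -
    have "\<tau>\<^sup>2 \<le> (sqrt (real n / \<Lambda>))\<^sup>2" using \<tau> by (intro power_mono) (auto simp: \<tau>_def)
    also have "\<dots> = real n / \<Lambda>" using \<Lambda> by simp
    finally show ?thesis using \<Lambda> by (simp add: field_simps)
  qed
  have \<tau>m: "m * real n \<le> \<tau> * (sqrt (real n * \<Lambda>) + real n * lam k)"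
  proof (cases "t0 / lam k \<le> sqrt (real n / \<Lambda>)")
    case True
    hence "\<tau> = t0 / lam k" by (simp add: \<tau>_def)
    hence "\<tau> * (sqrt (real n * \<Lambda>) + real n * lam k) = \<tau> * sqrt (real n * \<Lambda>) + t0 * real n" using lk by (simp add: field_simps)
    moreover have "m * real n \<le> t0 * real n" using m by (intro mult_right_mono) auto
    moreover have "0 \<le> \<tau> * sqrt (real n * \<Lambda>)" using \<tau> \<Lambda> by simp
    ultimately show ?thesis by linarith
  next
    case False
    hence "\<tau> = sqrt (real n / \<Lambda>)" by (simp add: \<tau>_def)
    moreover have "sqrt (real n / \<Lambda>) * sqrt (real n * \<Lambda>) = real n"
      using \<Lambda> by (simp add: real_sqrt_mult[symmetric])
    ultimately have "\<tau> * (sqrt (real n * \<Lambda>) + real n * lam k) = real n + \<tau> * (real n * lam k)" by (simp add: distrib_left)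
    moreover have "m * real n \<le> 1 * real n" using m by (intro mult_right_mono) auto
    moreover have "0 \<le> \<tau> * (real n * lam k)" using \<tau> lk by simp
    ultimately show ?thesis by linarith
  qed
  have "(mgf_const + 19) / m * (m * real n) \<le> (mgf_const + 19) / m * (\<tau> * (sqrt (real n * \<Lambda>) + real n * lam k))"
    using \<tau>m m K0 by (intro mult_left_mono) (auto intro!: divide_nonneg_pos add_nonneg_nonneg)
  hence \<tau>t: "(mgf_const + 19) * real n \<le> \<tau> * t" using m by (simp add: t mult_ac)
  have K\<tau>: "mgf_const * \<tau>\<^sup>2 * \<Lambda> \<le> mgf_const * real n" using mult_left_mono[OF \<tau>2 K0] by (simp add: mult.assoc)
  have "S.prob {\<omega>\<in>space (sample n D). \<not> tail_ok k t (design \<omega>)}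
    \<le> (3 * 2 ^ 16) ^ n * (2 * exp (- \<tau> * t + mgf_const * \<tau>\<^sup>2 * \<Lambda>))"
    unfolding \<Lambda>_def
  proof (rule prob_not_tail_ok)
    fix l assume "l \<in> {k..<p}"
    hence "lam l \<le> lam k" using lam_antimono by auto
    hence "\<tau> * lam l \<le> \<tau> * lam k" using \<tau> by simp
    also have "\<dots> \<le> (t0 / lam k) * lam k" using lk by (intro mult_right_mono) (auto simp: \<tau>_def)
    finally show "\<tau> * lam l \<le> 1 / (8 * sx\<^sup>2)" using lk by (simp add: t0_def)
  qed (use \<tau> in simp)
  also have "\<dots> \<le> exp (18 * real n) * (2 * exp (- \<tau> * t + mgf_const * \<tau>\<^sup>2 * \<Lambda>))"
    by (intro mult_right_mono net_cardinality_exp) auto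
  also have "\<dots> = 2 * exp (18 * real n + (- \<tau> * t + mgf_const * \<tau>\<^sup>2 * \<Lambda>))" by (simp only: exp_add)
  also have "\<dots> \<le> 2 * exp (- real n)"
  proof -
    have "18 * real n + (- \<tau> * t + mgf_const * \<tau>\<^sup>2 * \<Lambda>) \<le> - real n"
      using \<tau>t K\<tau> unfolding distrib_right by linarith
    thus ?thesis by simp
  qed
  finally show ?thesis .
qed

text \<open>Budget in units of \<open>\<tau> * n\<close>: a gain of 1/4, less 1/8 for the quadratic
  term and 1/16 for the net of dimension \<open>k\<close>, leaves 1/16.\<close>

lemma prob_not_head_ok_le:
  assumes k: "k \<le> p" and \<tau>: "0 < \<tau>" "\<tau> \<le> 1 / (8 * sx\<^sup>2)" "mgf_const * \<tau> \<le> 1 / 8"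
    and kn: "18 * real k \<le> \<tau> / 16 * real n"
  shows "S.prob {\<omega>\<in>space (sample n D). \<not> head_ok k (design \<omega>)} \<le> 2 * exp (- \<tau> / 16 * real n)"
proof -
  have K\<tau>: "mgf_const * \<tau>\<^sup>2 * real n \<le> \<tau> / 8 * real n"
  proof (rule mult_right_mono)
    show "mgf_const * \<tau>\<^sup>2 \<le> \<tau> / 8" using mult_left_mono[OF \<tau>(3), of \<tau>] \<tau>(1) by (simp add: power2_eq_square mult_ac)
  qed simp
  have "S.prob {\<omega>\<in>space (sample n D). \<not> head_ok k (design \<omega>)}
    \<le> (3 * 2 ^ 16) ^ k * (2 * exp (- \<tau> * (real n / 4) + mgf_const * \<tau>\<^sup>2 * real n))"
    by (rule prob_not_head_ok[OF k]) (use \<tau> in auto)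
  also have "\<dots> \<le> exp (18 * real k) * (2 * exp (- \<tau> * (real n / 4) + mgf_const * \<tau>\<^sup>2 * real n))"
    by (intro mult_right_mono net_cardinality_exp) auto
  also have "\<dots> = 2 * exp (18 * real k + (- \<tau> * (real n / 4) + mgf_const * \<tau>\<^sup>2 * real n))" by (simp only: exp_add)
  also have "\<dots> \<le> 2 * exp (- \<tau> / 16 * real n)"
  proof -
    have "18 * real k + (- \<tau> * (real n / 4) + mgf_const * \<tau>\<^sup>2 * real n) \<le> - \<tau> / 16 * real n"
      using K\<tau> kn by linarith
    thus ?thesis by simp
  qed
  finally show ?thesis .
qed

text \<open>At this exponent the linear and the quadratic term are both multiples of
  \<open>L\<close>; the threshold constant exceeds the quadratic one by 1, so exactly
  \<open>- L\<close> remains.\<close>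

lemma prob_noise_norm_le:
  assumes L: "0 < L" "L \<le> (1 / (8 * sy\<^sup>2))\<^sup>2 * real n"
  shows "S.prob {\<omega>\<in>space (sample n D). real n * ((128 * exp 2 * sy ^ 4 + 1) * sqrt (L / real n)) < \<bar>ip n (noises \<omega>) (noises \<omega>) - real n * sig\<^sup>2\<bar>}
    \<le> 2 * exp (- L)"
proof -
  let ?\<tau> = "sqrt (L / real n)"
  have n1: "real n > 0" using n_pos by simp
  have \<tau>2: "?\<tau>\<^sup>2 * real n = L" using L n1 by simp
  have "?\<tau> \<le> sqrt ((1 / (8 * sy\<^sup>2))\<^sup>2)" using L n1 by (intro real_sqrt_le_mono) (simp add: field_simps)
  hence \<tau>: "?\<tau> \<le> 1 / (8 * sy\<^sup>2)" by simp
  have "S.prob {\<omega>\<in>space (sample n D). real n * ((128 * exp 2 * sy ^ 4 + 1) * ?\<tau>) < \<bar>ip n (noises \<omega>) (noises \<omega>) - real n * sig\<^sup>2\<bar>}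
    \<le> 2 * exp (- ?\<tau> * (real n * ((128 * exp 2 * sy ^ 4 + 1) * ?\<tau>)) + 128 * exp 2 * sy ^ 4 * ?\<tau>\<^sup>2 * real n)"
    by (rule noise_bernstein) (use L \<tau> in auto)
  also have "- ?\<tau> * (real n * ((128 * exp 2 * sy ^ 4 + 1) * ?\<tau>)) + 128 * exp 2 * sy ^ 4 * ?\<tau>\<^sup>2 * real n
      = - ((128 * exp 2 * sy ^ 4 + 1) * (?\<tau>\<^sup>2 * real n)) + 128 * exp 2 * sy ^ 4 * (?\<tau>\<^sup>2 * real n)"
    by (simp only: power2_eq_square mult_ac minus_mult_left minus_mult_right)
  also have "\<dots> = - L" unfolding \<tau>2 by (simp add: distrib_right)
  finally show ?thesis .
qed

end

section \<open>The good sample and the risk bound\<close>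

context regression
begin

definition noise_risk :: "(nat \<Rightarrow> pt) \<Rightarrow> real" where
  "noise_risk \<omega> = (\<Sum>i<p. lam i * (xT n (design \<omega>) (gram_solve n p (design \<omega>) (noises \<omega>)) i)\<^sup>2)"

lemma measurable_noise_risk [measurable]: "noise_risk \<in> borel_measurable (sample n D)"
proof -
  have [measurable]: "(\<lambda>\<omega>. design \<omega> j i) \<in> borel_measurable (sample n D)" if "j < n" "i < p" for j i
    using that by (intro measurable_compose[OF measurable_design measurable_design_entry])
  have [measurable]: "(\<lambda>\<omega>. inv_entry n (\<lambda>j j'. ip p (design \<omega> j) (design \<omega> j')) j l) \<in> borel_measurable (sample n D)"
    if "j < n" "l < n" for j l
    using that by (intro borel_measurable_inv_entry) (auto simp: ip_def)
  show ?thesis unfolding noise_risk_def[abs_def] xT_def gram_solve_def by measurable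
qed

text \<open>On good designs \<open>xT_gram_solve\<close> writes \<open>noise_risk\<close> as a
  quadratic form whose rows are \<open>sqrt (lam i)\<close> times the Gram solution of column
  \<open>i\<close>, and \<open>variance_trace_le\<close> bounds its trace.\<close>

lemma prob_noise_risk_le:
  fixes k t s
  defines "\<Lambda> \<equiv> \<Sum>i\<in>{k..<p}. (lam i)\<^sup>2"
  assumes k: "k < p" and s: "s = (\<Sum>i\<in>{k..<p}. lam i)" "0 < s" and t: "0 \<le> t" "4 * t \<le> s"
    and small: "\<And>i. k \<le> i \<Longrightarrow> i < p \<Longrightarrow> lam i \<le> s / real n"
  shows "S.prob {\<omega>\<in>space (sample n D). (tail_ok k t (design \<omega>) \<and> head_ok k (design \<omega>) \<and> trace_ok k (design \<omega>)) \<and>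
      4 * sy\<^sup>2 * (32 * (real k / real n + real n * \<Lambda> / s\<^sup>2)) * L < noise_risk \<omega>} \<le> 2 * exp (- L)"
proof -
  define G where "G x \<longleftrightarrow> tail_ok k t x \<and> head_ok k x \<and> trace_ok k x" for x
  define q where "q x i j = sqrt (lam i) * gram_solve n p x (\<lambda>j. x j i) j" for x i j
  let ?\<tau> = "32 * (real k / real n + real n * \<Lambda> / s\<^sup>2)"
  have kp: "k \<le> p" using k by simp
  have good: "good_design n k p lam x s (2 * t / s)" if "G x" for x
    using that kp s t small by (intro good_design_of_ok) (auto simp: G_def)
  have ipq: "ip n (q x i) f = sqrt (lam i) * ip n (gram_solve n p x (\<lambda>j. x j i)) f" for x i f
    unfolding q_def[abs_def] by (rule ip_scale_left)
  have ipqq: "ip n (q x i) (q x i) = lam i * ip n (gram_solve n p x (\<lambda>j. x j i)) (gram_solve n p x (\<lambda>j. x j i))" if "i < p" for x i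
    unfolding q_def[abs_def] ip_linear using lam_pos[OF that] by (simp add: mult.assoc[symmetric])
  have "(lam k)\<^sup>2 \<le> \<Lambda>" unfolding \<Lambda>_def using k by (intro member_le_sum) auto
  hence \<Lambda>: "\<Lambda> > 0" using lam_pos[OF k] by (meson less_le_trans zero_less_power)
  have "S.prob {\<omega>\<in>space (sample n D). G (design \<omega>) \<and> 4 * sy\<^sup>2 * ?\<tau> * L < (\<Sum>i<p. (ip n (q (design \<omega>) i) (noises \<omega>))\<^sup>2)} \<le> 2 * exp (- L)"
  proof (rule noise_quadratic_tail)
    show "(\<lambda>x. q x i j) \<in> borel_measurable designs" if "i < p" "j < n" for i j
      unfolding q_def using that by measurable
    show "Measurable.pred designs G" unfolding G_def[abs_def] using kp by measurable
    show "(\<Sum>i<p. ip n (q x i) (q x i)) \<le> ?\<tau>" if "G x" for x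
    proof -
      interpret good_design n k p lam x s "2 * t / s" by (rule good[OF that])
      show ?thesis using variance_trace_le that by (simp add: ipqq G_def trace_ok_def \<Lambda>_def)
    qed
    show "0 < ?\<tau>" using \<Lambda> s n_pos by (auto intro!: add_nonneg_pos)
  qed
  moreover have "(\<Sum>i<p. (ip n (q (design \<omega>) i) (noises \<omega>))\<^sup>2) = noise_risk \<omega>" if "G (design \<omega>)" for \<omega>
  proof -
    interpret good_design n k p lam "design \<omega>" s "2 * t / s" by (rule good[OF that])
    show ?thesis unfolding noise_risk_def using lam_pos
      by (intro sum.cong refl) (auto simp: ipq xT_gram_solve power_mult_distrib less_imp_le)
  qed
  hence "{\<omega>\<in>space (sample n D). G (design \<omega>) \<and> 4 * sy\<^sup>2 * ?\<tau> * L < (\<Sum>i<p. (ip n (q (design \<omega>) i) (noises \<omega>))\<^sup>2)}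
      = {\<omega>\<in>space (sample n D). G (design \<omega>) \<and> 4 * sy\<^sup>2 * ?\<tau> * L < noise_risk \<omega>}" by auto
  ultimately show ?thesis by (simp add: G_def)
qed

text \<open>The vectors \<open>v1\<close> and \<open>v2\<close> will be \<open>ps - th\<close> and
  \<open>ps\<close>; both are fixed before the sample is drawn, so one event for each is
  enough.\<close>

definition good_sample :: "nat \<Rightarrow> real \<Rightarrow> (nat \<Rightarrow> real) \<Rightarrow> (nat \<Rightarrow> real) \<Rightarrow> real \<Rightarrow> real \<Rightarrow> (nat \<Rightarrow> pt) \<Rightarrow> bool" where
  "good_sample k t v1 v2 \<kappa> Vb \<omega> \<longleftrightarrow>
     tail_ok k t (design \<omega>) \<and> head_ok k (design \<omega>) \<and> trace_ok k (design \<omega>) \<and>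
     vec_ok k v1 (design \<omega>) \<and> vec_ok k v2 (design \<omega>) \<and>
     \<bar>ip n (noises \<omega>) (noises \<omega>) - real n * sig\<^sup>2\<bar> \<le> real n * \<kappa> \<and> noise_risk \<omega> \<le> Vb"

lemma measurable_good_sample: "k \<le> p \<Longrightarrow> {\<omega>\<in>space (sample n D). good_sample k t v1 v2 \<kappa> Vb \<omega>} \<in> sets (sample n D)"
proof -
  assume "k \<le> p"
  have [measurable]: "(\<lambda>\<omega>. ip n (noises \<omega>) (noises \<omega>)) \<in> borel_measurable (sample n D)" unfolding ip_def by measurable
  show ?thesis unfolding good_sample_def using \<open>k \<le> p\<close> by measurable
qed

text \<open>Seven bad events, each of probability at most \<open>2 * exp (- L)\<close>: the upper
  limits on \<open>L\<close> bring the bounds exponential in \<open>n\<close> below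
  \<open>exp (- L)\<close>. The event for \<open>noise_risk\<close> is intersected with the design
  conditions, whose failure is already counted in the union.\<close>

lemma prob_good_sample:
  fixes k t s \<tau> L v1 v2
  defines "\<Lambda> \<equiv> \<Sum>i\<in>{k..<p}. (lam i)\<^sup>2"
  assumes k: "k < p" and s: "s = (\<Sum>i\<in>{k..<p}. lam i)" "0 < s"
    and t: "t = (mgf_const + 19) / min 1 (1 / (8 * sx\<^sup>2)) * (sqrt (real n * \<Lambda>) + real n * lam k)" "4 * t \<le> s"
    and small: "\<And>i. k \<le> i \<Longrightarrow> i < p \<Longrightarrow> lam i \<le> s / real n"
    and \<tau>: "0 < \<tau>" "\<tau> \<le> 1 / (8 * sx\<^sup>2)" "mgf_const * \<tau> \<le> 1 / 8"
    and kn: "18 * real k \<le> \<tau> / 16 * real n"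
    and L: "0 < L" "L \<le> real n" "L \<le> \<tau> / 16 * real n" "L \<le> (1 / (8 * sy\<^sup>2))\<^sup>2 * real n"
  shows "1 - 14 * exp (- L) \<le> S.prob {\<omega>\<in>space (sample n D).
     good_sample k t v1 v2 ((128 * exp 2 * sy ^ 4 + 1) * sqrt (L / real n))
       (4 * sy\<^sup>2 * (32 * (real k / real n + real n * \<Lambda> / s\<^sup>2)) * L) \<omega>}"
proof -
  have kp: "k \<le> p" using k by simp
  let ?\<kappa> = "(128 * exp 2 * sy ^ 4 + 1) * sqrt (L / real n)"
  let ?Vb = "4 * sy\<^sup>2 * (32 * (real k / real n + real n * \<Lambda> / s\<^sup>2)) * L"
  let ?A = "{\<omega>\<in>space (sample n D). good_sample k t v1 v2 ?\<kappa> ?Vb \<omega>}"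
  have \<Lambda>0: "0 \<le> \<Lambda>" unfolding \<Lambda>_def by (intro sum_nonneg) auto
  have m0: "0 < min 1 (1 / (8 * sx\<^sup>2))" using sx_pos by auto
  have t0: "0 \<le> t" unfolding t using m0 lam_pos[OF k] \<Lambda>0 by (intro mult_nonneg_nonneg divide_nonneg_pos add_nonneg_nonneg) auto
  have e1: "exp (- real n) \<le> exp (- L)" using L by simp
  have e2: "exp (- \<tau> / 16 * real n) \<le> exp (- L)" using L by simp
  have K\<tau>': "mgf_const * \<tau>\<^sup>2 \<le> \<tau> / 8" using mult_left_mono[OF \<tau>(3), of \<tau>] \<tau>(1) by (simp add: power2_eq_square mult_ac)
  have e3: "exp (- \<tau> * real n + mgf_const * \<tau>\<^sup>2 * real n) \<le> exp (- L)"
  proof -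
    have "mgf_const * \<tau>\<^sup>2 * real n \<le> \<tau> / 8 * real n" by (rule mult_right_mono[OF K\<tau>']) simp
    moreover have "0 \<le> \<tau> * real n" using \<tau> by simp
    ultimately have "- \<tau> * real n + mgf_const * \<tau>\<^sup>2 * real n \<le> - L" using L(3) by linarith
    thus ?thesis by simp
  qed
  have K\<tau>: "mgf_const * \<tau>\<^sup>2 \<le> \<tau>" using K\<tau>' \<tau> by linarith
  define Bt where "Bt = {\<omega>\<in>space (sample n D). \<not> tail_ok k t (design \<omega>)}"
  define Bh where "Bh = {\<omega>\<in>space (sample n D). \<not> head_ok k (design \<omega>)}"
  define Br where "Br = {\<omega>\<in>space (sample n D). \<not> trace_ok k (design \<omega>)}"
  define B1 where "B1 = {\<omega>\<in>space (sample n D). \<not> vec_ok k v1 (design \<omega>)}"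
  define B2 where "B2 = {\<omega>\<in>space (sample n D). \<not> vec_ok k v2 (design \<omega>)}"
  define Bn where "Bn = {\<omega>\<in>space (sample n D). real n * ?\<kappa> < \<bar>ip n (noises \<omega>) (noises \<omega>) - real n * sig\<^sup>2\<bar>}"
  define Bv where "Bv = {\<omega>\<in>space (sample n D). (tail_ok k t (design \<omega>) \<and> head_ok k (design \<omega>) \<and> trace_ok k (design \<omega>)) \<and> ?Vb < noise_risk \<omega>}"
  have ipn [measurable]: "(\<lambda>\<omega>. ip n (noises \<omega>) (noises \<omega>)) \<in> borel_measurable (sample n D)" unfolding ip_def by measurable
  have [measurable]: "Bt \<in> S.events" "Br \<in> S.events" "B1 \<in> S.events" "B2 \<in> S.events" "Bn \<in> S.events"
    unfolding Bt_def Br_def B1_def B2_def Bn_def by measurable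
  have [measurable]: "Bh \<in> S.events" "Bv \<in> S.events" unfolding Bh_def Bv_def using kp by measurable
  have "S.prob (Bt \<union> (Bh \<union> (Br \<union> (B1 \<union> (B2 \<union> (Bn \<union> Bv)))))) \<le>
     S.prob Bt + (S.prob Bh + (S.prob Br + (S.prob B1 + (S.prob B2 + (S.prob Bn + S.prob Bv)))))"
    by (intro order_trans[OF measure_Un_le] add_left_mono order_refl) measurable
  also have "S.prob Bt \<le> 2 * exp (- L)"
    unfolding Bt_def using prob_not_tail_ok_le[OF k t(1)[unfolded \<Lambda>_def]] e1 by linarith
  also have "S.prob Bh \<le> 2 * exp (- L)"
    unfolding Bh_def using prob_not_head_ok_le[OF kp \<tau> kn] e2 by linarith
  also have "S.prob Br \<le> 2 * exp (- L)"
    unfolding Br_def using prob_not_trace_ok[OF k _ \<tau>(2) K\<tau>] \<tau>(1) e3 by linarith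
  also have "S.prob B1 \<le> 2 * exp (- L)"
    unfolding B1_def using prob_not_vec_ok[OF kp _ \<tau>(2), of v1] \<tau>(1) e3 by linarith
  also have "S.prob B2 \<le> 2 * exp (- L)"
    unfolding B2_def using prob_not_vec_ok[OF kp _ \<tau>(2), of v2] \<tau>(1) e3 by linarith
  also have "S.prob Bn \<le> 2 * exp (- L)"
    unfolding Bn_def by (rule prob_noise_norm_le[OF L(1) L(4)])
  also have "S.prob Bv \<le> 2 * exp (- L)"
    unfolding Bv_def \<Lambda>_def by (rule prob_noise_risk_le[OF k s t0 t(2) small])
  finally have bad: "S.prob (Bt \<union> (Bh \<union> (Br \<union> (B1 \<union> (B2 \<union> (Bn \<union> Bv)))))) \<le> 14 * exp (- L)" by simp
  have A [measurable]: "?A \<in> S.events" by (rule measurable_good_sample[OF kp])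
  have "space (sample n D) - ?A \<subseteq> Bt \<union> (Bh \<union> (Br \<union> (B1 \<union> (B2 \<union> (Bn \<union> Bv)))))"
    by (auto simp: Bt_def Bh_def Br_def B1_def B2_def Bn_def Bv_def good_sample_def not_le)
  hence "S.prob (space (sample n D) - ?A) \<le> 14 * exp (- L)"
    by (intro order_trans[OF S.finite_measure_mono bad]) measurable
  thus ?thesis using S.prob_compl[OF A] by simp
qed

lemma good_sample_estimator:
  fixes k t s \<kappa> Vb
  defines "bias \<equiv> \<lambda>v. (s / real n)\<^sup>2 * (\<Sum>i<k. (v i)\<^sup>2 / lam i) + (\<Sum>i\<in>{k..<p}. lam i * (v i)\<^sup>2)"
  assumes good: "good_sample k t (\<lambda>i. ps i - th i) ps \<kappa> Vb \<omega>"
    and k: "k \<le> p" and s: "s = (\<Sum>i\<in>{k..<p}. lam i)" "0 < s" and t: "0 \<le> t" "4 * t \<le> s"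
    and small: "\<And>i. k \<le> i \<Longrightarrow> i < p \<Longrightarrow> lam i \<le> s / real n"
    and ps: "\<And>i. ps i = 2/3 * sqrt (sig * sqrt (real n / s)) * w i"
    and norms: "nrm p th \<le> 1" "nrm p w \<le> 1" and \<kappa>: "0 \<le> \<kappa>"
  shows "\<exists>\<theta>. is_est n p \<omega> w \<theta>"
    and "is_est n p \<omega> w \<theta> \<Longrightarrow> risk p D th \<theta> \<le> 1800 * bias (\<lambda>i. ps i - th i) + 3 * Vb
     + 7200 * bias ps * (4 * s / (real n * sig\<^sup>2)
         + (4 * (2 * t / s)\<^sup>2 * (sig\<^sup>2 + \<kappa>)\<^sup>2 + 2 * (sig\<^sup>2 + \<kappa>) * Vb + \<kappa>\<^sup>2) / sig ^ 4)"
proof -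
  interpret good_design n k p lam "design \<omega>" s "2 * t / s"
    using good k s t small by (intro good_design_of_ok) (auto simp: good_sample_def)
  have x: "design \<omega> j = fst (\<omega> j)" if "j < n" for j using that by (simp add: design_def)
  show "\<exists>\<theta>. is_est n p \<omega> w \<theta>"
  proof (rule is_est_exists)
    show "snd (\<omega> j) = ip p (fst (\<omega> j)) (xT n (design \<omega>) (gram_solve n p (design \<omega>) (\<lambda>j. snd (\<omega> j))))" if "j < n" for j
      using gram_solve[OF that, of "\<lambda>j. snd (\<omega> j)"] that by (simp add: x)
  qed
  assume est: "is_est n p \<omega> w \<theta>"
  show "risk p D th \<theta> \<le> 1800 * bias (\<lambda>i. ps i - th i) + 3 * Vb
     + 7200 * bias ps * (4 * s / (real n * sig\<^sup>2)
         + (4 * (2 * t / s)\<^sup>2 * (sig\<^sup>2 + \<kappa>)\<^sup>2 + 2 * (sig\<^sup>2 + \<kappa>) * Vb + \<kappa>\<^sup>2) / sig ^ 4)"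
    unfolding risk_eq bias_def bias_form_def[symmetric]
  proof (rule estimator_risk_le[OF sig_pos])
    show "ip p (design \<omega> j) \<theta> = ip p (design \<omega> j) th + noises \<omega> j" if "j < n" for j
      using est that unfolding is_est_def by (simp add: x noises_def noise_def)
    show "ip p \<theta> h = 2/3 * sqrt (nrm p \<theta>) * ip p w h" if "\<And>j. j < n \<Longrightarrow> ip p (design \<omega> j) h = 0" for h
      by (rule is_est_stationary[OF est]) (use that x in auto)
    show "ps i = 2/3 * sqrt (sig * sqrt (real n / s)) * w i" for i by (rule ps)
  qed (use good norms \<kappa> in \<open>auto simp: good_sample_def vec_ok_def noise_risk_def\<close>)
qed

end

text \<open>\<open>psi\<close> is the stationarity vector
  \<open>2/3 * sqrt (nrm p \<theta>) * w\<close> with the random norm replaced by its deterministic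
  approximation \<open>sig * sqrt (n / s)\<close>.\<close>

lemma psi_eq:
  assumes "0 < s_tail p lam (kidx b n p lam)" "0 < sig"
  shows "psi sig b n p lam w i = 2/3 * sqrt (sig * sqrt (real n / s_tail p lam (kidx b n p lam))) * w i"
proof -
  let ?s = "s_tail p lam (kidx b n p lam)"
  have root4: "sqrt (sqrt y) = y powr (1/4)" if "0 \<le> y" for y :: real
    using that by (simp add: powr_half_sqrt[symmetric] powr_powr)
  have "sqrt (sig * sqrt (real n / ?s)) = sqrt sig * (real n powr (1/4) / ?s powr (1/4))"
    using assms by (simp add: real_sqrt_mult root4 powr_divide)
  thus ?thesis by (simp add: psi_def)
qed


text \<open>The product of the bias \<open>Bp\<close> of \<open>ps\<close> with the squared relative
  error \<open>T\<close> is split. Against the bracket \<open>BR\<close>, the bound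
  \<open>b * P * sn\<close> produces the third error term; against the variance part of
  \<open>T\<close>, the constant bound \<open>b * sg\<close> keeps the product within the variance
  term.\<close>

lemma excess_terms_le:
  fixes b P sn V BR M :: real
  assumes nonneg: "0 \<le> b" "0 \<le> Bp" "0 \<le> V" "0 \<le> BR" "0 \<le> P" "0 \<le> sn" "0 \<le> Cv" "0 \<le> C8" "0 \<le> C9" "0 \<le> sg"
    and Bp: "Bp \<le> b * P * sn" "Bp \<le> b * sg" and sn: "sn \<le> l0 * M"
    and T: "T \<le> C8 * BR + C9 * (Cv * V)"
    and risk: "rk \<le> 1800 * B1 + 3 * (Cv * V) + 7200 * Bp * T"
    and c7: "c7 = 1800 * b + 7200 * b * C8 + (3 + 7200 * b * sg * C9) * Cv"
  shows "rk \<le> 1800 * B1 + c7 * V + c7 * l0 * P * BR * M"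
proof -
  have "0 \<le> l0 * M" using nonneg sn by linarith
  hence M: "0 \<le> P * BR * (l0 * M)" using nonneg by simp
  have "Bp * T \<le> Bp * (C8 * BR + C9 * (Cv * V))" using nonneg T by (intro mult_left_mono)
  also have "\<dots> = C8 * BR * Bp + C9 * (Cv * V) * Bp" by (simp add: algebra_simps)
  also have "\<dots> \<le> C8 * BR * (b * P * sn) + C9 * (Cv * V) * (b * sg)"
    using nonneg Bp by (intro add_mono mult_left_mono) auto
  also have "\<dots> \<le> C8 * BR * (b * P * (l0 * M)) + C9 * (Cv * V) * (b * sg)"
    using nonneg sn by (intro add_right_mono mult_left_mono) auto
  finally have "7200 * (Bp * T) \<le> 7200 * (C8 * BR * (b * P * (l0 * M)) + C9 * (Cv * V) * (b * sg))" by simp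
  hence "rk \<le> 1800 * B1 + ((3 + 7200 * b * sg * C9) * Cv) * V + (7200 * b * C8) * (P * BR * (l0 * M))"
    using risk by (simp add: algebra_simps)
  also have "\<dots> \<le> 1800 * B1 + c7 * V + c7 * (P * BR * (l0 * M))"
    unfolding c7 using nonneg M by (intro add_mono order_refl mult_right_mono) (auto intro!: add_nonneg_nonneg mult_nonneg_nonneg)
  finally show ?thesis by (simp add: mult_ac)
qed

text \<open>The event is a measurable subset \<open>A\<close>, since the set of samples where every
  minimiser obeys the bounds is not obviously measurable. Existence of a minimiser is asserted with
  it, so that the bound over all minimisers is not vacuous. The later constants may depend on
  \<open>b\<close>.\<close>

theorem theorem1:
  fixes sx sy sig c :: real
  assumes "0 < sx" and "0 < sy" and "0 < sig" and "0 < c"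
  shows "\<exists>b0>0. \<forall>b\<ge>b0. \<exists>c0 c1 c2 c3 c4 c5 c6 c7 :: real.
    0 < c0 \<and> 0 < c1 \<and> 0 < c2 \<and> 0 < c3 \<and> 0 < c4 \<and> 0 < c5 \<and> 0 < c6 \<and> 0 < c7 \<and>
    (\<forall>n p D lam th \<theta>0 \<delta>.
       setting sx sy sig c n p D lam th \<and>
       (\<exists>j. b * real n \<le> r_tail p lam j) \<and>
       (\<exists>i<p. \<theta>0 i \<noteq> 0) \<and>
       exp (- c0 * sqrt (real n)) < \<delta> \<and> \<delta> < 1 - c1 * exp (- c2 * real n) \<and>
       c3 * real (n + kidx b n p lam) \<le> real p \<and>
       c4 * max (real (kidx b n p lam)) (s_tail p lam (kidx b n p lam)) \<le> real n \<and>
       nrm p th \<le> c5 \<and> nrm p (initw p \<theta>0) \<le> c5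
     \<longrightarrow>
       (\<exists>A \<in> sets (sample n D).
          A \<subseteq> {\<omega> \<in> space (sample n D).
                 (\<exists>\<theta>. is_est n p \<omega> (initw p \<theta>0) \<theta>) \<and>
                 (\<forall>\<theta>. is_est n p \<omega> (initw p \<theta>0) \<theta> \<longrightarrow>
                    (let k = kidx b n p lam; ps = psi sig b n p lam (initw p \<theta>0) in
                     risk p D th \<theta> \<le> bias_bd1 c7 n p lam k th ps + var_bd c7 \<delta> n p lam k
                                        + xi_bd c7 \<delta> n p lam k ps \<and>
                     risk p D th \<theta> \<le> bias_bd2 c7 n p lam k th ps + var_bd c7 \<delta> n p lam k
                                        + xi_bd c7 \<delta> n p lam k ps))} \<and>
          1 - c6 * \<delta> \<le> measure (sample n D) A))"
proof -
  define K where "K = 128 * exp 2 * sx ^ 4"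
  define m where "m = min 1 (1 / (8 * sx\<^sup>2))"
  define C1 where "C1 = (K + 19) / m"
  define \<tau> where "\<tau> = min (1 / (8 * sx\<^sup>2)) (1 / (8 * K))"
  define C6 where "C6 = 128 * exp 2 * sy ^ 4 + 1"
  define E where "E = sig\<^sup>2 + C6"
  define C8 where "C8 = 4 / sig\<^sup>2 + (32 * C1\<^sup>2 * E\<^sup>2 + C6\<^sup>2) / sig ^ 4"
  define C9 where "C9 = 2 * E / sig ^ 4"
  define Cv where "Cv = 128 * sy\<^sup>2"
  \<comment> \<open>One entry for each upper limit on \<open>L = ln (1 / \<delta>)\<close>: the tail
    net event, the events with exponent \<open>\<tau> / 16\<close>, and the range restriction for
    the noise energy.\<close>
  define c0 where "c0 = min (min 1 (\<tau> / 16)) ((1 / (8 * sy\<^sup>2))\<^sup>2)"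
  \<comment> \<open>\<open>288 = 18 * 16\<close>: the head net costs \<open>18 * k\<close>, paid
    from \<open>\<tau> * n / 16\<close>. The entry 1 gives \<open>s <= n\<close>.\<close>
  define c4 where "c4 = max 1 (288 / \<tau>)"
  \<comment> \<open>The relative threshold \<open>t / s\<close> is at most
    \<open>2 * C1 / sqrt b\<close>, which this makes at most 1/4, as \<open>good_design\<close>
    requires.\<close>
  define b0 where "b0 = max 1 ((8 * C1)\<^sup>2)"
  have K: "0 < K" using \<open>0 < sx\<close> by (simp add: K_def)
  have m: "0 < m" using \<open>0 < sx\<close> by (simp add: m_def)
  have C1: "0 < C1" using K m by (simp add: C1_def)
  have \<tau>: "0 < \<tau>" "\<tau> \<le> 1 / (8 * sx\<^sup>2)" using \<open>0 < sx\<close> K by (auto simp: \<tau>_def)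
  have K\<tau>: "K * \<tau> \<le> 1 / 8"
  proof -
    have "K * \<tau> \<le> K * (1 / (8 * K))" using K by (intro mult_left_mono) (auto simp: \<tau>_def)
    thus ?thesis using K by simp
  qed
  have C6: "0 < C6" using \<open>0 < sy\<close> by (simp add: C6_def add_nonneg_pos)
  have E: "0 < E" using C6 by (simp add: E_def add_nonneg_pos)
  have C8: "0 \<le> C8" by (simp add: C8_def)
  have C9: "0 \<le> C9" using E by (simp add: C9_def)
  have Cv: "0 \<le> Cv" by (simp add: Cv_def)
  have c0: "0 < c0" "c0 \<le> 1" "c0 \<le> \<tau> / 16" "c0 \<le> (1 / (8 * sy\<^sup>2))\<^sup>2" using \<tau> \<open>0 < sy\<close> by (auto simp: c0_def)
  have c4: "0 < c4" "1 \<le> c4" "288 / \<tau> \<le> c4" by (auto simp: c4_def)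
  have b0: "0 < b0" "1 \<le> b0" "(8 * C1)\<^sup>2 \<le> b0" by (auto simp: b0_def)
  show ?thesis
  proof (rule exI[of _ b0], intro conjI allI impI b0(1))
    fix b assume "b0 \<le> b"
    hence b: "1 \<le> b" "(8 * C1)\<^sup>2 \<le> b" using b0 by linarith+
    \<comment> \<open>A single constant for all three bounds: its summands are the coefficients of
      the bias, of the third error term and of the variance.\<close>
    define c7 where "c7 = 1800 * b + 7200 * b * C8 + (3 + 7200 * b * sig * C9) * Cv"
    have c7: "1800 * b \<le> c7" using b \<open>0 < sig\<close> C8 C9 Cv by (auto simp: c7_def intro!: add_nonneg_nonneg mult_nonneg_nonneg)
    hence c7_pos: "0 < c7" using b by linarith
    show "\<exists>c0 c1 c2 c3 c4 c5 c6 c7 :: real.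
    0 < c0 \<and> 0 < c1 \<and> 0 < c2 \<and> 0 < c3 \<and> 0 < c4 \<and> 0 < c5 \<and> 0 < c6 \<and> 0 < c7 \<and>
    (\<forall>n p D lam th \<theta>0 \<delta>.
       setting sx sy sig c n p D lam th \<and>
       (\<exists>j. b * real n \<le> r_tail p lam j) \<and>
       (\<exists>i<p. \<theta>0 i \<noteq> 0) \<and>
       exp (- c0 * sqrt (real n)) < \<delta> \<and> \<delta> < 1 - c1 * exp (- c2 * real n) \<and>
       c3 * real (n + kidx b n p lam) \<le> real p \<and>
       c4 * max (real (kidx b n p lam)) (s_tail p lam (kidx b n p lam)) \<le> real n \<and>
       nrm p th \<le> c5 \<and> nrm p (initw p \<theta>0) \<le> c5
     \<longrightarrow>
       (\<exists>A \<in> sets (sample n D).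
          A \<subseteq> {\<omega> \<in> space (sample n D).
                 (\<exists>\<theta>. is_est n p \<omega> (initw p \<theta>0) \<theta>) \<and>
                 (\<forall>\<theta>. is_est n p \<omega> (initw p \<theta>0) \<theta> \<longrightarrow>
                    (let k = kidx b n p lam; ps = psi sig b n p lam (initw p \<theta>0) in
                     risk p D th \<theta> \<le> bias_bd1 c7 n p lam k th ps + var_bd c7 \<delta> n p lam k
                                        + xi_bd c7 \<delta> n p lam k ps \<and>
                     risk p D th \<theta> \<le> bias_bd2 c7 n p lam k th ps + var_bd c7 \<delta> n p lam k
                                        + xi_bd c7 \<delta> n p lam k ps))} \<and>
          1 - c6 * \<delta> \<le> measure (sample n D) A))"
    proof (rule exI[of _ c0], rule exI[of _ 1], rule exI[of _ 1], rule exI[of _ 1], rule exI[of _ c4],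
        rule exI[of _ 1], rule exI[of _ 14], rule exI[of _ c7], intro conjI allI impI c0(1) c4(1) c7_pos)
      fix n p :: nat and D :: "pt measure" and lam th \<theta>0 :: "nat \<Rightarrow> real" and \<delta> :: real
      assume H: "setting sx sy sig c n p D lam th \<and>
       (\<exists>j. b * real n \<le> r_tail p lam j) \<and>
       (\<exists>i<p. \<theta>0 i \<noteq> 0) \<and>
       exp (- c0 * sqrt (real n)) < \<delta> \<and> \<delta> < 1 - 1 * exp (- 1 * real n) \<and>
       1 * real (n + kidx b n p lam) \<le> real p \<and>
       c4 * max (real (kidx b n p lam)) (s_tail p lam (kidx b n p lam)) \<le> real n \<and>
       nrm p th \<le> 1 \<and> nrm p (initw p \<theta>0) \<le> 1"
      define k where "k = kidx b n p lam"
      define w where "w = initw p \<theta>0"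
      define ps where "ps = psi sig b n p lam w"
      define s where "s = s_tail p lam k"
      define L where "L = ln (1 / \<delta>)"
      have \<delta>: "exp (- c0 * sqrt (real n)) < \<delta>" "\<delta> < 1 - exp (- real n)" using H by auto
      have \<delta>0: "0 < \<delta>" using \<delta>(1) by (meson exp_gt_zero less_trans)
      have \<delta>1: "\<delta> < 1" using \<delta>(2) exp_gt_zero[of "- real n"] by linarith
      \<comment> \<open>For \<open>n = 0\<close> the two limits on \<open>\<delta>\<close> would
        read \<open>1 < \<delta> < 0\<close>.\<close>
      have n_pos: "0 < n" using \<delta> by (cases "n = 0") auto
      interpret regression sx sy sig c n p D lam th
        by standard (use H assms n_pos in auto)
      have n1: "1 \<le> real n" using n_pos by simp
      have expL: "exp (- L) = \<delta>" using \<delta>0 by (simp add: L_def ln_div)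
      have L0: "0 < L" using \<delta>0 \<delta>1 by (simp add: L_def)
      have Ln: "L \<le> c0 * real n"
      proof -
        have "exp (- c0 * sqrt (real n)) < exp (- L)" using \<delta>(1) expL by simp
        hence "L < c0 * sqrt (real n)" by simp
        also have "\<dots> \<le> c0 * real n"
        proof (rule mult_left_mono)
          show "sqrt (real n) \<le> real n" using n1 by (intro real_le_lsqrt) (auto simp: power2_eq_square)
        qed (use c0 in simp)
        finally show ?thesis by simp
      qed
      have Ls: "L \<le> real n" "L \<le> \<tau> / 16 * real n" "L \<le> (1 / (8 * sy\<^sup>2))\<^sup>2 * real n"
        using Ln c0(2-4)[THEN mult_right_mono, of "real n"] by auto
      have ex: "\<exists>j. b * real n \<le> r_tail p lam j" using H by blast
      note kp = kidx_properties[OF b(1) ex k_def]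
      have s_sum: "s = (\<Sum>i\<in>{k..<p}. lam i)" by (simp add: s_def s_tail_def)
      have s0: "0 < s" using kp(3) by (simp add: s_def)
      have lk: "0 < lam k" by (rule lam_pos[OF kp(1)])
      have small: "lam i \<le> s / real n" if "k \<le> i" "i < p" for i using kp(5)[OF that] by (simp add: s_def)
      have head: "s \<le> b * real n * lam i" if "i < k" for i using kp(4)[OF that] by (simp add: s_def)
      have kn: "c4 * real k \<le> real n" and sn: "c4 * s \<le> real n"
      proof -
        have "c4 * max (real k) s \<le> real n" using H by (simp add: k_def s_def)
        moreover have "c4 * real k \<le> c4 * max (real k) s" "c4 * s \<le> c4 * max (real k) s"
          using c4 by (auto intro!: mult_left_mono)
        ultimately show "c4 * real k \<le> real n" "c4 * s \<le> real n" by linarith+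
      qed
      have sn1: "s / real n \<le> 1"
      proof -
        have "1 * s \<le> c4 * s" using c4 s0 by (intro mult_right_mono) auto
        thus ?thesis using sn n1 by simp
      qed
      have kn18: "18 * real k \<le> \<tau> / 16 * real n"
      proof -
        have "288 / \<tau> * real k \<le> c4 * real k" using c4 by (intro mult_right_mono) auto
        hence "288 / \<tau> * real k \<le> real n" using kn by linarith
        thus ?thesis using \<tau> by (simp add: field_simps)
      qed
      define \<Lambda> where "\<Lambda> = (\<Sum>i\<in>{k..<p}. (lam i)\<^sup>2)"
      define nR where "nR = real n / R_tail p lam k"
      define nr where "nr = real n / r_tail p lam k"
      have R: "nR = real n * \<Lambda> / s\<^sup>2" by (simp add: nR_def R_tail_def s_def \<Lambda>_def)
      have r: "nr = real n * lam k / s" by (simp add: nr_def r_tail_def s_def)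
      have \<Lambda>0: "0 \<le> \<Lambda>" unfolding \<Lambda>_def by (intro sum_nonneg) auto
      have nR0: "0 \<le> nR" and nr0: "0 \<le> nr" using \<Lambda>0 s0 lk by (simp_all add: R r)
      have nr_le: "nr \<le> 1 / b"
      proof -
        have "b * real n \<le> s / lam k" using kp(2) by (simp add: r_tail_def s_def)
        thus ?thesis using lk s0 b by (simp add: r field_simps)
      qed
      \<comment> \<open>On the tail \<open>lam i <= lam k\<close>, so the rank \<open>R_k\<close> is
        at least \<open>r_k\<close> and this ratio inherits the bound for \<open>nr\<close>.\<close>
      have nR_le: "nR \<le> 1 / b"
      proof -
        have "\<Lambda> \<le> (\<Sum>i\<in>{k..<p}. lam k * lam i)" unfolding \<Lambda>_def power2_eq_square
          using lam_antimono lam_pos by (intro sum_mono mult_right_mono) (auto simp: less_imp_le)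
        also have "\<dots> = lam k * s" by (simp add: s_sum sum_distrib_left)
        finally have "nR \<le> real n * (lam k * s) / s\<^sup>2" unfolding R by (intro divide_right_mono mult_left_mono) auto
        also have "\<dots> = nr" using s0 by (simp add: r power2_eq_square)
        finally show ?thesis using nr_le by linarith
      qed
      define t where "t = (K + 19) / m * (sqrt (real n * \<Lambda>) + real n * lam k)"
      have t_eq: "t / s = C1 * (sqrt nR + nr)"
      proof -
        have "sqrt nR = sqrt (real n * \<Lambda>) / s" using s0 by (simp add: R real_sqrt_divide)
        thus ?thesis unfolding t_def C1_def[symmetric] r by (simp add: add_divide_distrib[of _ _ s, symmetric])
      qed
      have t0: "0 \<le> t" unfolding t_def C1_def[symmetric] using C1 \<Lambda>0 lk by (intro mult_nonneg_nonneg add_nonneg_nonneg) auto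
      have t4: "4 * t \<le> s"
      proof -
        have sb: "8 * C1 \<le> sqrt b" using b C1 by (intro real_le_rsqrt) auto
        have sb0: "0 < sqrt b" using b by simp
        have "sqrt nR \<le> 1 / sqrt b" using nR_le by (metis real_sqrt_divide real_sqrt_le_mono real_sqrt_one)
        moreover have "nr \<le> 1 / sqrt b"
        proof -
          have "sqrt b \<le> b" using b by (intro real_le_lsqrt) (auto simp: power2_eq_square)
          hence "1 / b \<le> 1 / sqrt b" using sb0 by (intro divide_left_mono) auto
          thus ?thesis using nr_le by linarith
        qed
        ultimately have "t / s \<le> C1 * (1 / sqrt b + 1 / sqrt b)" unfolding t_eq using C1 by (intro mult_left_mono add_mono) auto
        also have "\<dots> = (8 * C1) / (4 * sqrt b)" by (simp add: field_simps)
        also have "\<dots> \<le> sqrt b / (4 * sqrt b)" using sb sb0 by (intro divide_right_mono) auto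
        also have "\<dots> = 1 / 4" using sb0 by simp
        finally show ?thesis using s0 by (simp add: field_simps)
      qed
      define \<kappa> where "\<kappa> = C6 * sqrt (L / real n)"
      define V where "V = L * (real k / real n + nR)"
      define Vb where "Vb = 4 * sy\<^sup>2 * (32 * (real k / real n + real n * \<Lambda> / s\<^sup>2)) * L"
      have Vb: "Vb = Cv * V" by (simp add: Vb_def Cv_def V_def R)
      have V0: "0 \<le> V" using L0 nR0 by (simp add: V_def)
      have \<kappa>0: "0 \<le> \<kappa>" using C6 L0 by (simp add: \<kappa>_def)
      have \<kappa>2: "\<kappa>\<^sup>2 = C6\<^sup>2 * (L / real n)" using L0 by (simp add: \<kappa>_def power_mult_distrib)
      have \<kappa>_le: "\<kappa> \<le> C6"
      proof -
        have "sqrt (L / real n) \<le> sqrt 1" using Ls(1) n1 by (intro real_sqrt_le_mono) simp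
        thus ?thesis using C6 by (simp add: \<kappa>_def mult_left_le)
      qed
      have ps: "ps i = 2/3 * sqrt (sig * sqrt (real n / s)) * w i" for i
        unfolding ps_def s_def k_def by (rule psi_eq) (use s0 \<open>0 < sig\<close> in \<open>simp_all add: s_def k_def\<close>)
      have norms: "nrm p th \<le> 1" "nrm p w \<le> 1" using H by (auto simp: w_def)
      define A where "A = {\<omega>\<in>space (sample n D). good_sample k t (\<lambda>i. ps i - th i) ps \<kappa> Vb \<omega>}"
      have A: "A \<in> sets (sample n D)" unfolding A_def using kp(1) by (intro measurable_good_sample) simp
      have "1 - 14 * exp (- L) \<le> S.prob A"
        unfolding A_def \<kappa>_def C6_def Vb_def \<Lambda>_def
        by (rule prob_good_sample[OF kp(1) s_sum s0 _ t4 small \<tau> K\<tau>[unfolded K_def] kn18 L0 Ls])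
          (auto simp: t_def K_def m_def \<Lambda>_def)
      hence prob: "1 - 14 * \<delta> \<le> measure (sample n D) A" by (simp add: expL)
      define bias where "bias v = (s / real n)\<^sup>2 * (\<Sum>i<k. (v i)\<^sup>2 / lam i) + (\<Sum>i\<in>{k..<p}. lam i * (v i)\<^sup>2)" for v
      have bias0: "0 \<le> bias v" for v
        using lam_pos kp(1) by (auto simp: bias_def less_imp_le intro!: add_nonneg_nonneg mult_nonneg_nonneg sum_nonneg divide_nonneg_nonneg)
      have bias_le: "bias v \<le> b * (nrm p v)\<^sup>2 * (s / real n)" for v
        using bias_form_le[OF b(1) less_imp_le[OF kp(1)] s0 head small, where v=v] by (simp add: bias_def)
      have bias_minus: "bias (\<lambda>i. ps i - th i) = bias (\<lambda>i. th i - ps i)"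
        by (simp add: bias_def power2_commute)
      \<comment> \<open>The squared norm of \<open>ps\<close> grows only like
        \<open>sqrt (n / s)\<close>, so after multiplication by \<open>s / n\<close> there remains
        \<open>sig * sqrt (s / n)\<close>, bounded because \<open>s <= n\<close>.\<close>
      have bias_ps: "bias ps \<le> b * sig"
      proof -
        define \<rho> where "\<rho> = sig * sqrt (real n / s)"
        have \<rho>0: "0 \<le> \<rho>" using \<open>0 < sig\<close> s0 by (simp add: \<rho>_def)
        have "ps = (\<lambda>i. (2/3 * sqrt \<rho>) * w i)" using ps by (auto simp: \<rho>_def)
        hence "nrm p ps = \<bar>2/3 * sqrt \<rho>\<bar> * nrm p w" by (simp only: nrm_scale)
        hence "(nrm p ps)\<^sup>2 = (\<bar>2/3 * sqrt \<rho>\<bar> * nrm p w)\<^sup>2" by (rule arg_cong)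
        also have "\<dots> = 4/9 * \<rho> * (nrm p w)\<^sup>2" using \<rho>0 by (simp add: power_mult_distrib power_divide)
        also have "\<dots> \<le> 4/9 * \<rho> * 1" using norms(2) \<rho>0 by (intro mult_left_mono) (auto simp: power_le_one)
        finally have "(nrm p ps)\<^sup>2 * (s / real n) \<le> \<rho> * (s / real n)"
          using s0 \<rho>0 by (intro mult_right_mono) auto
        also have "\<dots> = sig * sqrt (s / real n)"
        proof -
          have "sqrt (real n / s) * (s / real n) = sqrt (s / real n)"
          proof -
            have "s / real n = sqrt (s / real n) * sqrt (s / real n)" using s0 by simp
            moreover have "sqrt (real n / s) * sqrt (s / real n) = 1" using s0 n1 by (simp add: real_sqrt_mult[symmetric])
            ultimately show ?thesis by (metis mult.assoc mult_1)
          qed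
          thus ?thesis by (simp only: \<rho>_def mult.assoc)
        qed
        also have "\<dots> \<le> sig * 1" using \<open>0 < sig\<close> sn1 by (intro mult_left_mono) auto
        finally have "b * ((nrm p ps)\<^sup>2 * (s / real n)) \<le> b * sig" using b by (intro mult_left_mono) auto
        thus ?thesis using bias_le[of ps] by (simp add: mult.assoc)
      qed
      define BR where "BR = nR + (real n)\<^sup>2 / (r_tail p lam k)\<^sup>2 + s / real n + L / real n + (real k)\<^sup>2 / (real n)\<^sup>2"
      define M where "M = max (sqrt (r_tail p lam 0 / real n)) (max (r_tail p lam 0 / real n) (sqrt (L / real n)))"
      have nr2: "(real n)\<^sup>2 / (r_tail p lam k)\<^sup>2 = nr\<^sup>2" by (simp add: nr_def power_divide)
      have BR: "nR + nr\<^sup>2 \<le> BR" "s / real n \<le> BR" "L / real n \<le> BR" "0 \<le> BR"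
        using nR0 s0 L0 unfolding BR_def nr2 by (auto simp: add_increasing add_increasing2)
      \<comment> \<open>The full eigenvalue sum dominates \<open>s\<close> and equals
        \<open>lam 0 * r_tail p lam 0\<close>; the middle entry of the maximum \<open>M\<close> is
        thus the one used.\<close>
      have snM: "s / real n \<le> lam 0 * M"
      proof -
        have l0: "0 < lam 0" using kp(1) by (intro lam_pos) simp
        have "s \<le> s_tail p lam 0" unfolding s_def s_tail_def using lam_pos by (intro sum_mono2) (auto simp: less_imp_le)
        hence "s / real n \<le> s_tail p lam 0 / real n" by (intro divide_right_mono) auto
        also have "\<dots> = lam 0 * (r_tail p lam 0 / real n)" using l0 by (simp add: r_tail_def)
        also have "\<dots> \<le> lam 0 * M" using l0 by (intro mult_left_mono) (auto simp: M_def)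
        finally show ?thesis .
      qed
      have T: "4 * s / (real n * sig\<^sup>2) + (4 * (2 * t / s)\<^sup>2 * (sig\<^sup>2 + \<kappa>)\<^sup>2 + 2 * (sig\<^sup>2 + \<kappa>) * Vb + \<kappa>\<^sup>2) / sig ^ 4
          \<le> C8 * BR + C9 * (Cv * V)"
      proof -
        have Vb0: "0 \<le> Vb" unfolding Vb using Cv V0 by simp
        have E\<kappa>: "0 \<le> sig\<^sup>2 + \<kappa>" "sig\<^sup>2 + \<kappa> \<le> E" using \<kappa>0 \<kappa>_le by (auto simp: E_def)
        have "(2 * t / s)\<^sup>2 = 4 * (t / s)\<^sup>2" by (simp add: power_divide power_mult_distrib)
        also have "\<dots> = 4 * C1\<^sup>2 * (sqrt nR + nr)\<^sup>2" by (simp add: t_eq power_mult_distrib)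
        also have "\<dots> \<le> 4 * C1\<^sup>2 * (2 * ((sqrt nR)\<^sup>2 + nr\<^sup>2))" by (intro mult_left_mono square_sum2_le) auto
        also have "\<dots> = 8 * C1\<^sup>2 * (nR + nr\<^sup>2)" using nR0 by simp
        also have "\<dots> \<le> 8 * C1\<^sup>2 * BR" using BR by (intro mult_left_mono) auto
        finally have \<eta>2: "4 * (2 * t / s)\<^sup>2 \<le> 32 * C1\<^sup>2 * BR" by linarith
        have a1: "4 * (2 * t / s)\<^sup>2 * (sig\<^sup>2 + \<kappa>)\<^sup>2 \<le> 32 * C1\<^sup>2 * BR * E\<^sup>2"
          using E\<kappa> BR by (intro mult_mono[OF \<eta>2] power_mono) auto
        have a2: "2 * (sig\<^sup>2 + \<kappa>) * Vb \<le> 2 * E * Vb" using E\<kappa> Vb0 by (intro mult_right_mono) auto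
        have a3: "\<kappa>\<^sup>2 \<le> C6\<^sup>2 * BR" unfolding \<kappa>2 using BR by (intro mult_left_mono) auto
        have a4: "4 * s / (real n * sig\<^sup>2) \<le> 4 / sig\<^sup>2 * BR"
        proof -
          have "4 / sig\<^sup>2 * (s / real n) \<le> 4 / sig\<^sup>2 * BR" using BR by (intro mult_left_mono) auto
          thus ?thesis by (simp add: mult.commute)
        qed
        have "4 * s / (real n * sig\<^sup>2) + (4 * (2 * t / s)\<^sup>2 * (sig\<^sup>2 + \<kappa>)\<^sup>2 + 2 * (sig\<^sup>2 + \<kappa>) * Vb + \<kappa>\<^sup>2) / sig ^ 4
          \<le> 4 / sig\<^sup>2 * BR + (32 * C1\<^sup>2 * BR * E\<^sup>2 + 2 * E * Vb + C6\<^sup>2 * BR) / sig ^ 4"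
          using a1 a2 a3 a4 \<open>0 < sig\<close> by (intro add_mono divide_right_mono) auto
        also have "\<dots> = C8 * BR + C9 * (Cv * V)"
          by (simp add: C8_def C9_def Vb[symmetric] add_divide_distrib algebra_simps)
        finally show ?thesis .
      qed
      have bounds: "risk p D th \<theta> \<le> bias_bd1 c7 n p lam k th ps + var_bd c7 \<delta> n p lam k + xi_bd c7 \<delta> n p lam k ps \<and>
          risk p D th \<theta> \<le> bias_bd2 c7 n p lam k th ps + var_bd c7 \<delta> n p lam k + xi_bd c7 \<delta> n p lam k ps"
        if "\<omega> \<in> A" and est: "is_est n p \<omega> w \<theta>" for \<omega> \<theta>
      proof -
        have good: "good_sample k t (\<lambda>i. ps i - th i) ps \<kappa> Vb \<omega>" using that by (simp add: A_def)
        have "risk p D th \<theta> \<le> 1800 * bias (\<lambda>i. ps i - th i) + 3 * Vb + 7200 * bias ps * (4 * s / (real n * sig\<^sup>2)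
         + (4 * (2 * t / s)\<^sup>2 * (sig\<^sup>2 + \<kappa>)\<^sup>2 + 2 * (sig\<^sup>2 + \<kappa>) * Vb + \<kappa>\<^sup>2) / sig ^ 4)"
          unfolding bias_def
          by (rule good_sample_estimator(2)[OF good _ s_sum s0 t0 t4 small ps norms \<kappa>0 est]) (use kp(1) in auto)
        hence "risk p D th \<theta> \<le> 1800 * bias (\<lambda>i. ps i - th i) + c7 * V + c7 * lam 0 * (nrm p ps)\<^sup>2 * BR * M"
          using b bias0 V0 BR s0 Cv C8 C9 \<open>0 < sig\<close> bias_le[of ps] bias_ps snM T
          by (intro excess_terms_le[where Bp="bias ps" and P="(nrm p ps)\<^sup>2" and sn="s / real n" and sg=sig
                and Cv=Cv and ?C8.0=C8 and ?C9.0=C9 and b=b and V=V and BR=BR and ?l0.0="lam 0" and M=M])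
            (auto simp: Vb c7_def)
        moreover have "c7 * V = var_bd c7 \<delta> n p lam k" by (simp add: V_def var_bd_def L_def nR_def)
        moreover have "c7 * lam 0 * (nrm p ps)\<^sup>2 * BR * M = xi_bd c7 \<delta> n p lam k ps"
          by (simp add: xi_bd_def BR_def M_def nR_def L_def s_def)
        moreover have "1800 * bias (\<lambda>i. ps i - th i) \<le> bias_bd1 c7 n p lam k th ps"
        proof -
          have "1800 * 1 \<le> 1800 * b" using b by simp
          hence "1800 * bias (\<lambda>i. th i - ps i) \<le> c7 * bias (\<lambda>i. th i - ps i)" using c7 bias0 by (intro mult_right_mono) auto
          also have "\<dots> = bias_bd1 c7 n p lam k th ps" by (simp add: bias_bd1_def bias_def s_def sum_distrib_left mult.commute)
          finally show ?thesis unfolding bias_minus .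
        qed
        moreover have "1800 * bias (\<lambda>i. ps i - th i) \<le> bias_bd2 c7 n p lam k th ps"
        proof -
          let ?q = "(nrm p (\<lambda>i. th i - ps i))\<^sup>2 * (s / real n)"
          have q0: "0 \<le> ?q" using s0 by simp
          have "1800 * bias (\<lambda>i. th i - ps i) \<le> 1800 * (b * ?q)" using bias_le[of "\<lambda>i. th i - ps i"] by (simp add: mult.assoc)
          also have "\<dots> = (1800 * b) * ?q" by simp
          also have "\<dots> \<le> (2 * c7) * ?q" using c7 c7_pos q0 by (intro mult_right_mono) auto
          also have "\<dots> = bias_bd2 c7 n p lam k th ps" by (simp add: bias_bd2_def s_def)
          finally show ?thesis unfolding bias_minus .
        qed
        ultimately show ?thesis by linarith
      qed
      have exist: "\<exists>\<theta>. is_est n p \<omega> w \<theta>" if "\<omega> \<in> A" for \<omega>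
      proof (rule good_sample_estimator(1)[OF _ _ s_sum s0 t0 t4 small ps norms \<kappa>0])
        show "good_sample k t (\<lambda>i. ps i - th i) ps \<kappa> Vb \<omega>" using that by (simp add: A_def)
      qed (use kp(1) in auto)
      have sub: "A \<subseteq> space (sample n D)" by (auto simp: A_def)
      show "\<exists>A \<in> sets (sample n D).
          A \<subseteq> {\<omega> \<in> space (sample n D).
                 (\<exists>\<theta>. is_est n p \<omega> (initw p \<theta>0) \<theta>) \<and>
                 (\<forall>\<theta>. is_est n p \<omega> (initw p \<theta>0) \<theta> \<longrightarrow>
                    (let k = kidx b n p lam; ps = psi sig b n p lam (initw p \<theta>0) in
                     risk p D th \<theta> \<le> bias_bd1 c7 n p lam k th ps + var_bd c7 \<delta> n p lam k
                                        + xi_bd c7 \<delta> n p lam k ps \<and>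
                     risk p D th \<theta> \<le> bias_bd2 c7 n p lam k th ps + var_bd c7 \<delta> n p lam k
                                        + xi_bd c7 \<delta> n p lam k ps))} \<and>
          1 - 14 * \<delta> \<le> measure (sample n D) A"
        unfolding Let_def w_def[symmetric] k_def[symmetric] ps_def[symmetric]
        using A prob exist bounds sub by (intro bexI[of _ A] conjI subsetI CollectI allI impI) auto
    qed auto
  qed
qed

end
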